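(* Let $\eta_0\in H^2_{\mathrm{od}}(\mathbb{T}^2)$. Then there exist $T_0>0$ and a constant $C_{\epsilon,\beta,\delta,\eta_0}$, both depending on $\eta_0,\epsilon,\beta,\delta$, such that the solution $\eta$ of the initial value problem $$\eta_t+\eta\eta_x+(\beta-1)\eta_{xx}-\eta_{yy}-\delta\Lambda^3\eta+\epsilon\Delta^2\eta=0,\quad (x,y)\in\mathbb{T}^2,\ t>0,\qquad \eta(x,y,0)=\eta_0(x,y),$$ satisfies $$\|e^{\sigma(t)\Lambda}\eta(t)\|_{L^2}^2\le 1+2C_{\epsilon,\beta,\delta,\eta_0}^2\qquad\text{for all } t>0,$$ where $\sigma(t)=\min\{\tanh(t),\tanh(T_0/2)\}$. In particular, $\eta(\cdot,\cdot,t)$ is (real) analytic in the spatial variables for every $t>0$.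
   Context: $\mathbb{T}^2=[0,2\pi]^2$ with periodic boundary conditions; functions are real-valued. Fourier coefficients are $\widehat{\eta}(\xi)=(2\pi)^{-2}\int_{\mathbb{T}^2}e^{-i\xi_1x-i\xi_2y}\eta(x,y)\,dx\,dy$, $\xi\in\mathbb{Z}^2$. The operator $\Lambda$ is defined by $\widehat{\Lambda u}(\xi)=|\xi|\widehat{u}(\xi)$ with $|\xi|=(\xi_1^2+\xi_2^2)^{1/2}$, and $e^{\sigma\Lambda}$ by $\widehat{e^{\sigma\Lambda}u}(\xi)=e^{\sigma|\xi|}\widehat{u}(\xi)$. The parameters are $\beta>0$, $\delta=\gamma\lambda$ and $\epsilon=\lambda^2$, where $0\le\gamma\le 2$ and $\lambda=2\pi/L$ with $L>0$. The space of data that are odd in $x$ is $$H^2_{\mathrm{od}}(\mathbb{T}^2)=\{\eta\in H^2(\mathbb{T}^2): -\eta(-x,y)=\eta(x,y)\ \forall (x,y)\in\mathbb{T}^2\}.$$ "The solution" is the unique global solution, belonging to $C([0,T];H^2(\mathbb{T}^2))\cap L^2(0,T;H^4(\mathbb{T}^2))$ for every $0<T<\infty$. *)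

theory Defs
  imports "HOL-Analysis.Analysis"
begin

text \<open>
  Functions on the torus are represented by functions on the plane that are $2\pi$-periodic in each
  variable; elements of $L^2$ and $H^s$ are such functions, every notion below being invariant
  under changes on null sets.
\<close>

definition torus :: "(real \<times> real) measure" where
  "torus = restrict_space lebesgue ({0..2 * pi} \<times> {0..2 * pi})"

definition torus_periodic :: "(real \<times> real \<Rightarrow> real) \<Rightarrow> bool" where
  "torus_periodic u \<longleftrightarrow> (\<forall>x y. u (x + 2 * pi, y) = u (x, y) \<and> u (x, y + 2 * pi) = u (x, y))"

definition L2_torus :: "(real \<times> real \<Rightarrow> real) set" where
  "L2_torus = {u. torus_periodic u \<and> u \<in> borel_measurable torus \<and> integrable torus (\<lambda>z. (u z)\<^sup>2)}"

definition L2_norm :: "(real \<times> real \<Rightarrow> real) \<Rightarrow> real" where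
  "L2_norm u = sqrt (\<integral>z. (u z)\<^sup>2 \<partial>torus)"

definition fourier :: "(real \<times> real \<Rightarrow> real) \<Rightarrow> int \<times> int \<Rightarrow> complex" where
  "fourier u \<xi> = complex_of_real (1 / (2 * pi)\<^sup>2) *
     (\<integral>z. exp (- \<i> * complex_of_real (of_int (fst \<xi>) * fst z)
             - \<i> * complex_of_real (of_int (snd \<xi>) * snd z)) * complex_of_real (u z) \<partial>torus)"

definition freq_norm :: "int \<times> int \<Rightarrow> real" where
  "freq_norm \<xi> = sqrt ((of_int (fst \<xi>))\<^sup>2 + (of_int (snd \<xi>))\<^sup>2)"

definition Sobolev :: "nat \<Rightarrow> (real \<times> real \<Rightarrow> real) set" where
  "Sobolev s = {u \<in> L2_torus. (\<lambda>\<xi>. (1 + (freq_norm \<xi>)\<^sup>2) ^ s * (cmod (fourier u \<xi>))\<^sup>2) summable_on UNIV}"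

definition Sobolev_norm :: "nat \<Rightarrow> (real \<times> real \<Rightarrow> real) \<Rightarrow> real" where
  "Sobolev_norm s u = sqrt (\<Sum>\<^sub>\<infinity>\<xi>. (1 + (freq_norm \<xi>)\<^sup>2) ^ s * (cmod (fourier u \<xi>))\<^sup>2)"

text \<open>
  Since $H^2(\mathbb{T}^2)$ embeds into the continuous functions, oddness almost everywhere is
  oddness at every point of the continuous representative.
\<close>

definition H2_od :: "(real \<times> real \<Rightarrow> real) set" where
  "H2_od = {u \<in> Sobolev 2. AE z in lebesgue. - u (- fst z, snd z) = u z}"

text \<open>
  The operator with symbol \<open>m\<close> sends \<open>u\<close> to the $L^2$ function whose Fourier coefficients are
  $m(\xi)\,\widehat{u}(\xi)$. That function is unique up to null sets, and it exists exactly when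
  \<open>u\<close> lies in the domain.
\<close>

definition multiplier_domain :: "(int \<times> int \<Rightarrow> complex) \<Rightarrow> (real \<times> real \<Rightarrow> real) set" where
  "multiplier_domain m = {u \<in> L2_torus. \<exists>v\<in>L2_torus. \<forall>\<xi>. fourier v \<xi> = m \<xi> * fourier u \<xi>}"

definition multiplier ::
  "(int \<times> int \<Rightarrow> complex) \<Rightarrow> (real \<times> real \<Rightarrow> real) \<Rightarrow> real \<times> real \<Rightarrow> real" where
  "multiplier m u = (SOME v. v \<in> L2_torus \<and> (\<forall>\<xi>. fourier v \<xi> = m \<xi> * fourier u \<xi>))"

text \<open>
  Distributional derivatives of periodic functions: testing against the characters
  $e^{-i\xi\cdot z}$ and integrating by parts yields the symbols $i\xi_1$ and $i\xi_2$.
\<close>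

definition Dx :: "(real \<times> real \<Rightarrow> real) \<Rightarrow> real \<times> real \<Rightarrow> real" where
  "Dx = multiplier (\<lambda>\<xi>. \<i> * of_int (fst \<xi>))"

definition Dy :: "(real \<times> real \<Rightarrow> real) \<Rightarrow> real \<times> real \<Rightarrow> real" where
  "Dy = multiplier (\<lambda>\<xi>. \<i> * of_int (snd \<xi>))"

definition Laplacian :: "(real \<times> real \<Rightarrow> real) \<Rightarrow> real \<times> real \<Rightarrow> real" where
  "Laplacian u = (\<lambda>z. Dx (Dx u) z + Dy (Dy u) z)"

definition Lambda :: "(real \<times> real \<Rightarrow> real) \<Rightarrow> real \<times> real \<Rightarrow> real" where
  "Lambda = multiplier (\<lambda>\<xi>. complex_of_real (freq_norm \<xi>))"

definition exp_Lambda_symbol :: "real \<Rightarrow> int \<times> int \<Rightarrow> complex" where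
  "exp_Lambda_symbol \<sigma> \<xi> = complex_of_real (exp (\<sigma> * freq_norm \<xi>))"

definition exp_Lambda :: "real \<Rightarrow> (real \<times> real \<Rightarrow> real) \<Rightarrow> real \<times> real \<Rightarrow> real" where
  "exp_Lambda \<sigma> = multiplier (exp_Lambda_symbol \<sigma>)"

definition C_time_Sobolev :: "real \<Rightarrow> nat \<Rightarrow> (real \<Rightarrow> real \<times> real \<Rightarrow> real) set" where
  "C_time_Sobolev T s = {u. \<forall>t\<in>{0..T}. u t \<in> Sobolev s \<and>
     ((\<lambda>r. Sobolev_norm s (\<lambda>z. u r z - u t z)) \<longlongrightarrow> 0) (at t within {0..T})}"

text \<open>
  The Bochner space $L^2(0,T;H^s)$. As $H^s$ is separable, strong measurability amounts to
  measurability of every Fourier coefficient.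
\<close>

definition L2_time_Sobolev :: "real \<Rightarrow> nat \<Rightarrow> (real \<Rightarrow> real \<times> real \<Rightarrow> real) set" where
  "L2_time_Sobolev T s = {u.
     (AE t in lebesgue. t \<in> {0..T} \<longrightarrow> u t \<in> Sobolev s) \<and>
     (\<forall>\<xi>. set_borel_measurable lebesgue {0..T} (\<lambda>t. fourier (u t) \<xi>)) \<and>
     set_integrable lebesgue {0..T} (\<lambda>t. (Sobolev_norm s (u t))\<^sup>2)}"

text \<open>
  \<open>w\<close> is the time derivative of \<open>u\<close>, locally square integrable with values in $L^2$:
  $u(t) = u(0) + \int_0^t w(s)\,ds$ as an identity in $L^2$, expressed through Fourier coefficients.
\<close>

definition has_time_derivative ::
  "(real \<Rightarrow> real \<times> real \<Rightarrow> real) \<Rightarrow> (real \<Rightarrow> real \<times> real \<Rightarrow> real) \<Rightarrow> bool" where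
  "has_time_derivative u w \<longleftrightarrow>
     (\<forall>T>0. w \<in> L2_time_Sobolev T 0) \<and>
     (\<forall>t\<ge>0. \<forall>\<xi>. fourier (u t) \<xi> - fourier (u 0) \<xi> = (LINT s:{0..t}|lebesgue. fourier (w s) \<xi>))"

text \<open>
  For such \<open>\<eta>\<close> every term of the equation lies in $L^2$ for almost every time, so the equation is
  required almost everywhere in space for almost every time.
\<close>

definition global_solution ::
  "real \<Rightarrow> real \<Rightarrow> real \<Rightarrow> (real \<times> real \<Rightarrow> real) \<Rightarrow> (real \<Rightarrow> real \<times> real \<Rightarrow> real) \<Rightarrow> bool" where
  "global_solution \<beta> \<delta> \<epsilon> \<eta>\<^sub>0 \<eta> \<longleftrightarrow>
     (\<forall>T>0. \<eta> \<in> C_time_Sobolev T 2 \<inter> L2_time_Sobolev T 4) \<and>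
     (AE z in torus. \<eta> 0 z = \<eta>\<^sub>0 z) \<and>
     (\<exists>\<eta>\<^sub>t. has_time_derivative \<eta> \<eta>\<^sub>t \<and>
       (AE t in lebesgue. t > 0 \<longrightarrow> (AE z in torus.
          \<eta>\<^sub>t t z + \<eta> t z * Dx (\<eta> t) z + (\<beta> - 1) * Dx (Dx (\<eta> t)) z - Dy (Dy (\<eta> t)) z
          - \<delta> * (Lambda ^^ 3) (\<eta> t) z + \<epsilon> * Laplacian (Laplacian (\<eta> t)) z = 0)))"

definition real_analytic :: "(real \<times> real \<Rightarrow> real) \<Rightarrow> bool" where
  "real_analytic g \<longleftrightarrow> (\<forall>x\<^sub>0 y\<^sub>0. \<exists>r>0. \<exists>a :: nat \<times> nat \<Rightarrow> real. \<forall>x y.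
     \<bar>x - x\<^sub>0\<bar> < r \<longrightarrow> \<bar>y - y\<^sub>0\<bar> < r \<longrightarrow>
     ((\<lambda>(j, k). a (j, k) * (x - x\<^sub>0) ^ j * (y - y\<^sub>0) ^ k) has_sum g (x, y)) UNIV)"

end

theory Submission
  imports Defs
begin

text \<open>
  The equation is an infinite system of ordinary differential equations for the Fourier
  coefficients \<open>a t \<xi>\<close> of the solution, and every estimate is a maximum principle for finitely many
  modes (lemma \<open>barrier\<close>). Oddness in \<open>x\<close> is preserved, because the even part solves a linear
  equation. For odd data a Lyapunov functional $\frac12\|\eta\|^2-\langle\phi,\eta\rangle$ in the style of
  Nicolaenko, Scheurer and Temam bounds the $L^2$ norm uniformly in time, and the dissipation turns this
  into a uniform bound $|\widehat\eta(t,\xi)|\le M/\langle\xi\rangle^2$. From any starting time, the weighted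
  coefficients $e^{\tau|\xi|}|\widehat\eta(s+\tau,\xi)|$ then stay below $3M/\langle\xi\rangle^2$ for a time
  that depends on \<open>M\<close> only, which gives the Gevrey bound for all times and hence analyticity.
\<close>

text \<open>Every barrier is a multiple of \<open>1 / bracket \<xi>\<close>, where
  \<open>bracket\<close> is the square of the Japanese bracket. This decay is square summable on a
  two-dimensional lattice, so the quadratic term is controlled by Cauchy-Schwarz alone. Relative to
  the barrier it costs a derivative and a factor \<open>bracket\<close>, about |\<xi>|^3, and is
  beaten by the symbol of order four. Since only finitely many modes may ever come near a barrier, a
  majorant of the modes that is independent of time is needed before each such argument.

  The obstacle to a bound uniform in time is the linear growth at low frequencies, which the energy
  identity does not see because the nonlinearity conserves the L2 norm. The auxiliary profile is to
  supply damping through its slope. A periodic function cannot have positive slope everywhere, so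
  the bad slope is placed near x = 0, where odd functions vanish.

  Uniformity cannot be relaxed: the Gevrey estimate is restarted shortly before each time t, and one
  lifespan must serve for all t and for every solution with the given data.\<close>

definition bracket :: "int \<times> int \<Rightarrow> real" where
  "bracket \<xi> = 1 + (freq_norm \<xi>)\<^sup>2"

text \<open>The reflection x -> -x seen on frequencies: by \<open>fourier_odd\<close>, oddness in x
  becomes antisymmetry of the coefficients under it.\<close>

definition reflect :: "int \<times> int \<Rightarrow> int \<times> int" where
  "reflect \<xi> = (- fst \<xi>, snd \<xi>)"

definition sq_summable :: "('i \<Rightarrow> complex) \<Rightarrow> bool" where
  "sq_summable a \<longleftrightarrow> (\<lambda>i. (cmod (a i))\<^sup>2) summable_on UNIV"

definition sqsum :: "('i \<Rightarrow> complex) \<Rightarrow> real" where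
  "sqsum a = (\<Sum>\<^sub>\<infinity>i. (cmod (a i))\<^sup>2)"

text \<open>Coefficients of the product of two Fourier series. A divergent sum is 0 by the
  convention of \<open>infsum\<close>, so the identities that split the sum assume square
  summability.\<close>

definition conv :: "('g::ab_group_add \<Rightarrow> complex) \<Rightarrow> ('g \<Rightarrow> complex) \<Rightarrow> 'g \<Rightarrow> complex" where
  "conv a b \<xi> = (\<Sum>\<^sub>\<infinity>k. a k * b (\<xi> - k))"

definition lattice_const :: real where
  "lattice_const = (\<Sum>\<^sub>\<infinity>\<xi>. 1 / (bracket \<xi>)\<^sup>2)"

section \<open>Square-summable families and convolution\<close>

lemma infsum_Cauchy_Schwarz:
  fixes f g :: "'i \<Rightarrow> real"
  assumes f: "(\<lambda>i. (f i)\<^sup>2) summable_on A" and g: "(\<lambda>i. (g i)\<^sup>2) summable_on A"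
  shows "(\<lambda>i. \<bar>f i * g i\<bar>) summable_on A"
    and "(\<Sum>\<^sub>\<infinity>i\<in>A. \<bar>f i * g i\<bar>) \<le> sqrt (\<Sum>\<^sub>\<infinity>i\<in>A. (f i)\<^sup>2) * sqrt (\<Sum>\<^sub>\<infinity>i\<in>A. (g i)\<^sup>2)"
proof -
  have fin: "(\<Sum>i\<in>F. \<bar>f i * g i\<bar>) \<le> sqrt (\<Sum>\<^sub>\<infinity>i\<in>A. (f i)\<^sup>2) * sqrt (\<Sum>\<^sub>\<infinity>i\<in>A. (g i)\<^sup>2)"
    if "finite F" "F \<subseteq> A" for F
  proof -
    have "(\<Sum>i\<in>F. \<bar>f i * g i\<bar>) \<le> L2_set f F * L2_set g F"
      using L2_set_mult_ineq[of f g F] by (simp add: abs_mult)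
    also have "\<dots> \<le> sqrt (\<Sum>\<^sub>\<infinity>i\<in>A. (f i)\<^sup>2) * sqrt (\<Sum>\<^sub>\<infinity>i\<in>A. (g i)\<^sup>2)"
      unfolding L2_set_def using that f g
      by (intro mult_mono real_sqrt_le_mono finite_sum_le_infsum)
        (auto intro!: infsum_nonneg sum_nonneg)
    finally show ?thesis .
  qed
  show 1: "(\<lambda>i. \<bar>f i * g i\<bar>) summable_on A"
    by (rule nonneg_bdd_above_summable_on) (auto intro!: bdd_aboveI2 fin)
  show "(\<Sum>\<^sub>\<infinity>i\<in>A. \<bar>f i * g i\<bar>) \<le> sqrt (\<Sum>\<^sub>\<infinity>i\<in>A. (f i)\<^sup>2) * sqrt (\<Sum>\<^sub>\<infinity>i\<in>A. (g i)\<^sup>2)"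
    by (rule infsum_le_finite_sums[OF 1]) (use fin in auto)
qed

lemma sq_summable_add:
  assumes "sq_summable a" "sq_summable b"
  shows "sq_summable (\<lambda>i. a i + b i)" and "sqsum (\<lambda>i. a i + b i) \<le> 2 * sqsum a + 2 * sqsum b"
proof -
  have le: "(cmod (a i + b i))\<^sup>2 \<le> 2 * (cmod (a i))\<^sup>2 + 2 * (cmod (b i))\<^sup>2" for i
  proof -
    have "(cmod (a i + b i))\<^sup>2 \<le> (cmod (a i) + cmod (b i))\<^sup>2"
      by (simp add: norm_triangle_ineq power_mono)
    also have "\<dots> \<le> 2 * (cmod (a i))\<^sup>2 + 2 * (cmod (b i))\<^sup>2"
      using sum_squares_bound[of "cmod (a i)" "cmod (b i)"] by (simp add: power2_sum)
    finally show ?thesis .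
  qed
  have s: "(\<lambda>i. 2 * (cmod (a i))\<^sup>2 + 2 * (cmod (b i))\<^sup>2) summable_on UNIV"
    using assms unfolding sq_summable_def by (intro summable_on_add summable_on_cmult_right)
  show 1: "sq_summable (\<lambda>i. a i + b i)"
    unfolding sq_summable_def by (rule summable_on_comparison_test[OF s]) (use le in auto)
  have "sqsum (\<lambda>i. a i + b i) \<le> (\<Sum>\<^sub>\<infinity>i. 2 * (cmod (a i))\<^sup>2 + 2 * (cmod (b i))\<^sup>2)"
    unfolding sqsum_def by (rule infsum_mono) (use 1 s le in \<open>auto simp: sq_summable_def\<close>)
  also have "\<dots> = 2 * sqsum a + 2 * sqsum b"
    unfolding sqsum_def using assms unfolding sq_summable_def
    by (simp add: infsum_add summable_on_cmult_right infsum_cmult_right)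
  finally show "sqsum (\<lambda>i. a i + b i) \<le> 2 * sqsum a + 2 * sqsum b" .
qed

lemma sqsum_nonneg: "sqsum a \<ge> 0"
  unfolding sqsum_def by (rule infsum_nonneg) auto

lemma sqsum_uminus [simp]: "sqsum (\<lambda>i. - a i) = sqsum a"
  and sq_summable_uminus [simp]: "sq_summable (\<lambda>i. - a i) = sq_summable a"
  by (simp_all add: sqsum_def sq_summable_def)

lemma sq_summable_diff:
  assumes "sq_summable a" "sq_summable b"
  shows "sq_summable (\<lambda>i. a i - b i)" and "sqsum (\<lambda>i. a i - b i) \<le> 2 * sqsum a + 2 * sqsum b"
  using sq_summable_add[of a "\<lambda>i. - b i"] assms by simp_all

lemma norm_le_sqsum:
  assumes "sq_summable a"
  shows "(cmod (a i))\<^sup>2 \<le> sqsum a"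
  using finite_sum_le_infsum[of "\<lambda>i. (cmod (a i))\<^sup>2" UNIV "{i}"] assms
  by (simp add: sq_summable_def sqsum_def)

lemma norm_le_sqrt_sqsum:
  assumes "sq_summable a"
  shows "cmod (a i) \<le> sqrt (sqsum a)"
  using norm_le_sqsum[OF assms] by (simp add: real_le_rsqrt)

lemma sqsum_mono:
  assumes "sq_summable b" "\<And>i. cmod (a i) \<le> cmod (b i)"
  shows "sq_summable a" "sqsum a \<le> sqsum b"
proof -
  have le: "(cmod (a i))\<^sup>2 \<le> (cmod (b i))\<^sup>2" for i
    using assms(2) by (simp add: power_mono)
  show 1: "sq_summable a"
    unfolding sq_summable_def
    by (rule summable_on_comparison_test[of "\<lambda>i. (cmod (b i))\<^sup>2"]) (use assms(1) le in \<open>auto simp: sq_summable_def\<close>)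
  show "sqsum a \<le> sqsum b"
    unfolding sqsum_def
    by (rule infsum_mono) (use 1 assms(1) le in \<open>auto simp: sq_summable_def\<close>)
qed

lemma bij_diff_left: "bij (\<lambda>k. \<xi> - k :: 'g::ab_group_add)"
  by (rule bij_betw_byWitness[where f' = "\<lambda>k. \<xi> - k"]) auto

lemma sq_summable_shift [simp]: "sq_summable (\<lambda>k. a (\<xi> - k)) = sq_summable (a :: 'g::ab_group_add \<Rightarrow> complex)"
  unfolding sq_summable_def
  using summable_on_reindex_bij_betw[OF bij_diff_left[of \<xi>], of "\<lambda>k. (cmod (a k))\<^sup>2"] by simp

lemma sqsum_shift [simp]: "sqsum (\<lambda>k. a (\<xi> - k)) = sqsum (a :: 'g::ab_group_add \<Rightarrow> complex)"
  unfolding sqsum_def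
  using infsum_reindex_bij_betw[OF bij_diff_left[of \<xi>], of "\<lambda>k. (cmod (a k))\<^sup>2"] by simp

lemma conv_abs_summable:
  fixes a b :: "'g::ab_group_add \<Rightarrow> complex"
  assumes "sq_summable a" "sq_summable b"
  shows "(\<lambda>k. cmod (a k * b (\<xi> - k))) summable_on UNIV"
    and "(\<Sum>\<^sub>\<infinity>k. cmod (a k * b (\<xi> - k))) \<le> sqrt (sqsum a) * sqrt (sqsum b)"
proof -
  have b: "sq_summable (\<lambda>k. b (\<xi> - k))" using assms by simp
  show "(\<lambda>k. cmod (a k * b (\<xi> - k))) summable_on UNIV"
    using infsum_Cauchy_Schwarz(1)[of "\<lambda>k. cmod (a k)" UNIV "\<lambda>k. cmod (b (\<xi> - k))"] assms(1)[unfolded sq_summable_def] b[unfolded sq_summable_def]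
    by (simp add: norm_mult)
  have "(\<Sum>\<^sub>\<infinity>k. cmod (a k * b (\<xi> - k))) \<le> sqrt (sqsum a) * sqrt (sqsum (\<lambda>k. b (\<xi> - k)))"
    using infsum_Cauchy_Schwarz(2)[of "\<lambda>k. cmod (a k)" UNIV "\<lambda>k. cmod (b (\<xi> - k))"] assms(1)[unfolded sq_summable_def] b[unfolded sq_summable_def]
    unfolding sqsum_def norm_mult by simp
  then show "(\<Sum>\<^sub>\<infinity>k. cmod (a k * b (\<xi> - k))) \<le> sqrt (sqsum a) * sqrt (sqsum b)" by simp
qed

lemma conv_summable:
  fixes a b :: "'g::ab_group_add \<Rightarrow> complex"
  assumes "sq_summable a" "sq_summable b"
  shows "(\<lambda>k. a k * b (\<xi> - k)) summable_on UNIV"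
  by (rule abs_summable_summable) (rule conv_abs_summable[OF assms])

lemma norm_conv_le:
  assumes "sq_summable a" "sq_summable b"
  shows "cmod (conv a b \<xi>) \<le> sqrt (sqsum a) * sqrt (sqsum b)"
proof -
  have "cmod (conv a b \<xi>) \<le> (\<Sum>\<^sub>\<infinity>k. cmod (a k * b (\<xi> - k)))"
    unfolding conv_def by (rule norm_infsum_bound) (rule conv_abs_summable[OF assms])
  then show ?thesis using conv_abs_summable(2)[OF assms, of \<xi>] by linarith
qed

lemma conv_commute: "conv a b \<xi> = conv b a \<xi>"
  unfolding conv_def
  using infsum_reindex_bij_betw[OF bij_diff_left[of \<xi>], of "\<lambda>k. a k * b (\<xi> - k)"]
  by (simp add: mult.commute)

text \<open>Difference of two squares; the cross terms cancel by commutativity. It makes the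
  quadratic term linear in a difference, which serves both the equation for the even part and the
  continuity in time of the nonlinearity.\<close>

lemma conv_diff_sq:
  assumes "sq_summable a" "sq_summable b"
  shows "conv a a \<xi> - conv b b \<xi> = conv (\<lambda>k. a k - b k) (\<lambda>k. a k + b k) \<xi>"
proof -
  note s = conv_summable[OF assms(1) assms(1), of \<xi>] conv_summable[OF assms(1) assms(2), of \<xi>]
    conv_summable[OF assms(2) assms(1), of \<xi>] conv_summable[OF assms(2) assms(2), of \<xi>]
  have "conv (\<lambda>k. a k - b k) (\<lambda>k. a k + b k) \<xi> =
    (\<Sum>\<^sub>\<infinity>k. (a k * a (\<xi> - k) - b k * b (\<xi> - k)) + (a k * b (\<xi> - k) - b k * a (\<xi> - k)))"
    unfolding conv_def by (intro infsum_cong) (simp add: algebra_simps)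
  also have "\<dots> = (\<Sum>\<^sub>\<infinity>k. a k * a (\<xi> - k)) - (\<Sum>\<^sub>\<infinity>k. b k * b (\<xi> - k))
      + ((\<Sum>\<^sub>\<infinity>k. a k * b (\<xi> - k)) - (\<Sum>\<^sub>\<infinity>k. b k * a (\<xi> - k)))"
  proof -
    have d: "(\<Sum>\<^sub>\<infinity>k. f k - g k) = infsum f UNIV - infsum g UNIV"
      and sd: "(\<lambda>k. f k - g k) summable_on UNIV"
      if "f summable_on UNIV" "g summable_on UNIV" for f g :: "'a \<Rightarrow> complex"
      using infsum_add[OF that(1), of "\<lambda>k. - g k"] that(2) summable_on_add[OF that(1), of "\<lambda>k. - g k"]
      by (simp_all add: infsum_uminus summable_on_uminus)
    show ?thesis
      using s by (simp add: infsum_add d sd)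
  qed
  also have "\<dots> = conv a a \<xi> - conv b b \<xi>"
    using conv_commute[of a b \<xi>] by (simp add: conv_def)
  finally show ?thesis by simp
qed

subsection \<open>Weights on the lattice\<close>

lemma freq_norm_sq: "(freq_norm \<xi>)\<^sup>2 = (of_int (fst \<xi>))\<^sup>2 + (of_int (snd \<xi>))\<^sup>2"
  by (simp add: freq_norm_def)

lemma freq_norm_nonneg [simp]: "freq_norm \<xi> \<ge> 0"
  by (simp add: freq_norm_def)

lemma freq_norm_uminus [simp]: "freq_norm (- \<xi>) = freq_norm \<xi>"
  and freq_norm_reflect [simp]: "freq_norm (reflect \<xi>) = freq_norm \<xi>"
  by (simp_all add: freq_norm_def reflect_def)

lemma bracket_uminus [simp]: "bracket (- \<xi>) = bracket \<xi>"
  and bracket_reflect [simp]: "bracket (reflect \<xi>) = bracket \<xi>"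
  by (simp_all add: bracket_def)

lemma bracket_ge_1 [simp]: "bracket \<xi> \<ge> 1"
  by (simp add: bracket_def)

lemma bracket_pos [simp]: "bracket \<xi> > 0"
  using bracket_ge_1[of \<xi>] by linarith

lemma bracket_nonneg [simp]: "bracket \<xi> \<ge> 0"
  using bracket_ge_1[of \<xi>] by linarith

lemma bracket_nz [simp]: "bracket \<xi> \<noteq> 0"
  using bracket_ge_1[of \<xi>] by linarith

lemma abs_fst_le_freq_norm: "\<bar>of_int (fst \<xi>)\<bar> \<le> freq_norm \<xi>"
  unfolding freq_norm_def by (rule real_le_rsqrt) simp

lemma abs_snd_le_freq_norm: "\<bar>of_int (snd \<xi>)\<bar> \<le> freq_norm \<xi>"
  unfolding freq_norm_def by (rule real_le_rsqrt) simp

lemma fst_sq_le_bracket: "(of_int (fst \<xi>))\<^sup>2 \<le> bracket \<xi>"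
  by (simp add: bracket_def freq_norm_sq)

lemma freq_norm_le_bracket: "freq_norm \<xi> \<le> bracket \<xi>"
proof -
  have "0 \<le> (freq_norm \<xi> - 1)\<^sup>2" by simp
  then have "2 * freq_norm \<xi> \<le> 1 + (freq_norm \<xi>)\<^sup>2" unfolding power2_diff by simp
  with freq_norm_nonneg[of \<xi>] show ?thesis unfolding bracket_def by linarith
qed

lemma abs_fst_le_bracket: "\<bar>of_int (fst \<xi>)\<bar> \<le> bracket \<xi>"
  using abs_fst_le_freq_norm[of \<xi>] freq_norm_le_bracket[of \<xi>] by linarith

lemma freq_norm_add: "freq_norm (\<xi> + \<zeta>) \<le> freq_norm \<xi> + freq_norm \<zeta>"
proof -
  have *: "freq_norm \<xi> = cmod (Complex (of_int (fst \<xi>)) (of_int (snd \<xi>)))" for \<xi>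
    by (simp add: freq_norm_def complex_norm)
  have "Complex (of_int (fst (\<xi> + \<zeta>))) (of_int (snd (\<xi> + \<zeta>))) =
    Complex (of_int (fst \<xi>)) (of_int (snd \<xi>)) + Complex (of_int (fst \<zeta>)) (of_int (snd \<zeta>))"
    by (simp add: complex_eq_iff)
  then show ?thesis unfolding * by (simp add: norm_triangle_ineq)
qed

lemma summable_on_inverse_int_sq: "(\<lambda>n::int. 1 / (1 + (of_int n)\<^sup>2) :: real) summable_on UNIV"
proof -
  have nat: "(\<lambda>n::nat. 1 / (1 + (of_nat n)\<^sup>2) :: real) summable_on UNIV"
  proof (rule summable_nonneg_imp_summable_on)
    show "summable (\<lambda>n::nat. 1 / (1 + (of_nat n)\<^sup>2) :: real)"
    proof (rule summable_comparison_test')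
      show "summable (\<lambda>n::nat. 1 / (of_nat n)\<^sup>2 :: real)"
        using inverse_power_summable[of 2, where 'a=real] by (simp add: inverse_eq_divide)
      show "norm (1 / (1 + (of_nat n)\<^sup>2) :: real) \<le> 1 / (of_nat n)\<^sup>2" if "n \<ge> 1" for n :: nat
        using that by (auto intro!: frac_le)
    qed
  qed auto
  have 1: "(\<lambda>n::int. 1 / (1 + (of_int n)\<^sup>2) :: real) summable_on (int ` UNIV)"
    by (subst summable_on_reindex) (use nat in \<open>auto simp: o_def\<close>)
  have 2: "(\<lambda>n::int. 1 / (1 + (of_int n)\<^sup>2) :: real) summable_on ((\<lambda>n. - int n) ` UNIV)"
    by (subst summable_on_reindex) (use nat in \<open>auto simp: o_def inj_on_def\<close>)
  have "(UNIV::int set) = int ` UNIV \<union> (\<lambda>n. - int n) ` UNIV"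
    by (auto simp: image_iff) (metis int_cases2)
  with summable_on_union[OF 1 2] show ?thesis by simp
qed

text \<open>Comparison with a product of two one-dimensional sums, through (1 + p)(1 + q) \<le> (1 +
  p + q)^2 for nonnegative p and q.\<close>

lemma summable_on_inverse_bracket_sq: "(\<lambda>\<xi>. 1 / (bracket \<xi>)\<^sup>2) summable_on UNIV"
proof -
  define f :: "int \<Rightarrow> real" where "f n = 1 / (1 + (of_int n)\<^sup>2)" for n
  have f0: "f n \<ge> 0" for n by (simp add: f_def)
  have "(\<lambda>(x,y). f x * f y) summable_on UNIV \<times> UNIV"
  proof (rule summable_on_SigmaI[where g = "\<lambda>x. f x * infsum f UNIV"])
    show "((\<lambda>y. case (x, y) of (x, y) \<Rightarrow> f x * f y) has_sum f x * infsum f UNIV) UNIV" for x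
    proof -
      have "(f has_sum infsum f UNIV) UNIV"
        using summable_on_inverse_int_sq by (simp add: f_def[abs_def])
      then show ?thesis by (auto intro!: has_sum_cmult_right)
    qed
    show "(\<lambda>x. f x * infsum f UNIV) summable_on UNIV"
      using summable_on_inverse_int_sq by (intro summable_on_cmult_left) (auto simp: f_def[abs_def])
  qed (use f0 in auto)
  then have s: "(\<lambda>\<xi>. f (fst \<xi>) * f (snd \<xi>)) summable_on UNIV"
    by (simp add: case_prod_unfold)
  show ?thesis
  proof (rule summable_on_comparison_test[OF s])
    fix \<xi>
    have "(1 + (of_int (fst \<xi>))\<^sup>2) * (1 + (of_int (snd \<xi>))\<^sup>2) \<le> (bracket \<xi>)\<^sup>2"
      proof -
      have "(1 + p) * (1 + q) \<le> (1 + (p + q))\<^sup>2" if "p \<ge> 0" "q \<ge> 0" for p q :: real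
        using that by (simp add: power2_eq_square algebra_simps add_increasing)
      then show ?thesis unfolding bracket_def freq_norm_sq by simp
    qed
    then show "1 / (bracket \<xi>)\<^sup>2 \<le> f (fst \<xi>) * f (snd \<xi>)"
      unfolding f_def by (simp add: frac_le add_pos_nonneg)
  qed auto
qed

lemma lattice_const_pos: "lattice_const > 0"
proof -
  have "(\<Sum>\<xi>\<in>{0}. 1 / (bracket \<xi>)\<^sup>2) \<le> lattice_const" unfolding lattice_const_def
    by (rule finite_sum_le_infsum) (use summable_on_inverse_bracket_sq in auto)
  moreover have "bracket 0 = 1" by (simp add: bracket_def freq_norm_def)
  ultimately show ?thesis by simp
qed

lemma sqsum_le_of_bracket:
  assumes "\<And>\<xi>. cmod (a \<xi>) \<le> A / bracket \<xi>"
  shows "sq_summable a" and "sqsum a \<le> A\<^sup>2 * lattice_const"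
proof -
  have A: "A \<ge> 0" using assms[of 0] bracket_pos[of 0]
    by (metis norm_ge_zero order_trans zero_le_divide_iff not_le)
  have le: "(cmod (a \<xi>))\<^sup>2 \<le> A\<^sup>2 * (1 / (bracket \<xi>)\<^sup>2)" for \<xi>
    using power_mono[OF assms[of \<xi>], of 2] by (simp add: power_divide)
  have s: "(\<lambda>\<xi>. A\<^sup>2 * (1 / (bracket \<xi>)\<^sup>2)) summable_on UNIV"
    by (rule summable_on_cmult_right[OF summable_on_inverse_bracket_sq])
  show 1: "sq_summable a" unfolding sq_summable_def
    by (rule summable_on_comparison_test[OF s]) (use le in auto)
  have "sqsum a \<le> (\<Sum>\<^sub>\<infinity>\<xi>. A\<^sup>2 * (1 / (bracket \<xi>)\<^sup>2))"
    unfolding sqsum_def by (rule infsum_mono) (use 1 s le in \<open>auto simp: sq_summable_def\<close>)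
  also have "\<dots> = A\<^sup>2 * lattice_const"
    unfolding lattice_const_def by (rule infsum_cmult_right) (use summable_on_inverse_bracket_sq in auto)
  finally show "sqsum a \<le> A\<^sup>2 * lattice_const" .
qed

text \<open>Cauchy-Schwarz spends all the decay on convergence, so the bound is uniform in \<xi>
  instead of decaying. The factor \<open>bracket \<xi>\<close> lost against the barriers is
  recovered from the fourth-order dissipation.\<close>

lemma norm_conv_le_of_bracket:
  assumes a: "\<And>\<xi>. cmod (a \<xi>) \<le> A / bracket \<xi>" and b: "\<And>\<xi>. cmod (b \<xi>) \<le> B / bracket \<xi>"
  shows "(\<Sum>\<^sub>\<infinity>k. cmod (a k * b (\<xi> - k))) \<le> A * B * lattice_const"
    and "cmod (conv a b \<xi>) \<le> A * B * lattice_const"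
proof -
  have A: "A \<ge> 0" and B: "B \<ge> 0" using a[of 0] b[of 0] bracket_pos[of 0]
    by (metis norm_ge_zero order_trans zero_le_divide_iff not_le)+
  note sa = sqsum_le_of_bracket[of a, OF a] and sb = sqsum_le_of_bracket[of b, OF b]
  have "sqrt (sqsum a) * sqrt (sqsum b) \<le> sqrt (A\<^sup>2 * lattice_const) * sqrt (B\<^sup>2 * lattice_const)"
    using sa sb by (intro mult_mono real_sqrt_le_mono) (use lattice_const_pos in \<open>auto simp: sqsum_nonneg\<close>)
  also have "\<dots> = A * B * lattice_const"
    using A B lattice_const_pos by (simp add: real_sqrt_mult)
  finally have *: "sqrt (sqsum a) * sqrt (sqsum b) \<le> A * B * lattice_const" .
  show "(\<Sum>\<^sub>\<infinity>k. cmod (a k * b (\<xi> - k))) \<le> A * B * lattice_const"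
    using conv_abs_summable(2)[OF sa(1) sb(1), of \<xi>] * by linarith
  show "cmod (conv a b \<xi>) \<le> A * B * lattice_const"
    using norm_conv_le[OF sa(1) sb(1), of \<xi>] * by linarith
qed

text \<open>The product rule (u^2)_x = 2 u_x u on coefficients: the first component of \<xi> is
  split as that of k plus that of \<xi> - k, and the two resulting sums agree by
  commutativity.\<close>

lemma conv_first_moment:
  fixes a :: "int \<times> int \<Rightarrow> complex"
  assumes a: "sq_summable a" and a1: "sq_summable (\<lambda>k. of_int (fst k) * a k)"
  shows "of_int (fst \<xi>) * conv a a \<xi> = 2 * conv (\<lambda>k. of_int (fst k) * a k) a \<xi>"
proof -
  note s = conv_summable[OF a1 a, of \<xi>] conv_summable[OF a a1, of \<xi>]
  have "of_int (fst \<xi>) * conv a a \<xi> = (\<Sum>\<^sub>\<infinity>k. of_int (fst \<xi>) * (a k * a (\<xi> - k)))"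
    unfolding conv_def using conv_summable[OF a a] by (simp add: infsum_cmult_right)
  also have "\<dots> = (\<Sum>\<^sub>\<infinity>k. of_int (fst k) * a k * a (\<xi> - k) + a k * (of_int (fst (\<xi> - k)) * a (\<xi> - k)))"
    by (intro infsum_cong) (simp add: algebra_simps)
  also have "\<dots> = conv (\<lambda>k. of_int (fst k) * a k) a \<xi> + conv a (\<lambda>k. of_int (fst k) * a k) \<xi>"
    unfolding conv_def using s by (simp add: infsum_add)
  also have "\<dots> = 2 * conv (\<lambda>k. of_int (fst k) * a k) a \<xi>"
    by (simp add: conv_commute[of a])
  finally show ?thesis .
qed

subsection \<open>A maximum principle for the Fourier modes\<close>

text \<open>Consider the first time at which some mode of F reaches 0. It exists because a finite
  union of closed sets of times is closed, which is where the finiteness of F enters. At that time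
  all modes are still nonpositive, so \<open>touch\<close> applies, and its negative derivative
  would make the touching mode positive just before.\<close>

lemma barrier:
  fixes v v' :: "'i \<Rightarrow> real \<Rightarrow> real"
  assumes fin: "finite F"
    and outside: "\<And>i t. i \<notin> F \<Longrightarrow> t \<in> {0..T} \<Longrightarrow> v i t < 0"
    and init: "\<And>i. i \<in> F \<Longrightarrow> v i 0 < 0"
    and deriv: "\<And>i t. i \<in> F \<Longrightarrow> t \<in> {0..T} \<Longrightarrow> (v i has_real_derivative v' i t) (at t within {0..T})"
    and touch: "\<And>i t. i \<in> F \<Longrightarrow> t \<in> {0..T} \<Longrightarrow> v i t = 0 \<Longrightarrow> (\<And>j. v j t \<le> 0) \<Longrightarrow> v' i t < 0"
    and t: "t \<in> {0..T}"
  shows "v i t < 0"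
proof (rule ccontr)
  assume neg: "\<not> v i t < 0"
  have cont: "continuous_on {0..T} (v j)" if "j \<in> F" for j
    by (rule DERIV_continuous_on[OF deriv[OF that]])
  define Z where "Z = (\<Union>j\<in>F. {x\<in>{0..T}. v j x \<in> {0..}})"
  have Z: "Z \<subseteq> {0..T}" by (auto simp: Z_def)
  have "closed Z" unfolding Z_def
    by (intro closed_UN fin ballI continuous_closed_preimage[unfolded vimage_def Int_def mem_Collect_eq] cont) auto
  moreover have "Z \<noteq> {}" 
  proof -
    have "i \<in> F" using neg outside[OF _ t] by blast
    then have "t \<in> Z" unfolding Z_def using neg t by (auto intro!: bexI[of _ i])
    then show ?thesis by blast
  qed
  moreover have "bdd_below Z" using Z by (meson bdd_below_Icc bdd_below_mono)
  ultimately have sZ: "Inf Z \<in> Z" by (rule closed_contains_Inf[rotated 2])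
  define s where "s = Inf Z"
  have sT: "s \<in> {0..T}" using sZ Z by (auto simp: s_def)
  obtain j where j: "j \<in> F" "v j s \<ge> 0" using sZ by (auto simp: Z_def s_def)
  have s0: "s > 0" using init[OF j(1)] j(2) sT by (cases "s = 0") auto
  have before: "v k x < 0" if "x \<in> {0..<s}" "k \<in> F" for k x
  proof (rule ccontr)
    assume "\<not> v k x < 0"
    then have "x \<in> Z" using that sT unfolding Z_def by (auto intro!: bexI[of _ k])
    then have "s \<le> x" unfolding s_def using \<open>bdd_below Z\<close> by (intro cInf_lower)
    then show False using that by auto
  qed
  have le: "v k s \<le> 0" for k
  proof (cases "k \<in> F")
    case True
    have "closure {0..<s} = {0..s}" using s0 by simp
    moreover have "continuous_on {0..s} (v k)"
      by (rule continuous_on_subset[OF cont[OF True]]) (use sT in auto)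
    moreover have "v k x \<le> 0" if "x \<in> {0..<s}" for x
      using before[OF that True] by simp
    ultimately show ?thesis
      using continuous_le_on_closure[of "{0..<s}" "v k" s 0] s0 by simp
  next
    case False
    then show ?thesis using outside[OF False sT] by simp
  qed
  have eq: "v j s = 0" using le[of j] j by simp
  have "v' j s < 0" using touch[OF j(1) sT eq le] .
  from has_real_derivative_neg_dec_left[OF deriv[OF j(1) sT] this]
  obtain d where d: "d > 0" "\<And>h. h > 0 \<Longrightarrow> s - h \<in> {0..T} \<Longrightarrow> h < d \<Longrightarrow> v j s < v j (s - h)" by auto
  define h where "h = min (d/2) (s/2)"
  have "h > 0" "h < d" "s - h \<in> {0..<s}" using d s0 by (auto simp: h_def min_def)
  then have "v j s < v j (s - h)" using d(2)[of h] sT by simp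
  moreover have "v j (s - h) < 0" by (rule before) (use \<open>s - h \<in> {0..<s}\<close> j in auto)
  ultimately show False using eq by simp
qed

lemma barrier_real:
  fixes v v' :: "real \<Rightarrow> real"
  assumes "v 0 < 0"
    and "\<And>t. t \<in> {0..T} \<Longrightarrow> (v has_real_derivative v' t) (at t within {0..T})"
    and "\<And>t. t \<in> {0..T} \<Longrightarrow> v t = 0 \<Longrightarrow> v' t < 0"
    and "t \<in> {0..T}"
  shows "v t < 0"
proof (rule barrier[where F = "UNIV :: unit set" and v = "\<lambda>_. v" and v' = "\<lambda>_. v'" and T = T])
  show "v' t < 0" if "t \<in> {0..T}" "v t = 0" for t by (rule assms(3)[OF that])
  show "(v has_real_derivative v' t) (at t within {0..T})" if "t \<in> {0..T}" for t by (rule assms(2)[OF that])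
qed (simp_all add: assms(1) assms(4)[simplified])

lemma has_real_derivative_cmod_sq:
  assumes "(u has_vector_derivative u') (at t within S)"
  shows "((\<lambda>t. (cmod (u t))\<^sup>2) has_real_derivative 2 * Re (cnj (u t) * u')) (at t within S)"
proof -
  have re: "((\<lambda>t. Re (u t)) has_real_derivative Re u') (at t within S)"
    using bounded_linear.has_vector_derivative[OF bounded_linear_Re assms]
    by (simp add: has_real_derivative_iff_has_vector_derivative)
  have im: "((\<lambda>t. Im (u t)) has_real_derivative Im u') (at t within S)"
    using bounded_linear.has_vector_derivative[OF bounded_linear_Im assms]
    by (simp add: has_real_derivative_iff_has_vector_derivative)
  have "((\<lambda>t. (Re (u t))\<^sup>2 + (Im (u t))\<^sup>2) has_real_derivative
     (2 * Re (u t) * Re u' + 2 * Im (u t) * Im u')) (at t within S)"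
    using DERIV_add[OF DERIV_power[OF re, of 2] DERIV_power[OF im, of 2]]
    by (simp add: algebra_simps)
  then show ?thesis by (simp add: cmod_power2 algebra_simps)
qed

text \<open>Half the time derivative of |z|^2 for a mode with growth rate \<open>l\<close> and
  forcing \<open>n\<close>: the real factor acts exactly, and only the modulus of the forcing
  matters, whatever the phases.\<close>

lemma Re_cnj_mult_le:
  assumes "cmod n \<le> c"
  shows "Re (cnj z * (complex_of_real l * z + n)) \<le> l * (cmod z)\<^sup>2 + cmod z * c"
proof -
  have "Re (cnj z * (complex_of_real l * z + n)) = l * (cmod z)\<^sup>2 + Re (cnj z * n)"
    unfolding cmod_power2 by (simp add: algebra_simps power2_eq_square)
  moreover have "Re (cnj z * n) \<le> cmod z * c"
    using complex_Re_le_cmod[of "cnj z * n"] mult_left_mono[OF assms, of "cmod z"]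
    by (simp add: norm_mult)
  ultimately show ?thesis by simp
qed

text \<open>Every radius \<rho> above the claimed bound is a barrier: on the circle of radius \<rho>
  the damping \<mu> \<rho> exceeds the forcing c. Nothing here depends on T.\<close>

lemma damped_bound:
  fixes u :: "real \<Rightarrow> complex"
  assumes deriv: "\<And>t. t \<in> {0..T} \<Longrightarrow> (u has_vector_derivative (complex_of_real l * u t + n t)) (at t within {0..T})"
    and n: "\<And>t. t \<in> {0..T} \<Longrightarrow> cmod (n t) \<le> c"
    and l: "l \<le> - \<mu>" "\<mu> > 0" and t: "t \<in> {0..T}"
  shows "cmod (u t) \<le> cmod (u 0) + c / \<mu>"
proof (rule dense_ge)
  fix \<rho> assume \<rho>: "cmod (u 0) + c / \<mu> < \<rho>"
  have c: "c \<ge> 0" using n[OF t] norm_ge_zero order_trans by blast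
  have \<rho>0: "\<rho> > 0" "cmod (u 0) < \<rho>" "c < \<mu> * \<rho>"
  proof -
    have "c / \<mu> \<ge> 0" "cmod (u 0) \<ge> 0" using c l by auto
    then show "\<rho> > 0" "cmod (u 0) < \<rho>" using \<rho> by linarith+
    have "c / \<mu> < \<rho>" using \<rho> \<open>cmod (u 0) \<ge> 0\<close> by linarith
    then show "c < \<mu> * \<rho>" using l by (simp add: field_simps)
  qed
  have "(cmod (u t))\<^sup>2 - \<rho>\<^sup>2 < 0"
  proof (rule barrier_real[where v = "\<lambda>t. (cmod (u t))\<^sup>2 - \<rho>\<^sup>2"
        and v' = "\<lambda>t. 2 * Re (cnj (u t) * (complex_of_real l * u t + n t))" and T = T])
    show "(cmod (u 0))\<^sup>2 - \<rho>\<^sup>2 < 0" using \<rho>0 by (simp add: power_strict_mono)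
    show "((\<lambda>t. (cmod (u t))\<^sup>2 - \<rho>\<^sup>2) has_real_derivative
        2 * Re (cnj (u s) * (complex_of_real l * u s + n s))) (at s within {0..T})" if "s \<in> {0..T}" for s
      using DERIV_diff[OF has_real_derivative_cmod_sq[OF deriv[OF that]] DERIV_const[of "\<rho>\<^sup>2"]] by simp
    show "2 * Re (cnj (u s) * (complex_of_real l * u s + n s)) < 0"
      if "s \<in> {0..T}" and eq: "(cmod (u s))\<^sup>2 - \<rho>\<^sup>2 = 0" for s
    proof -
      have eq': "cmod (u s) = \<rho>" by (rule power2_eq_imp_eq) (use eq \<rho>0 in simp_all)
      have "Re (cnj (u s) * (complex_of_real l * u s + n s)) \<le> l * \<rho>\<^sup>2 + \<rho> * c"
        using Re_cnj_mult_le[OF n[of s], of "u s" l] that(1) by (simp add: eq')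
      also have "\<dots> \<le> - \<mu> * \<rho>\<^sup>2 + \<rho> * c" using mult_right_mono[OF l(1), of "\<rho>\<^sup>2"] by simp
      also have "\<dots> = \<rho> * (c - \<mu> * \<rho>)" by (simp add: power2_eq_square algebra_simps)
      also have "\<dots> < 0" using \<rho>0 by (simp add: mult_pos_neg)
      finally show ?thesis by simp
    qed
  qed (use t in auto)
  then have "(cmod (u t))\<^sup>2 \<le> \<rho>\<^sup>2" by simp
  then show "cmod (u t) \<le> \<rho>" by (rule power2_le_imp_le) (use \<rho>0 in simp)
qed

section \<open>A priori bounds for the modes of a flow\<close>

lemma finite_ge_of_summable_on:
  fixes f :: "'i \<Rightarrow> real"
  assumes "f summable_on UNIV" "\<And>i. f i \<ge> 0" "e > 0"
  shows "finite {i. f i \<ge> e}"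
proof (rule ccontr)
  assume inf: "infinite {i. f i \<ge> e}"
  obtain n :: nat where n: "real n * e > infsum f UNIV"
    using reals_Archimedean3[OF assms(3)] by blast
  obtain G where G: "G \<subseteq> {i. f i \<ge> e}" "finite G" "card G = n"
    using inf infinite_arbitrarily_large by meson
  have "real n * e \<le> sum f G"
    using sum_bounded_below[of G e f] G by auto
  also have "\<dots> \<le> infsum f UNIV" by (rule finite_sum_le_infsum) (use assms G in auto)
  finally show False using n by simp
qed

text \<open>The embedding of H^2 into the absolutely convergent Fourier series in dimension two:
  Cauchy-Schwarz against the square-summable \<open>1 / bracket\<close>.\<close>

lemma summable_on_abs_of_bracket:
  assumes "sq_summable (\<lambda>\<xi>. complex_of_real (bracket \<xi>) * a \<xi>)"
  shows "(\<lambda>\<xi>. cmod (a \<xi>)) summable_on UNIV"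
proof -
  have "(\<lambda>\<xi>. (1 / bracket \<xi>)\<^sup>2) summable_on UNIV"
    using summable_on_inverse_bracket_sq by (simp add: power_divide)
  from infsum_Cauchy_Schwarz(1)[OF this, of "\<lambda>\<xi>. cmod (complex_of_real (bracket \<xi>) * a \<xi>)"] assms
  show ?thesis by (simp add: sq_summable_def norm_mult abs_mult)
qed

text \<open>
  Here \<open>a t\<close> are the Fourier coefficients of $\eta(t)$ and \<open>lam\<close> is the symbol of the linear part. The
  equation for a single coefficient holds at every time, not just at almost every one, because its
  right-hand side is continuous in time.
\<close>

locale modal_flow =
  fixes a :: "real \<Rightarrow> int \<times> int \<Rightarrow> complex" and lam :: "int \<times> int \<Rightarrow> real" and c0 \<kappa> :: real
  assumes kappa: "\<kappa> > 0" and c0: "c0 \<ge> 0"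
    and lam_le: "\<And>\<xi>. lam \<xi> \<le> c0 - \<kappa> * (bracket \<xi>)\<^sup>2"
    and lam_reflect: "\<And>\<xi>. lam (reflect \<xi>) = lam \<xi>"
    and a_cnj: "\<And>t \<xi>. t \<ge> 0 \<Longrightarrow> a t (- \<xi>) = cnj (a t \<xi>)"
    and h2: "\<And>t. t \<ge> 0 \<Longrightarrow> sq_summable (\<lambda>\<xi>. complex_of_real (bracket \<xi>) * a t \<xi>)"
    and h2_bdd: "\<And>T. \<exists>H. \<forall>t\<in>{0..T}. sqsum (\<lambda>\<xi>. complex_of_real (bracket \<xi>) * a t \<xi>) \<le> H"
    and deriv: "\<And>t \<xi>. t \<ge> 0 \<Longrightarrow> ((\<lambda>t. a t \<xi>) has_vector_derivative
      (complex_of_real (lam \<xi>) * a t \<xi> + (- \<i> * of_int (fst \<xi>) / 2 * conv (a t) (a t) \<xi>))) (at t within {0..})"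
begin

text \<open>Coefficients of -(eta^2)_x / 2, the form of the nonlinearity in which the derivative
  stands outside the product.\<close>

definition nonlin :: "real \<Rightarrow> int \<times> int \<Rightarrow> complex" where
  "nonlin t \<xi> = - \<i> * of_int (fst \<xi>) / 2 * conv (a t) (a t) \<xi>"

lemma deriv_within:
  assumes "t \<in> {0..T}"
  shows "((\<lambda>t. a t \<xi>) has_vector_derivative (complex_of_real (lam \<xi>) * a t \<xi> + nonlin t \<xi>)) (at t within {0..T})"
  using has_vector_derivative_within_subset[OF deriv[of t \<xi>], of "{0..T}"] assms
  by (auto simp: nonlin_def)

lemma sq_summable_a:
  assumes "t \<ge> 0"
  shows "sq_summable (a t)" "sqsum (a t) \<le> sqsum (\<lambda>\<xi>. complex_of_real (bracket \<xi>) * a t \<xi>)"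
proof -
  have "cmod (a t \<xi>) \<le> cmod (complex_of_real (bracket \<xi>) * a t \<xi>)" for \<xi>
    using mult_right_mono[OF bracket_ge_1[of \<xi>], of "cmod (a t \<xi>)"] by (simp add: norm_mult)
  from sqsum_mono[OF h2[OF assms], of "a t", OF this]
  show "sq_summable (a t)" "sqsum (a t) \<le> sqsum (\<lambda>\<xi>. complex_of_real (bracket \<xi>) * a t \<xi>)" by auto
qed

lemma sq_summable_fst_a:
  assumes "t \<ge> 0"
  shows "sq_summable (\<lambda>\<xi>. of_int (fst \<xi>) * a t \<xi>)"
    "sqsum (\<lambda>\<xi>. of_int (fst \<xi>) * a t \<xi>) \<le> sqsum (\<lambda>\<xi>. complex_of_real (bracket \<xi>) * a t \<xi>)"
proof -
  have "cmod (of_int (fst \<xi>) * a t \<xi>) \<le> cmod (complex_of_real (bracket \<xi>) * a t \<xi>)" for \<xi>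
    using mult_right_mono[OF abs_fst_le_bracket[of \<xi>], of "cmod (a t \<xi>)"] by (simp add: norm_mult)
  from sqsum_mono[OF h2[OF assms], of "\<lambda>\<xi>. of_int (fst \<xi>) * a t \<xi>", OF this]
  show "sq_summable (\<lambda>\<xi>. of_int (fst \<xi>) * a t \<xi>)"
    "sqsum (\<lambda>\<xi>. of_int (fst \<xi>) * a t \<xi>) \<le> sqsum (\<lambda>\<xi>. complex_of_real (bracket \<xi>) * a t \<xi>)" by auto
qed

text \<open>Moving the derivative onto one factor by \<open>conv_first_moment\<close> gives a bound
  that does not grow with \<xi>, at the price of the H^2 norm. It is used on bounded time intervals,
  where that norm is bounded.\<close>

lemma norm_nonlin_le:
  assumes "t \<ge> 0"
  shows "cmod (nonlin t \<xi>) \<le> sqsum (\<lambda>\<xi>. complex_of_real (bracket \<xi>) * a t \<xi>)" (is "_ \<le> ?H")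
proof -
  note s = sq_summable_a[OF assms] and s1 = sq_summable_fst_a[OF assms]
  have "nonlin t \<xi> = - \<i> / 2 * (of_int (fst \<xi>) * conv (a t) (a t) \<xi>)"
    by (simp add: nonlin_def)
  also have "\<dots> = - \<i> * conv (\<lambda>k. of_int (fst k) * a t k) (a t) \<xi>"
    by (subst conv_first_moment[OF s(1) s1(1)]) simp
  finally have "cmod (nonlin t \<xi>) = cmod (conv (\<lambda>k. of_int (fst k) * a t k) (a t) \<xi>)"
    by (simp add: norm_mult)
  also have "\<dots> \<le> sqrt (sqsum (\<lambda>\<xi>. of_int (fst \<xi>) * a t \<xi>)) * sqrt (sqsum (a t))"
    by (rule norm_conv_le[OF s1(1) s(1)])
  also have "\<dots> \<le> sqrt ?H * sqrt ?H"
    using s s1 by (intro mult_mono real_sqrt_le_mono) (auto simp: sqsum_nonneg)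
  also have "\<dots> = ?H" by (simp add: sqsum_nonneg)
  finally show ?thesis .
qed

text \<open>Here the derivative stays outside and costs a factor \<open>bracket\<close>, but only
  the L2 norm enters. This is the form that survives for all times once the L2 norm is bounded
  uniformly.\<close>

lemma norm_nonlin_le_sqsum:
  assumes "t \<ge> 0"
  shows "cmod (nonlin t \<xi>) \<le> bracket \<xi> / 2 * sqsum (a t)"
proof -
  note s = sq_summable_a[OF assms]
  have "cmod (nonlin t \<xi>) = \<bar>of_int (fst \<xi>)\<bar> / 2 * cmod (conv (a t) (a t) \<xi>)"
    by (simp add: nonlin_def norm_mult norm_divide)
  also have "\<dots> \<le> bracket \<xi> / 2 * (sqrt (sqsum (a t)) * sqrt (sqsum (a t)))"
    using abs_fst_le_bracket[of \<xi>] norm_conv_le[OF s(1) s(1)] by (intro mult_mono) auto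
  also have "\<dots> = bracket \<xi> / 2 * sqsum (a t)" by (simp add: sqsum_nonneg)
  finally show ?thesis .
qed

text \<open>High modes are damped at rate at least
  \<open>\<kappa> / 2 * (bracket \<xi>)\<^sup>2\<close>, so \<open>damped_bound\<close> gives the
  term with n. For low modes \<open>(bracket \<xi>)\<^sup>2\<close> is at most 2 c0 / \<kappa>, so
  the crude bound A can itself be written as a multiple of
  \<open>1 / (bracket \<xi>)\<^sup>2\<close>.\<close>

lemma mode_bound:
  assumes A: "\<And>t. t \<in> {0..T} \<Longrightarrow> cmod (a t \<xi>) \<le> A"
    and n: "\<And>t. t \<in> {0..T} \<Longrightarrow> cmod (nonlin t \<xi>) \<le> n"
    and t: "t \<in> {0..T}"
  shows "cmod (a t \<xi>) \<le> cmod (a 0 \<xi>) + (2 * n / \<kappa> + 2 * c0 * A / \<kappa>) / (bracket \<xi>)\<^sup>2"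
proof -
  have n0: "n \<ge> 0" using n[OF t] norm_ge_zero order_trans by blast
  have A0: "A \<ge> 0" using A[OF t] norm_ge_zero order_trans by blast
  have b: "(bracket \<xi>)\<^sup>2 > 0" by simp
  show ?thesis
  proof (cases "c0 \<le> \<kappa> / 2 * (bracket \<xi>)\<^sup>2")
    case True
    have "cmod (a t \<xi>) \<le> cmod (a 0 \<xi>) + n / (\<kappa> / 2 * (bracket \<xi>)\<^sup>2)"
    proof (rule damped_bound[where u = "\<lambda>t. a t \<xi>" and l = "lam \<xi>" and n = "\<lambda>t. nonlin t \<xi>" and T = T])
      show "lam \<xi> \<le> - (\<kappa> / 2 * (bracket \<xi>)\<^sup>2)" using lam_le[of \<xi>] True by simp
    qed (use n t kappa deriv_within in auto)
    also have "n / (\<kappa> / 2 * (bracket \<xi>)\<^sup>2) = (2 * n / \<kappa>) / (bracket \<xi>)\<^sup>2"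
      using kappa by (simp add: field_simps)
    also have "\<dots> \<le> (2 * n / \<kappa> + 2 * c0 * A / \<kappa>) / (bracket \<xi>)\<^sup>2"
      using A0 c0 kappa by (intro divide_right_mono) auto
    finally show ?thesis by simp
  next
    case False
    then have "\<kappa> * (bracket \<xi>)\<^sup>2 * A \<le> 2 * c0 * A"
      using A0 by (intro mult_right_mono) auto
    then have "A \<le> (2 * c0 * A / \<kappa>) / (bracket \<xi>)\<^sup>2"
      using kappa b by (simp add: field_simps)
    also have "\<dots> \<le> (2 * n / \<kappa> + 2 * c0 * A / \<kappa>) / (bracket \<xi>)\<^sup>2"
      using n0 kappa by (intro divide_right_mono) auto
    finally show ?thesis using A[OF t] norm_ge_zero[of "a 0 \<xi>"] by linarith
  qed
qed

text \<open>Boundedness in H^2 at each time would allow the large modes to wander with t. The gain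
  of \<open>mode_bound\<close> over the initial coefficients gives one square-summable majorant for
  the whole interval, hence one finite set of modes outside which a barrier cannot be
  reached.\<close>

lemma dominating_weights:
  obtains m where "\<And>t \<xi>. t \<in> {0..T} \<Longrightarrow> cmod (a t \<xi>) \<le> m \<xi>" "\<And>\<xi>. m \<xi> \<ge> 0"
    "(\<lambda>\<xi>. (bracket \<xi> * m \<xi>)\<^sup>2) summable_on UNIV"
proof -
  obtain H where H: "\<And>t. t \<in> {0..T} \<Longrightarrow> sqsum (\<lambda>\<xi>. complex_of_real (bracket \<xi>) * a t \<xi>) \<le> H"
    using h2_bdd[of T] by blast
  define A where "A = sqrt \<bar>H\<bar>"
  define D where "D = 2 * \<bar>H\<bar> / \<kappa> + 2 * c0 * A / \<kappa>"
  define m where "m \<xi> = cmod (a 0 \<xi>) + D / (bracket \<xi>)\<^sup>2" for \<xi>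
  have D0: "D \<ge> 0" using kappa c0 by (auto simp: D_def A_def)
  show thesis
  proof
    fix t \<xi> assume t: "t \<in> {0..T}"
    show "cmod (a t \<xi>) \<le> m \<xi>"
      unfolding m_def D_def
    proof (rule mode_bound[OF _ _ t])
      fix s assume s: "s \<in> {0..T}"
      show "cmod (nonlin s \<xi>) \<le> \<bar>H\<bar>"
        using norm_nonlin_le[of s \<xi>] H[OF s] s by auto
      have "cmod (a s \<xi>) \<le> sqrt (sqsum (a s))"
        by (rule norm_le_sqrt_sqsum) (use sq_summable_a s in auto)
      also have "\<dots> \<le> A" unfolding A_def
        by (rule real_sqrt_le_mono) (use sq_summable_a(2)[of s] H[OF s] s in auto)
      finally show "cmod (a s \<xi>) \<le> A" .
    qed
  next
    show "m \<xi> \<ge> 0" for \<xi> using D0 by (simp add: m_def)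
    have s: "(\<lambda>\<xi>. 2 * (cmod (complex_of_real (bracket \<xi>) * a 0 \<xi>))\<^sup>2 + 2 * D\<^sup>2 * (1 / (bracket \<xi>)\<^sup>2)) summable_on UNIV"
      using h2[of 0] summable_on_inverse_bracket_sq unfolding sq_summable_def
      by (intro summable_on_add summable_on_cmult_right) auto
    show "(\<lambda>\<xi>. (bracket \<xi> * m \<xi>)\<^sup>2) summable_on UNIV"
    proof (rule summable_on_comparison_test[OF s])
      fix \<xi>
      have "bracket \<xi> * m \<xi> = cmod (complex_of_real (bracket \<xi>) * a 0 \<xi>) + D / bracket \<xi>"
        by (simp add: m_def norm_mult power2_eq_square field_simps)
      then show "(bracket \<xi> * m \<xi>)\<^sup>2 \<le> 2 * (cmod (complex_of_real (bracket \<xi>) * a 0 \<xi>))\<^sup>2 + 2 * D\<^sup>2 * (1 / (bracket \<xi>)\<^sup>2)"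
        using sum_squares_bound[of "cmod (complex_of_real (bracket \<xi>) * a 0 \<xi>)" "D / bracket \<xi>"]
        by (simp add: power2_sum power_divide)
    qed auto
  qed
qed

text \<open>The cubic term is absorbed by the quartic one through $r \le \theta r^2 + 1/(4\theta)$.\<close>

lemma symbol_absorbs:
  assumes "P \<ge> 0"
  shows "lam \<xi> + freq_norm \<xi> + P * freq_norm \<xi> * bracket \<xi>
    \<le> (c0 + (1 + P)\<^sup>2 / (2 * \<kappa>)) * bracket \<xi> - \<kappa> / 2 * (bracket \<xi>)\<^sup>2"
proof -
  define r b where "r = freq_norm \<xi>" and "b = bracket \<xi>"
  have b: "b \<ge> 1" "r\<^sup>2 \<le> b" "r \<ge> 0" by (simp_all add: r_def b_def bracket_def)
  have "0 \<le> (\<kappa> * r - (1 + P))\<^sup>2" by simp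
  then have "2 * \<kappa> * ((1 + P) * r) \<le> \<kappa>\<^sup>2 * r\<^sup>2 + (1 + P)\<^sup>2"
    by (simp add: power2_diff power_mult_distrib algebra_simps)
  also have "\<dots> \<le> \<kappa>\<^sup>2 * b + (1 + P)\<^sup>2" using b by (intro add_right_mono mult_left_mono) auto
  finally have "(1 + P) * r \<le> \<kappa> / 2 * b + (1 + P)\<^sup>2 / (2 * \<kappa>)"
    using kappa by (simp add: field_simps power2_eq_square)
  from mult_right_mono[OF this, of b] b
  have "(1 + P) * r * b \<le> \<kappa> / 2 * b\<^sup>2 + (1 + P)\<^sup>2 / (2 * \<kappa>) * b"
    by (simp add: power2_eq_square algebra_simps)
  moreover have "r \<le> r * b" "c0 \<le> c0 * b" using b c0 mult_left_mono[of 1 b r] mult_left_mono[of 1 b c0] by auto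
  moreover have "(1 + P) * r * b = r * b + P * r * b"
    "(c0 + (1 + P)\<^sup>2 / (2 * \<kappa>)) * b = c0 * b + (1 + P)\<^sup>2 / (2 * \<kappa>) * b" by (simp_all add: algebra_simps)
  ultimately show ?thesis using lam_le[of \<xi>] unfolding r_def[symmetric] b_def[symmetric] by linarith
qed

text \<open>Maximum of the parabola in \<open>bracket\<close> from \<open>symbol_absorbs\<close>; it
  supplies the growth rate of the barrier for the even part.\<close>

lemma symbol_bounded_above:
  assumes "P \<ge> 0"
  shows "lam \<xi> + freq_norm \<xi> + P * freq_norm \<xi> * bracket \<xi> \<le> (c0 + (1 + P)\<^sup>2 / (2 * \<kappa>))\<^sup>2 / (2 * \<kappa>)"
proof -
  define d b where "d = c0 + (1 + P)\<^sup>2 / (2 * \<kappa>)" and "b = bracket \<xi>"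
  have "0 \<le> (d - \<kappa> * b)\<^sup>2" by simp
  then have "d * b - \<kappa> / 2 * b\<^sup>2 \<le> d\<^sup>2 / (2 * \<kappa>)"
    using kappa by (simp add: field_simps power2_eq_square)
  then show ?thesis using symbol_absorbs[OF assms, of \<xi>] unfolding d_def b_def by linarith
qed

text \<open>The threshold is the positive root of the same parabola. It separates the modes that
  dissipation alone keeps below the Gevrey barrier from those that need a short time.\<close>

lemma symbol_negative:
  assumes "P \<ge> 0" "bracket \<xi> > 2 * (c0 + (1 + P)\<^sup>2 / (2 * \<kappa>)) / \<kappa>"
  shows "lam \<xi> + freq_norm \<xi> + P * freq_norm \<xi> * bracket \<xi> < 0"
proof -
  define d b where "d = c0 + (1 + P)\<^sup>2 / (2 * \<kappa>)" and "b = bracket \<xi>"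
  have "d < \<kappa> / 2 * b" using assms(2) kappa unfolding d_def[symmetric] b_def[symmetric] by (simp add: field_simps)
  then have "d * b < \<kappa> / 2 * b * b" by (intro mult_strict_right_mono) (auto simp: b_def)
  then show ?thesis using symbol_absorbs[OF assms(1), of \<xi>] unfolding d_def[symmetric] b_def[symmetric]
    by (simp add: power2_eq_square algebra_simps)
qed

end

subsection \<open>Oddness and Gevrey regularity\<close>

lemma reflect_reflect [simp]: "reflect (reflect \<xi>) = \<xi>"
  by (simp add: reflect_def)

lemma bij_reflect: "bij reflect"
  by (rule bij_betw_byWitness[where f' = reflect]) auto

lemma reflect_diff: "reflect (\<xi> - \<zeta>) = reflect \<xi> - reflect \<zeta>"
  by (simp add: reflect_def prod_eq_iff)

lemma conv_reflect: "conv a b (reflect \<xi>) = conv (\<lambda>k. a (reflect k)) (\<lambda>k. b (reflect k)) \<xi>"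
  unfolding conv_def
  using infsum_reindex_bij_betw[OF bij_reflect, of "\<lambda>k. a k * b (reflect \<xi> - k)"]
  by (simp add: reflect_diff)

lemma sq_summable_reflect: "sq_summable (\<lambda>k. a (reflect k)) \<longleftrightarrow> sq_summable a"
  unfolding sq_summable_def
  using summable_on_reindex_bij_betw[OF bij_reflect, of "\<lambda>k. (cmod (a k))\<^sup>2"] by simp

context modal_flow begin

lemma bracket_bound:
  obtains X where "X \<ge> 0" "\<And>t \<xi>. t \<in> {0..T} \<Longrightarrow> cmod (a t \<xi>) \<le> X / bracket \<xi>"
proof -
  obtain H where H: "\<And>t. t \<in> {0..T} \<Longrightarrow> sqsum (\<lambda>\<xi>. complex_of_real (bracket \<xi>) * a t \<xi>) \<le> H"
    using h2_bdd[of T] by blast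
  show thesis
  proof
    show "sqrt \<bar>H\<bar> \<ge> 0" by simp
    fix t \<xi> assume t: "t \<in> {0..T}"
    have "bracket \<xi> * cmod (a t \<xi>) = cmod (complex_of_real (bracket \<xi>) * a t \<xi>)" by (simp add: norm_mult)
    also have "\<dots> \<le> sqrt (sqsum (\<lambda>\<xi>. complex_of_real (bracket \<xi>) * a t \<xi>))"
      using norm_le_sqrt_sqsum[OF h2[of t], of \<xi>] t by simp
    also have "\<dots> \<le> sqrt \<bar>H\<bar>" using H[OF t] by simp
    finally show "cmod (a t \<xi>) \<le> sqrt \<bar>H\<bar> / bracket \<xi>" by (simp add: field_simps)
  qed
qed

text \<open>
  The even part of a solution solves a linear equation, so a barrier of the form
  $\rho e^{Ct}/\langle\xi\rangle^2$ with \<open>\<rho>\<close> arbitrarily small stays above it.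
\<close>

lemma odd_preserved:
  assumes odd0: "\<And>\<xi>. a 0 (reflect \<xi>) = - a 0 \<xi>" and t: "t \<ge> 0"
  shows "a t (reflect \<xi>) = - a t \<xi>"
proof -
  obtain X where X: "X \<ge> 0" "\<And>s \<xi>. s \<in> {0..t} \<Longrightarrow> cmod (a s \<xi>) \<le> X / bracket \<xi>"
    using bracket_bound[of t] by blast
  obtain m where m: "\<And>s \<xi>. s \<in> {0..t} \<Longrightarrow> cmod (a s \<xi>) \<le> m \<xi>" "\<And>\<xi>. m \<xi> \<ge> 0"
    "(\<lambda>\<xi>. (bracket \<xi> * m \<xi>)\<^sup>2) summable_on UNIV" using dominating_weights[of t] by blast
  \<comment> \<open>Strength of the forcing of the even part: half a derivative, times 2X for the
    difference of a and its reflection, times the lattice constant.\<close>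
  define P where "P = X * lattice_const"
  have P0: "P \<ge> 0" using X lattice_const_pos by (simp add: P_def)
  \<comment> \<open>The summand 1 provides the strict inequality demanded at a touching
    time.\<close>
  define C where "C = (c0 + (1 + P)\<^sup>2 / (2 * \<kappa>))\<^sup>2 / (2 * \<kappa>) + 1"
  have C0: "C \<ge> 0" using kappa by (simp add: C_def)
  have C: "lam \<xi> + P * freq_norm \<xi> * bracket \<xi> < C" for \<xi>
    using symbol_bounded_above[OF P0, of \<xi>] freq_norm_nonneg[of \<xi>] unfolding C_def by linarith
  define e where "e \<xi> s = a s \<xi> + a s (reflect \<xi>)" for \<xi> s
  define g where "g \<xi> s = nonlin s \<xi> + nonlin s (reflect \<xi>)" for \<xi> s
  have de: "(e \<xi> has_vector_derivative (complex_of_real (lam \<xi>) * e \<xi> s + g \<xi> s)) (at s within {0..t})"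
    if "s \<in> {0..t}" for \<xi> s
    using has_vector_derivative_add[OF deriv_within[OF that, of \<xi>] deriv_within[OF that, of "reflect \<xi>"]]
    by (simp add: e_def[abs_def] g_def lam_reflect algebra_simps)
  have g_bound: "cmod (g \<xi> s) \<le> P * freq_norm \<xi> * E"
    if s: "s \<in> {0..t}" and E: "\<And>\<zeta>. cmod (e \<zeta> s) \<le> E / bracket \<zeta>" for \<xi> s E
  proof -
    have s0: "s \<ge> 0" using s by simp
    note sa = sq_summable_a(1)[OF s0]
    have E0: "E \<ge> 0" using E[of 0] bracket_pos[of 0]
      by (metis norm_ge_zero order_trans zero_le_divide_iff not_le)
    have "g \<xi> s = - \<i> * of_int (fst \<xi>) / 2 * (conv (a s) (a s) \<xi> - conv (a s) (a s) (reflect \<xi>))"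
      by (simp add: g_def nonlin_def reflect_def algebra_simps)
    \<comment> \<open>Difference of squares: one factor is the even part, so the forcing is linear
      in e and a small barrier produces a proportionally small forcing.\<close>
    also have "conv (a s) (a s) \<xi> - conv (a s) (a s) (reflect \<xi>) =
      conv (\<lambda>k. a s k - a s (reflect k)) (\<lambda>k. e k s) \<xi>"
      unfolding conv_reflect e_def by (rule conv_diff_sq) (use sa sq_summable_reflect in auto)
    finally have "cmod (g \<xi> s) = \<bar>of_int (fst \<xi>)\<bar> / 2 * cmod (conv (\<lambda>k. a s k - a s (reflect k)) (\<lambda>k. e k s) \<xi>)"
      by (simp add: norm_mult norm_divide)
    also have "\<dots> \<le> freq_norm \<xi> / 2 * (2 * X * E * lattice_const)"
    proof (intro mult_mono)
      show "cmod (conv (\<lambda>k. a s k - a s (reflect k)) (\<lambda>k. e k s) \<xi>) \<le> 2 * X * E * lattice_const"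
      proof (rule norm_conv_le_of_bracket(2))
        fix \<xi>
        have "cmod (a s \<xi> - a s (reflect \<xi>)) \<le> X / bracket \<xi> + X / bracket (reflect \<xi>)"
          by (rule order_trans[OF norm_triangle_ineq4]) (intro add_mono X(2) s)
        then show "cmod (a s \<xi> - a s (reflect \<xi>)) \<le> 2 * X / bracket \<xi>" by simp
      qed (use E in auto)
    qed (use abs_fst_le_freq_norm[of \<xi>] in auto)
    also have "\<dots> = P * freq_norm \<xi> * E" by (simp add: P_def)
    finally show ?thesis .
  qed
  have small: "cmod (e \<xi> t) \<le> \<rho> * (exp (C * t) / bracket \<xi>)" if \<rho>: "\<rho> > 0" for \<rho> \<xi>
  proof -
    define h where "h \<xi> s = \<rho> * exp (C * s) / bracket \<xi>" for \<xi> s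
    have h0: "h \<xi> s > 0" for \<xi> s using \<rho> by (simp add: h_def)
    have dh: "(h \<xi> has_real_derivative C * h \<xi> s) (at s within {0..t})" for \<xi> s
      unfolding h_def[abs_def] by (auto intro!: derivative_eq_intros)
    \<comment> \<open>Since e adds the modes \<xi> and \<open>reflect \<xi>\<close>, each is allowed
      half of the barrier, and the critical set is completed by its reflection.\<close>
    define F where "F = {\<xi>. bracket \<xi> * m \<xi> \<ge> \<rho> / 2}"
    have finF: "finite F"
    proof -
      have "finite {\<xi>. (bracket \<xi> * m \<xi>)\<^sup>2 \<ge> (\<rho> / 2)\<^sup>2}"
        by (rule finite_ge_of_summable_on[OF m(3)]) (use \<rho> in auto)
      moreover have "F \<subseteq> {\<xi>. (bracket \<xi> * m \<xi>)\<^sup>2 \<ge> (\<rho> / 2)\<^sup>2}"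
        using \<rho> by (auto simp: F_def intro!: power_mono)
      ultimately show ?thesis by (rule finite_subset[rotated])
    qed
    have "(cmod (e \<xi> t))\<^sup>2 - (h \<xi> t)\<^sup>2 < 0"
    proof (rule barrier[where F = "F \<union> reflect ` F" and v = "\<lambda>\<xi> s. (cmod (e \<xi> s))\<^sup>2 - (h \<xi> s)\<^sup>2" and T = t
        and v' = "\<lambda>\<xi> s. 2 * Re (cnj (e \<xi> s) * (complex_of_real (lam \<xi>) * e \<xi> s + g \<xi> s)) - 2 * C * (h \<xi> s)\<^sup>2"])
      show "finite (F \<union> reflect ` F)" using finF by simp
      show "t \<in> {0..t}" using t by simp
    next
      fix \<xi> s assume \<xi>: "\<xi> \<notin> F \<union> reflect ` F" and s: "s \<in> {0..t}"
      have "\<xi> \<notin> F" "reflect \<xi> \<notin> F" using \<xi> by (auto simp: image_iff)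
      then have "m \<xi> < \<rho> / 2 / bracket \<xi>" "m (reflect \<xi>) < \<rho> / 2 / bracket \<xi>"
        by (auto simp: F_def field_simps)
      moreover have "cmod (e \<xi> s) \<le> m \<xi> + m (reflect \<xi>)"
        unfolding e_def by (rule order_trans[OF norm_triangle_ineq]) (intro add_mono m(1) s)
      ultimately have "cmod (e \<xi> s) < \<rho> / 2 / bracket \<xi> + \<rho> / 2 / bracket \<xi>" by linarith
      also have "\<dots> = \<rho> / bracket \<xi>" by (simp add: field_simps)
      finally have "cmod (e \<xi> s) < \<rho> / bracket \<xi>" .
      also have "\<dots> \<le> h \<xi> s" unfolding h_def using \<rho> C0 s by (intro divide_right_mono) auto
      finally show "(cmod (e \<xi> s))\<^sup>2 - (h \<xi> s)\<^sup>2 < 0" by (simp add: power_strict_mono)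
    next
      fix \<xi> show "(cmod (e \<xi> 0))\<^sup>2 - (h \<xi> 0)\<^sup>2 < 0"
        using h0[of \<xi> 0] odd0[of \<xi>] by (simp add: e_def)
    next
      fix \<xi> s assume s: "s \<in> {0..t}"
      show "((\<lambda>s. (cmod (e \<xi> s))\<^sup>2 - (h \<xi> s)\<^sup>2) has_real_derivative
        2 * Re (cnj (e \<xi> s) * (complex_of_real (lam \<xi>) * e \<xi> s + g \<xi> s)) - 2 * C * (h \<xi> s)\<^sup>2) (at s within {0..t})"
        using DERIV_diff[OF has_real_derivative_cmod_sq[OF de[OF s, of \<xi>]] DERIV_power[OF dh[of \<xi> s], of 2]]
        by (simp add: power2_eq_square mult.assoc)
    next
      fix \<xi> s assume s: "s \<in> {0..t}" and eq: "(cmod (e \<xi> s))\<^sup>2 - (h \<xi> s)\<^sup>2 = 0"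
        and all: "\<And>\<zeta>. (cmod (e \<zeta> s))\<^sup>2 - (h \<zeta> s)\<^sup>2 \<le> 0"
      have le: "cmod (e \<zeta> s) \<le> (\<rho> * exp (C * s)) / bracket \<zeta>" for \<zeta>
        using power2_le_imp_le[of "cmod (e \<zeta> s)" "h \<zeta> s"] all[of \<zeta>] h0[of \<zeta> s] by (simp add: h_def)
      have eq': "cmod (e \<xi> s) = h \<xi> s"
        by (rule power2_eq_imp_eq) (use eq h0[of \<xi> s] in simp_all)
      have "Re (cnj (e \<xi> s) * (complex_of_real (lam \<xi>) * e \<xi> s + g \<xi> s))
        \<le> lam \<xi> * (h \<xi> s)\<^sup>2 + h \<xi> s * (P * freq_norm \<xi> * (\<rho> * exp (C * s)))"
        using Re_cnj_mult_le[OF g_bound[OF s le], of "e \<xi> s" "lam \<xi>" \<xi>] unfolding eq' .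
      also have "\<rho> * exp (C * s) = bracket \<xi> * h \<xi> s" by (simp add: h_def)
      also have "lam \<xi> * (h \<xi> s)\<^sup>2 + h \<xi> s * (P * freq_norm \<xi> * (bracket \<xi> * h \<xi> s))
        = (lam \<xi> + P * freq_norm \<xi> * bracket \<xi>) * (h \<xi> s)\<^sup>2" by (simp add: power2_eq_square algebra_simps)
      also have "\<dots> < C * (h \<xi> s)\<^sup>2" using C[of \<xi>] h0[of \<xi> s] by (intro mult_strict_right_mono) auto
      finally show "2 * Re (cnj (e \<xi> s) * (complex_of_real (lam \<xi>) * e \<xi> s + g \<xi> s)) - 2 * C * (h \<xi> s)\<^sup>2 < 0"
        by simp
    qed
    then have "(cmod (e \<xi> t))\<^sup>2 \<le> (h \<xi> t)\<^sup>2" by simp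
    then show ?thesis using h0[of \<xi> t] power2_le_imp_le[of "cmod (e \<xi> t)" "h \<xi> t"] by (simp add: h_def)
  qed
  have "cmod (e \<xi> t) \<le> 0"
  proof (rule field_le_epsilon)
    fix r :: real assume "r > 0"
    then show "cmod (e \<xi> t) \<le> 0 + r"
      using small[of "r / (exp (C * t) / bracket \<xi>)" \<xi>] by simp
  qed
  then have "a t \<xi> + a t (reflect \<xi>) = 0" by (simp add: e_def)
  then show ?thesis by (simp only: add_eq_0_iff)
qed

text \<open>\<open>mode_bound\<close> with a forcing that itself grows like \<open>bracket\<close>:
  of the two powers gained by dissipation one remains. The resulting constant involves only the
  initial data and the uniform L2 bound, not the length of the time interval.\<close>

lemma bound_of_sqsum_bound:
  assumes M: "\<And>t. t \<ge> 0 \<Longrightarrow> sqsum (a t) \<le> M" and t: "t \<ge> 0"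
  shows "cmod (a t \<xi>) \<le> (sqrt (sqsum (\<lambda>\<xi>. complex_of_real (bracket \<xi>) * a 0 \<xi>)) + M / \<kappa> + 2 * c0 * sqrt M / \<kappa>) / bracket \<xi>"
proof -
  have M0: "M \<ge> 0" using M[of 0] sqsum_nonneg[of "a 0"] by simp
  have "cmod (a t \<xi>) \<le> cmod (a 0 \<xi>) + (2 * (bracket \<xi> / 2 * M) / \<kappa> + 2 * c0 * sqrt M / \<kappa>) / (bracket \<xi>)\<^sup>2"
  proof (rule mode_bound[where T = t])
    fix s assume s: "s \<in> {0..t}"
    have "cmod (a s \<xi>) \<le> sqrt (sqsum (a s))" by (rule norm_le_sqrt_sqsum) (use sq_summable_a s in auto)
    also have "\<dots> \<le> sqrt M" using M[of s] s by simp
    finally show "cmod (a s \<xi>) \<le> sqrt M" .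
    have "cmod (nonlin s \<xi>) \<le> bracket \<xi> / 2 * sqsum (a s)" using norm_nonlin_le_sqsum[of s \<xi>] s by simp
    also have "\<dots> \<le> bracket \<xi> / 2 * M" using M[of s] s by (intro mult_left_mono) auto
    finally show "cmod (nonlin s \<xi>) \<le> bracket \<xi> / 2 * M" .
  qed (use t in auto)
  also have "(2 * (bracket \<xi> / 2 * M) / \<kappa> + 2 * c0 * sqrt M / \<kappa>) / (bracket \<xi>)\<^sup>2
      = M / \<kappa> / bracket \<xi> + 2 * c0 * sqrt M / \<kappa> / (bracket \<xi>)\<^sup>2"
    by (simp add: add_divide_distrib power2_eq_square)
  also have "2 * c0 * sqrt M / \<kappa> / (bracket \<xi>)\<^sup>2 \<le> 2 * c0 * sqrt M / \<kappa> / bracket \<xi>"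
  proof -
    have "bracket \<xi> \<le> (bracket \<xi>)\<^sup>2" using mult_left_mono[OF bracket_ge_1, of "bracket \<xi>" \<xi>] by (simp add: power2_eq_square)
    then show ?thesis using M0 c0 kappa by (intro divide_left_mono) auto
  qed
  also have "cmod (a 0 \<xi>) \<le> sqrt (sqsum (\<lambda>\<xi>. complex_of_real (bracket \<xi>) * a 0 \<xi>)) / bracket \<xi>"
    using norm_le_sqrt_sqsum[OF h2[of 0], of \<xi>] by (simp add: norm_mult field_simps)
  finally show ?thesis by (simp add: add_divide_distrib)
qed

text \<open>
  A barrier argument for $e^{\tau\min(|\xi|,N)}\widehat\eta(s+\tau,\xi)$. The truncated weight is still
  submultiplicative; truncating makes all but finitely many modes small a priori. Modes with
  $\langle\xi\rangle^2\ge W$ cannot cross the barrier because the dissipation dominates there, and the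
  others have no time to reach it.
\<close>

lemma gevrey_bound:
  assumes M: "M > 0" "\<And>t \<xi>. t \<ge> 0 \<Longrightarrow> cmod (a t \<xi>) \<le> M / bracket \<xi>"
  defines "P \<equiv> 3 * M * lattice_const / 2"
  defines "W \<equiv> 2 * (c0 + (1 + P)\<^sup>2 / (2 * \<kappa>)) / \<kappa> + 1"
  assumes s: "s \<ge> 0" and tau: "\<tau> \<in> {0..1 / (2 * W)}"
  shows "exp (\<tau> * freq_norm \<xi>) * cmod (a (s + \<tau>) \<xi>) \<le> 3 * M / bracket \<xi>"
proof -
  \<comment> \<open>The factor 3 and the lifespan 1 / (2 W) belong together: on modes with
    \<open>bracket\<close> at most W the weight is at most exp(1/2) \<le> 2, so they stay below 2 M
    and cannot touch a barrier of height 3 M.\<close>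
  define R where "R = 3 * M"
  \<comment> \<open>Truncating exactly at the frequency under consideration leaves its own weight
    unchanged, so no limit N to infinity is needed afterwards.\<close>
  define N where "N = freq_norm \<xi>"
  define p where "p \<xi> = min (freq_norm \<xi>) N" for \<xi>
  define T where "T = 1 / (2 * W)"
  have P0: "P \<ge> 0" using M lattice_const_pos by (simp add: P_def)
  have W1: "W \<ge> 1" using c0 kappa by (simp add: W_def)
  have T0: "T > 0" using W1 by (simp add: T_def)
  have N0: "N \<ge> 0" by (simp add: N_def)
  have p0: "p \<zeta> \<ge> 0" "p \<zeta> \<le> freq_norm \<zeta>" "p \<zeta> \<le> N" for \<zeta> using N0 by (auto simp: p_def)
  have p_sub: "p \<zeta> \<le> p k + p (\<zeta> - k)" for \<zeta> k
  proof -
    have "k + (\<zeta> - k) = \<zeta>" by simp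
    then have "freq_norm \<zeta> \<le> freq_norm k + freq_norm (\<zeta> - k)"
      using freq_norm_add[of k "\<zeta> - k"] by (simp only:)
    then show ?thesis
      using N0 freq_norm_nonneg[of k] freq_norm_nonneg[of "\<zeta> - k"] unfolding p_def by linarith
  qed
  obtain m where m: "\<And>t \<xi>. t \<in> {0..s+T} \<Longrightarrow> cmod (a t \<xi>) \<le> m \<xi>" "\<And>\<xi>. m \<xi> \<ge> 0"
    "(\<lambda>\<xi>. (bracket \<xi> * m \<xi>)\<^sup>2) summable_on UNIV" using dominating_weights[of "s+T"] by blast
  define u where "u \<zeta> r = complex_of_real (exp (r * p \<zeta>)) * a (s + r) \<zeta>" for \<zeta> r
  define n where "n \<zeta> r = complex_of_real (exp (r * p \<zeta>)) * nonlin (s + r) \<zeta>" for \<zeta> r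
  have norm_u: "cmod (u \<zeta> r) = exp (r * p \<zeta>) * cmod (a (s + r) \<zeta>)" for \<zeta> r
    by (simp add: u_def norm_mult)
  have du: "(u \<zeta> has_vector_derivative (complex_of_real (lam \<zeta> + p \<zeta>) * u \<zeta> r + n \<zeta> r)) (at r within {0..T})"
    if r: "r \<in> {0..T}" for \<zeta> r
  proof -
    have "((\<lambda>t. a t \<zeta>) \<circ> (\<lambda>r. s + r) has_vector_derivative 1 *\<^sub>R (complex_of_real (lam \<zeta>) * a (s + r) \<zeta> + nonlin (s + r) \<zeta>)) (at r within {0..T})"
    proof (rule vector_diff_chain_within)
      show "((\<lambda>r. s + r) has_vector_derivative 1) (at r within {0..T})"
        by (auto intro!: derivative_eq_intros)
      show "((\<lambda>t. a t \<zeta>) has_vector_derivative complex_of_real (lam \<zeta>) * a (s + r) \<zeta> + nonlin (s + r) \<zeta>)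
          (at (s + r) within (\<lambda>r. s + r) ` {0..T})"
        by (rule has_vector_derivative_within_subset[OF deriv[of "s + r" \<zeta>, folded nonlin_def]]) (use r s in auto)
    qed
    then have 1: "((\<lambda>r. a (s + r) \<zeta>) has_vector_derivative (complex_of_real (lam \<zeta>) * a (s + r) \<zeta> + nonlin (s + r) \<zeta>)) (at r within {0..T})"
      by (simp add: o_def)
    have "((\<lambda>r. exp (r * p \<zeta>)) has_real_derivative p \<zeta> * exp (r * p \<zeta>)) (at r within {0..T})"
      by (auto intro!: derivative_eq_intros)
    then have 2: "((\<lambda>r. complex_of_real (exp (r * p \<zeta>))) has_vector_derivative complex_of_real (p \<zeta> * exp (r * p \<zeta>))) (at r within {0..T})"
      by (intro has_vector_derivative_of_real) (simp add: has_real_derivative_iff_has_vector_derivative)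
    show ?thesis
      using has_vector_derivative_mult[OF 2 1] by (simp add: u_def[abs_def] n_def algebra_simps)
  qed
  have n_bound: "cmod (n \<zeta> r) \<le> P * freq_norm \<zeta> * R"
    if r: "r \<in> {0..T}" and le: "\<And>\<zeta>. cmod (u \<zeta> r) \<le> R / bracket \<zeta>" for \<zeta> r
  proof -
    have sr: "s + r \<ge> 0" using s r by simp
    note sa = sq_summable_a(1)[OF sr] and su = sqsum_le_of_bracket(1)[of "\<lambda>\<zeta>. u \<zeta> r", OF le]
    \<comment> \<open>The weight is distributed over the two factors by subadditivity of p. After
      that the convolution of the weighted coefficients is estimated like an unweighted one.\<close>
    have "exp (r * p \<zeta>) * cmod (conv (a (s + r)) (a (s + r)) \<zeta>)
      \<le> exp (r * p \<zeta>) * (\<Sum>\<^sub>\<infinity>k. cmod (a (s + r) k * a (s + r) (\<zeta> - k)))"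
      unfolding conv_def by (intro mult_left_mono norm_infsum_bound conv_abs_summable(1)[OF sa sa]) auto
    also have "\<dots> = (\<Sum>\<^sub>\<infinity>k. exp (r * p \<zeta>) * cmod (a (s + r) k * a (s + r) (\<zeta> - k)))"
      by (rule infsum_cmult_right[symmetric]) (use conv_abs_summable(1)[OF sa sa] in auto)
    also have "\<dots> \<le> (\<Sum>\<^sub>\<infinity>k. cmod (u k r * u (\<zeta> - k) r))"
    proof (rule infsum_mono)
      show "(\<lambda>k. exp (r * p \<zeta>) * cmod (a (s + r) k * a (s + r) (\<zeta> - k))) summable_on UNIV"
        by (rule summable_on_cmult_right) (rule conv_abs_summable(1)[OF sa sa])
      show "(\<lambda>k. cmod (u k r * u (\<zeta> - k) r)) summable_on UNIV"
        by (rule conv_abs_summable(1)[OF su su])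
      fix k
      have "exp (r * p \<zeta>) \<le> exp (r * p k) * exp (r * p (\<zeta> - k))"
        using mult_left_mono[OF p_sub[of \<zeta> k], of r] r by (simp add: exp_add[symmetric] algebra_simps)
      from mult_right_mono[OF this, of "cmod (a (s + r) k * a (s + r) (\<zeta> - k))"]
      show "exp (r * p \<zeta>) * cmod (a (s + r) k * a (s + r) (\<zeta> - k)) \<le> cmod (u k r * u (\<zeta> - k) r)"
        by (simp add: norm_mult norm_u mult_ac)
    qed
    also have "\<dots> \<le> R * R * lattice_const" by (rule norm_conv_le_of_bracket(1)[OF le le])
    finally have *: "exp (r * p \<zeta>) * cmod (conv (a (s + r)) (a (s + r)) \<zeta>) \<le> R * R * lattice_const" .
    have "cmod (n \<zeta> r) = \<bar>of_int (fst \<zeta>)\<bar> / 2 * (exp (r * p \<zeta>) * cmod (conv (a (s + r)) (a (s + r)) \<zeta>))"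
      by (simp add: n_def nonlin_def norm_mult norm_divide)
    also have "\<dots> \<le> freq_norm \<zeta> / 2 * (R * R * lattice_const)"
      by (rule mult_mono) (use abs_fst_le_freq_norm[of \<zeta>] * in auto)
    also have "\<dots> = P * freq_norm \<zeta> * R" by (simp add: P_def R_def)
    finally show ?thesis .
  qed
  \<comment> \<open>The truncated weight never exceeds exp(T N) on the time interval; the threshold
    compensates for it, so modes outside F remain below the barrier by the majorant alone.\<close>
  define F where "F = {\<zeta>. bracket \<zeta> * m \<zeta> \<ge> R * exp (- (T * N))}"
  have R0: "R > 0" using M by (simp add: R_def)
  have finF: "finite F"
  proof -
    have "finite {\<xi>. (bracket \<xi> * m \<xi>)\<^sup>2 \<ge> (R * exp (- (T * N)))\<^sup>2}"
      by (rule finite_ge_of_summable_on[OF m(3)]) (use R0 in auto)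
    moreover have "F \<subseteq> {\<xi>. (bracket \<xi> * m \<xi>)\<^sup>2 \<ge> (R * exp (- (T * N)))\<^sup>2}"
      using R0 by (auto simp: F_def intro!: power_mono)
    ultimately show ?thesis by (rule finite_subset[rotated])
  qed
  have "(cmod (u \<xi> \<tau>))\<^sup>2 - (R / bracket \<xi>)\<^sup>2 < 0"
  proof (rule barrier[where F = F and v = "\<lambda>\<xi> r. (cmod (u \<xi> r))\<^sup>2 - (R / bracket \<xi>)\<^sup>2" and T = T
        and v' = "\<lambda>\<xi> r. 2 * Re (cnj (u \<xi> r) * (complex_of_real (lam \<xi> + p \<xi>) * u \<xi> r + n \<xi> r))"])
    show "finite F" by (rule finF)
    show "\<tau> \<in> {0..T}" using tau by (simp add: T_def)
  next
    fix \<zeta> r assume \<zeta>: "\<zeta> \<notin> F" and r: "r \<in> {0..T}"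
    have "r * p \<zeta> \<le> T * N" using r p0[of \<zeta>] by (intro mult_mono) auto
    then have "cmod (u \<zeta> r) \<le> exp (T * N) * m \<zeta>"
      unfolding norm_u using r s by (intro mult_mono m) auto
    also have "\<dots> < R / bracket \<zeta>"
    proof -
      have "bracket \<zeta> * m \<zeta> < R * exp (- (T * N))" using \<zeta> by (simp add: F_def)
      from mult_strict_left_mono[OF this, of "exp (T * N)"]
      have "exp (T * N) * (bracket \<zeta> * m \<zeta>) < R" by (simp add: exp_minus field_simps)
      then show ?thesis by (simp add: field_simps)
    qed
    finally show "(cmod (u \<zeta> r))\<^sup>2 - (R / bracket \<zeta>)\<^sup>2 < 0" by (simp add: power_strict_mono)
  next
    fix \<zeta>
    have "cmod (u \<zeta> 0) \<le> M / bracket \<zeta>" using M(2)[OF s, of \<zeta>] by (simp add: norm_u)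
    also have "\<dots> < R / bracket \<zeta>" using M by (intro divide_strict_right_mono) (auto simp: R_def)
    finally show "(cmod (u \<zeta> 0))\<^sup>2 - (R / bracket \<zeta>)\<^sup>2 < 0" by (simp add: power_strict_mono)
  next
    fix \<zeta> r assume r: "r \<in> {0..T}"
    show "((\<lambda>r. (cmod (u \<zeta> r))\<^sup>2 - (R / bracket \<zeta>)\<^sup>2) has_real_derivative
      2 * Re (cnj (u \<zeta> r) * (complex_of_real (lam \<zeta> + p \<zeta>) * u \<zeta> r + n \<zeta> r))) (at r within {0..T})"
      using DERIV_diff[OF has_real_derivative_cmod_sq[OF du[OF r, of \<zeta>]] DERIV_const[of "(R / bracket \<zeta>)\<^sup>2"]] by simp
  next
    fix \<zeta> r assume r: "r \<in> {0..T}" and eq: "(cmod (u \<zeta> r))\<^sup>2 - (R / bracket \<zeta>)\<^sup>2 = 0"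
      and all: "\<And>\<zeta>. (cmod (u \<zeta> r))\<^sup>2 - (R / bracket \<zeta>)\<^sup>2 \<le> 0"
    define h where "h = R / bracket \<zeta>"
    have h0: "h > 0" using R0 by (simp add: h_def)
    have le: "cmod (u \<zeta> r) \<le> R / bracket \<zeta>" for \<zeta>
      using power2_le_imp_le[of "cmod (u \<zeta> r)" "R / bracket \<zeta>"] all[of \<zeta>] R0 by simp
    have eq': "cmod (u \<zeta> r) = h"
      by (rule power2_eq_imp_eq) (use eq h0 in \<open>simp_all add: h_def\<close>)
    have big: "bracket \<zeta> > 2 * (c0 + (1 + P)\<^sup>2 / (2 * \<kappa>)) / \<kappa>"
    proof (rule ccontr)
      assume "\<not> ?thesis"
      then have "bracket \<zeta> \<le> W" by (simp add: W_def)
      then have "r * p \<zeta> \<le> T * W" using p0[of \<zeta>] freq_norm_le_bracket[of \<zeta>] r by (intro mult_mono) auto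
      also have "\<dots> = 1 / 2" using W1 by (simp add: T_def)
      finally have "exp (r * p \<zeta>) \<le> exp (1 / 2)" by simp
      also have "\<dots> \<le> 2" using exp_half_le2 by simp
      finally have "cmod (u \<zeta> r) \<le> 2 * (M / bracket \<zeta>)"
        unfolding norm_u using M(2)[of "s + r" \<zeta>] s r by (intro mult_mono) auto
      also have "\<dots> < h" using M by (simp add: h_def R_def divide_strict_right_mono)
      finally show False using eq' by simp
    qed
    have "Re (cnj (u \<zeta> r) * (complex_of_real (lam \<zeta> + p \<zeta>) * u \<zeta> r + n \<zeta> r))
      \<le> (lam \<zeta> + p \<zeta>) * h\<^sup>2 + h * (P * freq_norm \<zeta> * R)"
      using Re_cnj_mult_le[OF n_bound[OF r le, of \<zeta>], of "u \<zeta> r" "lam \<zeta> + p \<zeta>"] unfolding eq' .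
    also have "R = bracket \<zeta> * h" by (simp add: h_def)
    also have "(lam \<zeta> + p \<zeta>) * h\<^sup>2 + h * (P * freq_norm \<zeta> * (bracket \<zeta> * h))
      = (lam \<zeta> + p \<zeta> + P * freq_norm \<zeta> * bracket \<zeta>) * h\<^sup>2" by (simp add: power2_eq_square algebra_simps)
    also have "\<dots> < 0"
      using symbol_negative[OF P0 big] p0(2)[of \<zeta>] h0 by (intro mult_neg_pos) auto
    finally show "2 * Re (cnj (u \<zeta> r) * (complex_of_real (lam \<zeta> + p \<zeta>) * u \<zeta> r + n \<zeta> r)) < 0" by simp
  qed
  then have "(cmod (u \<xi> \<tau>))\<^sup>2 \<le> (R / bracket \<xi>)\<^sup>2" by simp
  then have "cmod (u \<xi> \<tau>) \<le> R / bracket \<xi>"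
    by (rule power2_le_imp_le) (use R0 in simp)
  then show ?thesis by (simp add: norm_u p_def N_def R_def)
qed

end

subsection \<open>The Lyapunov functional\<close>

text \<open>A level r above both f 0 and C cannot be reached, because f' would be at most C - r < 0
  there. The bound is independent of T.\<close>

lemma gronwall_max:
  fixes f f' :: "real \<Rightarrow> real"
  assumes d: "\<And>t. t \<in> {0..T} \<Longrightarrow> (f has_real_derivative f' t) (at t within {0..T})"
    and le: "\<And>t. t \<in> {0..T} \<Longrightarrow> f' t \<le> - f t + C" and t: "t \<in> {0..T}"
  shows "f t \<le> max (f 0) C"
proof (rule dense_ge)
  fix r assume r: "max (f 0) C < r"
  have "f t - r < 0"
  proof (rule barrier_real[where T = T and v = "\<lambda>t. f t - r" and v' = f'])
    show "((\<lambda>t. f t - r) has_real_derivative f' t) (at t within {0..T})" if "t \<in> {0..T}" for t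
      using DERIV_diff[OF d[OF that] DERIV_const[of r]] by simp
    show "f' t < 0" if "t \<in> {0..T}" "f t - r = 0" for t
      using le[OF that(1)] that(2) r by simp
  qed (use r t in auto)
  then show "f t \<le> r" by simp
qed

section \<open>The Fejer kernel tested against the square of an odd function\<close>

definition hat :: "nat \<Rightarrow> int \<Rightarrow> real" where
  "hat n m = max 0 (1 - \<bar>of_int m\<bar> / real n)"

text \<open>The numerator 2 comes from 1 / l^2 \<le> 2 / (1 + l^2) for l \<noteq> 0; the right-hand
  side is also meaningful at l = 0.\<close>

definition int_const :: real where
  "int_const = (\<Sum>\<^sub>\<infinity>l::int. 2 / (1 + (of_int l)\<^sup>2))"

lemma summable_on_int_const: "(\<lambda>l::int. 2 / (1 + (of_int l)\<^sup>2) :: real) summable_on UNIV"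
  using summable_on_cmult_right[OF summable_on_inverse_int_sq, of 2] by simp

lemma int_const_nonneg: "int_const \<ge> 0"
  unfolding int_const_def by (rule infsum_nonneg) auto

lemma hat_0 [simp]: "hat n 0 = 1"
  by (simp add: hat_def)

lemma hat_bounds: "0 \<le> hat n m" "hat n m \<le> 1"
  by (auto simp: hat_def)

lemma hat_eq_0: "n > 0 \<Longrightarrow> m \<notin> {- int n..int n} \<Longrightarrow> hat n m = 0"
proof -
  assume "n > 0" "m \<notin> {- int n..int n}"
  then have "real n \<le> \<bar>of_int m\<bar>" by auto
  then show ?thesis using \<open>n > 0\<close> by (simp add: hat_def field_simps)
qed

text \<open>The distance between |x + l| and |x - l| is twice the smaller of |x| and |l|. For
  integers this is at most twice their product, the form that distributes one derivative to each
  factor of the quadratic form.\<close>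

lemma hat_diff:
  assumes n: "n > 0"
  shows "\<bar>hat n (x + l) - hat n (x - l)\<bar> \<le> 2 / real n * \<bar>of_int x\<bar> * \<bar>of_int l\<bar>"
proof -
  have lip: "\<bar>hat n p - hat n q\<bar> \<le> \<bar>\<bar>of_int p\<bar> - \<bar>of_int q\<bar>\<bar> / real n" for p q
  proof -
    have "\<bar>hat n p - hat n q\<bar> \<le> \<bar>(1 - \<bar>of_int p\<bar> / real n) - (1 - \<bar>of_int q\<bar> / real n)\<bar>"
      unfolding hat_def by linarith
    also have "\<dots> = \<bar>\<bar>of_int p\<bar> - \<bar>of_int q\<bar>\<bar> / real n"
      using n by (simp add: diff_divide_distrib[symmetric] abs_divide abs_minus_commute)
    finally show ?thesis .
  qed
  have "\<bar>\<bar>x + l\<bar> - \<bar>x - l\<bar>\<bar> \<le> 2 * \<bar>x\<bar> * \<bar>l\<bar>"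
  proof (cases "x = 0 \<or> l = 0")
    case False
    have "\<bar>\<bar>x + l\<bar> - \<bar>x - l\<bar>\<bar> \<le> 2 * \<bar>x\<bar>" by linarith
    also have "\<dots> \<le> 2 * \<bar>x\<bar> * \<bar>l\<bar>" proof -
      have "1 \<le> \<bar>l\<bar>" using False by linarith
      from mult_left_mono[OF this, of "2 * \<bar>x\<bar>"] show ?thesis by simp
    qed
    finally show ?thesis .
  qed auto
  then have "real_of_int \<bar>\<bar>x + l\<bar> - \<bar>x - l\<bar>\<bar> \<le> real_of_int (2 * \<bar>x\<bar> * \<bar>l\<bar>)"
    by (simp only: of_int_le_iff)
  then have "\<bar>\<bar>real_of_int (x + l)\<bar> - \<bar>real_of_int (x - l)\<bar>\<bar> \<le> 2 * \<bar>of_int x\<bar> * \<bar>of_int l\<bar>" by simp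
  then have "\<bar>\<bar>real_of_int (x + l)\<bar> - \<bar>real_of_int (x - l)\<bar>\<bar> / real n \<le> 2 * \<bar>of_int x\<bar> * \<bar>of_int l\<bar> / real n"
    by (rule divide_right_mono) simp
  with lip[of "x + l" "x - l"] show ?thesis by simp
qed

text \<open>
  The triple product is a convergent triple sum; moving the derivative between the factors gives
  $I = 2\overline{I}$.
\<close>

lemma triple_product_cancels:
  fixes A :: "int \<times> int \<Rightarrow> complex"
  assumes A: "sq_summable A" and A1: "sq_summable (\<lambda>k. of_int (fst k) * A k)"
    and l1: "(\<lambda>k. cmod (A k)) summable_on UNIV" and real: "\<And>k. A (- k) = cnj (A k)"
  shows "(\<Sum>\<^sub>\<infinity>\<xi>. cnj (A \<xi>) * (of_int (fst \<xi>) * conv A A \<xi>)) = 0" (is "?I = 0")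
proof -
  define g where "g k = of_int (fst k) * A k" for k
  have g: "sq_summable g" using A1 by (simp add: g_def[abs_def])
  \<comment> \<open>Absolute convergence of the double sum, required to exchange the order of
    summation: the factor at the difference is taken in l^1, the other two are paired by
    Cauchy-Schwarz.\<close>
  have s1: "(\<lambda>(j, \<xi>). cmod (A j) * cmod (A \<xi> * g (\<xi> - j))) summable_on UNIV \<times> UNIV"
  proof (rule summable_on_SigmaI)
    have *: "(\<lambda>\<xi>. cmod (A \<xi> * g (\<xi> - j))) summable_on UNIV"
      "(\<Sum>\<^sub>\<infinity>\<xi>. cmod (A \<xi> * g (\<xi> - j))) \<le> sqrt (sqsum A) * sqrt (sqsum g)" for j
    proof -
      define g' where "g' k = g (- k)" for k
      have "sq_summable g'" "sqsum g' = sqsum g"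
        using sq_summable_shift[of g 0] sqsum_shift[of g 0] g by (simp_all add: g'_def[abs_def])
      then show "(\<lambda>\<xi>. cmod (A \<xi> * g (\<xi> - j))) summable_on UNIV"
        "(\<Sum>\<^sub>\<infinity>\<xi>. cmod (A \<xi> * g (\<xi> - j))) \<le> sqrt (sqsum A) * sqrt (sqsum g)"
        using conv_abs_summable[OF A, of g' j] by (simp_all add: g'_def)
    qed
    show "((\<lambda>\<xi>. case (j, \<xi>) of (j, \<xi>) \<Rightarrow> cmod (A j) * cmod (A \<xi> * g (\<xi> - j))) has_sum
       cmod (A j) * (\<Sum>\<^sub>\<infinity>\<xi>. cmod (A \<xi> * g (\<xi> - j)))) UNIV" for j
      using has_sum_cmult_right[OF has_sum_infsum[OF *(1)[of j]], of "cmod (A j)"] by simp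
    show "(\<lambda>j. cmod (A j) * (\<Sum>\<^sub>\<infinity>\<xi>. cmod (A \<xi> * g (\<xi> - j)))) summable_on UNIV"
    proof (rule summable_on_comparison_test[OF summable_on_cmult_left[OF l1, of "sqrt (sqsum A) * sqrt (sqsum g)"]])
      show "cmod (A j) * (\<Sum>\<^sub>\<infinity>\<xi>. cmod (A \<xi> * g (\<xi> - j))) \<le> cmod (A j) * (sqrt (sqsum A) * sqrt (sqsum g))" for j
        using *(2)[of j] by (intro mult_left_mono) auto
      show "0 \<le> cmod (A j) * (\<Sum>\<^sub>\<infinity>\<xi>. cmod (A \<xi> * g (\<xi> - j)))" for j
        by (intro mult_nonneg_nonneg infsum_nonneg) auto
    qed
  qed auto
  have bij: "bij_betw (\<lambda>(\<xi>, k). (\<xi> - k, \<xi>)) (UNIV \<times> UNIV :: ((int\<times>int)\<times>(int\<times>int)) set) (UNIV \<times> UNIV)"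
    by (rule bij_betw_byWitness[where f' = "\<lambda>(j, \<xi>). (\<xi>, \<xi> - j)"]) auto
  have "(\<lambda>p. (\<lambda>(j, \<xi>). cmod (A j) * cmod (A \<xi> * g (\<xi> - j))) ((\<lambda>(\<xi>, k). (\<xi> - k, \<xi>)) p)) summable_on UNIV \<times> UNIV"
    by (rule iffD2[OF summable_on_reindex_bij_betw[OF bij] s1])
  then have s2: "(\<lambda>p. norm (case p of (\<xi>, k) \<Rightarrow> cnj (A \<xi>) * (g k * A (\<xi> - k)))) summable_on UNIV \<times> UNIV"
    by (simp add: case_prod_unfold norm_mult mult_ac)
  have swap: "(\<Sum>\<^sub>\<infinity>\<xi>. \<Sum>\<^sub>\<infinity>k. cnj (A \<xi>) * (g k * A (\<xi> - k))) = (\<Sum>\<^sub>\<infinity>k. \<Sum>\<^sub>\<infinity>\<xi>. cnj (A \<xi>) * (g k * A (\<xi> - k)))"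
    using infsum_swap_banach[OF abs_summable_summable[OF s2]] .
  have "?I = (\<Sum>\<^sub>\<infinity>\<xi>. 2 * (\<Sum>\<^sub>\<infinity>k. cnj (A \<xi>) * (g k * A (\<xi> - k))))"
  proof (rule infsum_cong)
    fix \<xi>
    have "(\<Sum>\<^sub>\<infinity>k. cnj (A \<xi>) * (g k * A (\<xi> - k))) = cnj (A \<xi>) * conv g A \<xi>"
      unfolding conv_def by (rule infsum_cmult_right) (use conv_summable[OF g A] in auto)
    then show "cnj (A \<xi>) * (of_int (fst \<xi>) * conv A A \<xi>) = 2 * (\<Sum>\<^sub>\<infinity>k. cnj (A \<xi>) * (g k * A (\<xi> - k)))"
      unfolding conv_first_moment[OF A A1] g_def by simp
  qed
  also have "\<dots> = 2 * (\<Sum>\<^sub>\<infinity>\<xi>. \<Sum>\<^sub>\<infinity>k. cnj (A \<xi>) * (g k * A (\<xi> - k)))"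
    by (rule infsum_cmult_right') 
  \<comment> \<open>With \<xi> summed first, reality replaces A(\<xi> - k) by the conjugate of A(k -
    \<xi>), and the inner sum becomes the conjugate of the convolution at k.\<close>
  also have "\<dots> = 2 * (\<Sum>\<^sub>\<infinity>k. cnj (cnj (A k) * (of_int (fst k) * conv A A k)))"
    unfolding swap
  proof (intro arg_cong[where f = "\<lambda>x. 2 * x"] infsum_cong)
    fix k
    have "(\<Sum>\<^sub>\<infinity>\<xi>. cnj (A \<xi>) * (g k * A (\<xi> - k))) = (\<Sum>\<^sub>\<infinity>\<xi>. g k * cnj (A \<xi> * A (k - \<xi>)))"
    proof (rule infsum_cong)
      fix \<xi>
      have "A (\<xi> - k) = cnj (A (k - \<xi>))" using real[of "k - \<xi>"] by (simp only: minus_diff_eq)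
      then show "cnj (A \<xi>) * (g k * A (\<xi> - k)) = g k * cnj (A \<xi> * A (k - \<xi>))"
        by (simp only: complex_cnj_mult mult_ac)
    qed
    also have "\<dots> = g k * cnj (conv A A k)"
      unfolding conv_def by (simp add: infsum_cmult_right' del: complex_cnj_mult)
    finally show "(\<Sum>\<^sub>\<infinity>\<xi>. cnj (A \<xi>) * (g k * A (\<xi> - k))) = cnj (cnj (A k) * (of_int (fst k) * conv A A k))"
      by (simp add: g_def)
  qed
  also have "\<dots> = 2 * cnj ?I" by (simp del: complex_cnj_mult)
  finally have "?I = 2 * cnj ?I" .
  then have "cmod ?I = cmod (2 * cnj ?I)" by (rule arg_cong)
  also have "\<dots> = 2 * cmod ?I" by (simp only: norm_mult complex_mod_cnj norm_numeral)
  finally have "cmod ?I = 0" by linarith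
  then show ?thesis by (simp only: norm_eq_zero)
qed

text \<open>Reality turns A(k) A(-k) into |A(k)|^2, so the zero mode of the square is the L2 mass.
  This is the source of the damping term in \<open>drift_deriv\<close>.\<close>

lemma conv_at_0:
  assumes A: "sq_summable A" and "\<And>k. A (- k) = cnj (A k)"
  shows "conv A A 0 = complex_of_real (sqsum A)"
proof -
  have "conv A A 0 = (\<Sum>\<^sub>\<infinity>k. complex_of_real ((cmod (A k))\<^sup>2))"
    unfolding conv_def using assms
    by (intro infsum_cong) (subst complex_norm_square, simp)
  also have "\<dots> = complex_of_real (sqsum A)"
    unfolding sqsum_def
    by (rule infsumI, rule has_sum_of_real, rule has_sum_infsum) (use A in \<open>simp add: sq_summable_def\<close>)
  finally show ?thesis .
qed

text \<open>
  Pairing \<open>l\<close> with \<open>-l\<close> for an odd sequence turns \<open>hat\<close> into a difference, which is of order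
  $1/n$ because \<open>hat n\<close> is Lipschitz with constant $1/n$.
\<close>

lemma hat_form_small:
  fixes A :: "int \<times> int \<Rightarrow> complex"
  assumes A: "sq_summable (\<lambda>\<xi>. complex_of_real (bracket \<xi>) * A \<xi>)"
    and odd: "\<And>\<xi>. A (reflect \<xi>) = - A \<xi>" and n: "n > 0"
  shows "cmod (\<Sum>m\<in>{- int n..int n}. complex_of_real (hat n m) * conv A A (m, 0))
    \<le> int_const / real n * sqsum (\<lambda>\<xi>. complex_of_real (bracket \<xi>) * A \<xi>)"
proof -
  define Y where "Y = sqsum (\<lambda>\<xi>. complex_of_real (bracket \<xi>) * A \<xi>)"
  define z where "z l = (2 / (1 + (of_int l)\<^sup>2) :: real)" for l :: int
  \<comment> \<open>Moduli of the coefficients of the second x-derivative, whose multiplier is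
    dominated by \<open>bracket\<close>.\<close>
  define B where "B \<xi> = (of_int (fst \<xi>))\<^sup>2 * cmod (A \<xi>)" for \<xi>
  \<comment> \<open>Pairs of modes whose sum has second component 0 are parametrized by the first
    mode \<xi> and the first component l of the second; \<open>hat n\<close> is then evaluated at
    \<open>fst \<xi> + l\<close>.\<close>
  define p where "p = (\<lambda>(\<xi>, l). A \<xi> * A (l, - snd \<xi>))"
  \<comment> \<open>G1 and G2 are the two halves of an arithmetic-geometric majorant: a squared
    coefficient of the second derivative times a summable weight in the remaining variable.
    Exchanging the two modes maps one to the other, so they have the same sum.\<close>
  define G1 where "G1 = (\<lambda>(\<xi>, l). (B \<xi>)\<^sup>2 * z l)"
  define G2 where "G2 = (\<lambda>(\<xi> :: int \<times> int, l). (B (l, - snd \<xi>))\<^sup>2 * z (fst \<xi>))"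
  define G where "G q = (1/2) * G1 q + (1/2) * G2 q" for q
  have z0: "z l \<ge> 0" for l by (simp add: z_def)
  have odd0: "A (0, y) = 0" for y
  proof -
    have "A (0, y) = - A (0, y)" using odd[of "(0, y)"] by (simp add: reflect_def)
    then show ?thesis by (simp add: eq_neg_iff_add_eq_0)
  qed
  have B_le: "(B \<xi>)\<^sup>2 \<le> (cmod (complex_of_real (bracket \<xi>) * A \<xi>))\<^sup>2" for \<xi>
    unfolding B_def using fst_sq_le_bracket[of \<xi>] by (intro power_mono) (auto simp: norm_mult mult_right_mono)
  have sB: "(\<lambda>\<xi>. (B \<xi>)\<^sup>2) summable_on UNIV"
    by (rule summable_on_comparison_test[OF A[unfolded sq_summable_def]]) (use B_le in auto)
  have BY: "(\<Sum>\<^sub>\<infinity>\<xi>. (B \<xi>)\<^sup>2) \<le> Y"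
    unfolding Y_def sqsum_def by (rule infsum_mono) (use sB A[unfolded sq_summable_def] B_le in auto)
  have hsz: "(z has_sum int_const) UNIV"
    using summable_on_int_const unfolding z_def[abs_def] int_const_def by simp
  have hs1: "(G1 has_sum (\<Sum>\<^sub>\<infinity>\<xi>. (B \<xi>)\<^sup>2) * int_const) (UNIV \<times> UNIV)"
  proof (rule has_sum_SigmaI)
    show "((\<lambda>l. G1 (\<xi>, l)) has_sum (B \<xi>)\<^sup>2 * int_const) UNIV" for \<xi>
      unfolding G1_def using has_sum_cmult_right[OF hsz, of "(B \<xi>)\<^sup>2"] by simp
    show hs: "((\<lambda>\<xi>. (B \<xi>)\<^sup>2 * int_const) has_sum (\<Sum>\<^sub>\<infinity>\<xi>. (B \<xi>)\<^sup>2) * int_const) UNIV"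
      by (rule has_sum_cmult_left) (use sB in simp)
    show "G1 summable_on UNIV \<times> UNIV"
    proof (rule summable_on_SigmaI)
      show "((\<lambda>l. G1 (\<xi>, l)) has_sum (B \<xi>)\<^sup>2 * int_const) UNIV" for \<xi>
        unfolding G1_def using has_sum_cmult_right[OF hsz, of "(B \<xi>)\<^sup>2"] by simp
      show "(\<lambda>\<xi>. (B \<xi>)\<^sup>2 * int_const) summable_on UNIV" using hs by (rule has_sum_imp_summable)
    qed (auto simp: G1_def z0)
  qed
  have bij2: "bij_betw (\<lambda>(\<xi> :: int \<times> int, l :: int). ((l, - snd \<xi>), fst \<xi>)) (UNIV \<times> UNIV) (UNIV \<times> UNIV)"
    by (rule bij_betw_byWitness[where f' = "\<lambda>(\<xi> :: int \<times> int, l). ((l, - snd \<xi>), fst \<xi>)"]) auto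
  have hs2: "(G2 has_sum (\<Sum>\<^sub>\<infinity>\<xi>. (B \<xi>)\<^sup>2) * int_const) (UNIV \<times> UNIV)"
  proof -
    have "G2 = (\<lambda>q. G1 ((\<lambda>(\<xi> :: int \<times> int, l :: int). ((l, - snd \<xi>), fst \<xi>)) q))"
      by (auto simp: G1_def G2_def)
    then show ?thesis using has_sum_reindex_bij_betw[OF bij2, of G1] hs1 by simp
  qed
  have hsG: "(G has_sum (\<Sum>\<^sub>\<infinity>\<xi>. (B \<xi>)\<^sup>2) * int_const) UNIV"
    using has_sum_add[OF has_sum_cmult_right[OF hs1, of "1/2"] has_sum_cmult_right[OF hs2, of "1/2"]]
    by (simp add: G_def[abs_def] mult.commute)
  \<comment> \<open>Of two x-derivatives on each mode, the weight uses one, which leaves 1/|x| and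
    1/|l|. The denominators are exchanged between the factors, so that each square splits into a
    function of \<xi> and l with separate summability.\<close>
  have key: "\<bar>of_int (fst \<xi>)\<bar> * \<bar>of_int l\<bar> * cmod (p (\<xi>, l)) \<le> G (\<xi>, l)" for \<xi> l
  proof (cases "fst \<xi> = 0 \<or> l = 0")
    case True
    have "G (\<xi>, l) \<ge> 0" by (simp add: G_def G1_def G2_def z0)
    then show ?thesis using True by auto
  next
    case False
    define x y where "x = \<bar>real_of_int (fst \<xi>)\<bar>" and "y = \<bar>real_of_int l\<bar>"
    have xy: "x \<ge> 1" "y \<ge> 1" using False by (auto simp: x_def y_def)
    have inv: "1 / q \<le> 2 / (1 + q)" if "1 \<le> q" for q :: real
      using that by (simp add: divide_simps)
    define b c where "b = B \<xi>" and "c = B (l, - snd \<xi>)"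
    have "x * y * cmod (p (\<xi>, l)) = (b / y) * (c / x)"
    proof -
      have "b = x\<^sup>2 * cmod (A \<xi>)" "c = y\<^sup>2 * cmod (A (l, - snd \<xi>))"
        by (simp_all add: b_def c_def B_def x_def y_def)
      then show ?thesis using xy by (simp add: p_def norm_mult power2_eq_square field_simps)
    qed
    also have "\<dots> \<le> 1/2 * (b / y)\<^sup>2 + 1/2 * (c / x)\<^sup>2"
      using sum_squares_bound[of "b / y" "c / x"] by simp
    also have "(b / y)\<^sup>2 \<le> G1 (\<xi>, l)"
    proof -
      have "1 \<le> y\<^sup>2" using xy by simp
      from inv[OF this] have "1 / y\<^sup>2 \<le> z l" by (simp add: z_def y_def)
      from mult_left_mono[OF this, of "b\<^sup>2"] show ?thesis by (simp add: G1_def b_def power_divide)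
    qed
    also have "(c / x)\<^sup>2 \<le> G2 (\<xi>, l)"
    proof -
      have "1 \<le> x\<^sup>2" using xy by simp
      from inv[OF this] have "1 / x\<^sup>2 \<le> z (fst \<xi>)" by (simp add: z_def x_def)
      from mult_left_mono[OF this, of "c\<^sup>2"] show ?thesis by (simp add: G2_def c_def power_divide)
    qed
    finally show ?thesis by (simp add: G_def x_def y_def)
  qed
  \<comment> \<open>The weight may be dropped: p vanishes by oddness if one of the first components
    is 0, and otherwise the weight is a product of nonzero integers.\<close>
  have key0: "cmod (p (\<xi>, l)) \<le> G (\<xi>, l)" for \<xi> l
  proof (cases "fst \<xi> = 0 \<or> l = 0")
    case True
    then have "p (\<xi>, l) = 0" using odd0 by (cases \<xi>) (auto simp: p_def)
    then show ?thesis by (simp add: G_def G1_def G2_def z0)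
  next
    case False
    then have "1 * 1 \<le> \<bar>real_of_int (fst \<xi>)\<bar> * \<bar>real_of_int l\<bar>" by (intro mult_mono) auto
    from mult_right_mono[OF this, of "cmod (p (\<xi>, l))"] show ?thesis using key[of \<xi> l] by simp
  qed
  define Tp where "Tp = (\<lambda>(\<xi>, l). complex_of_real (hat n (fst \<xi> + l)) * p (\<xi>, l))"
  define Tm where "Tm = (\<lambda>(\<xi>, l). complex_of_real (hat n (fst \<xi> - l)) * p (\<xi>, l))"
  have absT: "(\<lambda>q. norm (Tp q)) summable_on UNIV" "(\<lambda>q. norm (Tm q)) summable_on UNIV"
  proof -
    have le: "norm (complex_of_real (hat n m) * p (\<xi>, l)) \<le> G (\<xi>, l)" for m \<xi> l
      using mult_mono[OF hat_bounds(2)[of n m] key0[of \<xi> l]] hat_bounds(1)[of n m] by (simp add: norm_mult)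
    show "(\<lambda>q. norm (Tp q)) summable_on UNIV" "(\<lambda>q. norm (Tm q)) summable_on UNIV"
      by (rule summable_on_comparison_test[OF has_sum_imp_summable[OF hsG]];
          use le in \<open>force simp: Tp_def Tm_def\<close>)+
  qed
  have sT: "Tp summable_on UNIV" "Tm summable_on UNIV"
    using absT by (auto intro: abs_summable_summable)
  have pneg: "p (\<xi>, - l) = - p (\<xi>, l)" for \<xi> l
    using odd[of "(l, - snd \<xi>)"] by (simp add: p_def reflect_def)
  have bij3: "bij (\<lambda>(\<xi> :: int \<times> int, l :: int). (\<xi>, - l))"
    by (rule bij_betw_byWitness[where f' = "\<lambda>(\<xi>, l). (\<xi>, - l)"]) auto
  \<comment> \<open>Changing the sign of l flips p and turns the argument of \<open>hat n\<close>
    from a sum into a difference. Hence Tp and -Tm have equal sums, and twice the form is a sum over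
    differences of \<open>hat n\<close>.\<close>
  have TpTm: "infsum Tp UNIV = - infsum Tm UNIV"
  proof -
    have "infsum Tp UNIV = (\<Sum>\<^sub>\<infinity>q. Tp ((\<lambda>(\<xi>, l). (\<xi>, - l)) q))"
      using infsum_reindex_bij_betw[OF bij3, of Tp] by simp
    also have "\<dots> = (\<Sum>\<^sub>\<infinity>q. - Tm q)"
      by (intro infsum_cong) (auto simp: Tp_def Tm_def pneg)
    finally show ?thesis by (simp add: infsum_uminus)
  qed
  have Q_eq: "(\<Sum>m\<in>{- int n..int n}. complex_of_real (hat n m) * conv A A (m, 0)) = infsum Tp UNIV"
  proof -
    define U where "U = (\<lambda>(m, \<xi>). complex_of_real (hat n m) * (A \<xi> * A ((m, 0) - \<xi>)))"
    have bij4: "bij_betw (\<lambda>(m, \<xi>). (\<xi>, m - fst \<xi>)) (UNIV \<times> UNIV :: (int \<times> int \<times> int) set) UNIV"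
      by (rule bij_betw_byWitness[where f' = "\<lambda>(\<xi>, l). (fst \<xi> + l, \<xi>)"]) auto
    have U: "U = (\<lambda>q. Tp ((\<lambda>(m, \<xi>). (\<xi>, m - fst \<xi>)) q))"
      by (auto simp: U_def Tp_def p_def)
    have sU: "U summable_on UNIV \<times> UNIV"
      unfolding U by (rule iffD2[OF summable_on_reindex_bij_betw[OF bij4] sT(1)])
    have "infsum Tp UNIV = infsum U (UNIV \<times> UNIV)"
      unfolding U using infsum_reindex_bij_betw[OF bij4, of Tp] by simp
    also have "\<dots> = (\<Sum>\<^sub>\<infinity>m. \<Sum>\<^sub>\<infinity>\<xi>. U (m, \<xi>))"
      using infsum_Sigma'_banach[of "\<lambda>m \<xi>. U (m, \<xi>)" UNIV "\<lambda>_. UNIV"] sU by simp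
    also have "\<dots> = (\<Sum>\<^sub>\<infinity>m. complex_of_real (hat n m) * conv A A (m, 0))"
      unfolding U_def conv_def by (simp add: infsum_cmult_right')
    also have "\<dots> = (\<Sum>\<^sub>\<infinity>m\<in>{- int n..int n}. complex_of_real (hat n m) * conv A A (m, 0))"
      by (rule infsum_cong_neutral) (use hat_eq_0[OF n] in auto)
    finally show ?thesis by simp
  qed
  have "2 * infsum Tp UNIV = (\<Sum>\<^sub>\<infinity>q. Tp q + - Tm q)"
    using sT by (subst infsum_add) (auto simp: infsum_uminus TpTm summable_on_uminus)
  then have "cmod (2 * infsum Tp UNIV) = cmod (\<Sum>\<^sub>\<infinity>q. Tp q + - Tm q)"
    by (rule arg_cong)
  then have "2 * cmod (infsum Tp UNIV) = cmod (\<Sum>\<^sub>\<infinity>q. Tp q + - Tm q)"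
    by (simp only: norm_mult norm_numeral)
  also have "\<dots> \<le> (\<Sum>\<^sub>\<infinity>q. 2 / real n * G q)"
  proof (rule norm_infsum_le[OF has_sum_infsum has_sum_infsum])
    show "(\<lambda>q. Tp q + - Tm q) summable_on UNIV"
      using sT by (intro summable_on_add) (auto simp: summable_on_uminus)
    show "(\<lambda>q. 2 / real n * G q) summable_on UNIV"
      by (rule summable_on_cmult_right[OF has_sum_imp_summable[OF hsG]])
    fix q :: "(int \<times> int) \<times> int"
    obtain \<xi> l where q: "q = (\<xi>, l)" by fastforce
    have "Tp q + - Tm q = complex_of_real (hat n (fst \<xi> + l) - hat n (fst \<xi> - l)) * p (\<xi>, l)"
      by (simp add: q Tp_def Tm_def algebra_simps)
    then have "norm (Tp q + - Tm q) = \<bar>hat n (fst \<xi> + l) - hat n (fst \<xi> - l)\<bar> * cmod (p (\<xi>, l))"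
      by (simp only: norm_mult norm_of_real)
    also have "\<dots> \<le> (2 / real n * \<bar>of_int (fst \<xi>)\<bar> * \<bar>of_int l\<bar>) * cmod (p (\<xi>, l))"
      by (intro mult_right_mono hat_diff n) auto
    also have "\<dots> = 2 / real n * (\<bar>of_int (fst \<xi>)\<bar> * \<bar>of_int l\<bar> * cmod (p (\<xi>, l)))" by simp
    also have "\<dots> \<le> 2 / real n * G q"
      unfolding q using key[of \<xi> l] by (intro mult_left_mono) auto
    finally show "norm (Tp q + - Tm q) \<le> 2 / real n * G q" .
  qed
  also have "\<dots> = 2 / real n * ((\<Sum>\<^sub>\<infinity>\<xi>. (B \<xi>)\<^sup>2) * int_const)"
    by (rule infsumI, rule has_sum_cmult_right, rule hsG)
  also have "\<dots> \<le> 2 / real n * (Y * int_const)"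
    using BY int_const_nonneg by (intro mult_left_mono mult_right_mono) auto
  also have "\<dots> = 2 * (int_const / real n * Y)" by simp
  finally show ?thesis unfolding Q_eq Y_def[symmetric] by linarith
qed

text \<open>
  The Fourier coefficients of the function $\phi$ with $\phi'=K(1-D)$, where $D$ is the Fejer kernel with
  coefficients \<open>hat n\<close>.
\<close>

definition profile :: "real \<Rightarrow> nat \<Rightarrow> int \<Rightarrow> complex" where
  "profile K n m = \<i> * complex_of_real (K * hat n m / of_int m)"

definition profile_modes :: "nat \<Rightarrow> int set" where
  "profile_modes n = {- int n..int n} - {0}"

definition profile_norm :: "real \<Rightarrow> nat \<Rightarrow> real" where
  "profile_norm K n = (\<Sum>m\<in>profile_modes n. cmod (profile K n m))"

text \<open>Sum of the moduli of the coefficients of the linear operator applied to the profile; it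
  bounds the linear term in the derivative of the pairing.\<close>

definition profile_symbol_norm :: "(int \<times> int \<Rightarrow> real) \<Rightarrow> real \<Rightarrow> nat \<Rightarrow> real" where
  "profile_symbol_norm lam K n = (\<Sum>m\<in>profile_modes n. cmod (profile K n m) * \<bar>lam (m, 0)\<bar>)"

context modal_flow begin

text \<open>The pairing of the profile with the solution, without Parseval's factor. Only
  frequencies with second component 0 occur because the profile depends on x alone.\<close>

definition drift :: "real \<Rightarrow> nat \<Rightarrow> real \<Rightarrow> real" where
  "drift K n t = (\<Sum>m\<in>profile_modes n. Re (cnj (profile K n m) * a t (m, 0)))"

lemma finite_profile_modes [simp]: "finite (profile_modes n)"
  by (simp add: profile_modes_def)

lemma abs_drift_le:
  assumes "t \<ge> 0"
  shows "\<bar>drift K n t\<bar> \<le> profile_norm K n * sqrt (sqsum (a t))"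
proof -
  have "\<bar>drift K n t\<bar> \<le> (\<Sum>m\<in>profile_modes n. \<bar>Re (cnj (profile K n m) * a t (m, 0))\<bar>)"
    unfolding drift_def by (rule sum_abs)
  also have "\<dots> \<le> (\<Sum>m\<in>profile_modes n. cmod (profile K n m) * sqrt (sqsum (a t)))"
  proof (rule sum_mono)
    fix m
    have "\<bar>Re (cnj (profile K n m) * a t (m, 0))\<bar> \<le> cmod (profile K n m) * cmod (a t (m, 0))"
      using abs_Re_le_cmod[of "cnj (profile K n m) * a t (m, 0)"] by (simp add: norm_mult)
    also have "\<dots> \<le> cmod (profile K n m) * sqrt (sqsum (a t))"
      using norm_le_sqrt_sqsum[OF sq_summable_a(1)[OF assms]] by (intro mult_left_mono) auto
    finally show "\<bar>Re (cnj (profile K n m) * a t (m, 0))\<bar> \<le> cmod (profile K n m) * sqrt (sqsum (a t))" .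
  qed
  also have "\<dots> = profile_norm K n * sqrt (sqsum (a t))"
    by (simp add: profile_norm_def sum_distrib_right)
  finally show ?thesis .
qed

text \<open>The factor 1/m of the profile cancels the derivative in the nonlinearity. Completing the
  sum over m by m = 0, where the convolution equals \<open>sqsum (a t)\<close>, separates the
  damping from the Fejer form that \<open>hat_form_small\<close> estimates.\<close>

lemma drift_deriv:
  assumes t: "t \<in> {0..T}" and n: "n > 0"
  shows "(drift K n has_real_derivative
     ((\<Sum>m\<in>profile_modes n. lam (m, 0) * Re (cnj (profile K n m) * a t (m, 0)))
       - K / 2 * (Re (\<Sum>m\<in>{- int n..int n}. complex_of_real (hat n m) * conv (a t) (a t) (m, 0)) - sqsum (a t))))
     (at t within {0..T})"
proof -
  have t0: "t \<ge> 0" using t by simp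
  have d: "((\<lambda>t. Re (cnj (profile K n m) * a t (m, 0))) has_real_derivative
      Re (cnj (profile K n m) * (complex_of_real (lam (m, 0)) * a t (m, 0) + nonlin t (m, 0)))) (at t within {0..T})" for m
  proof -
    have "((\<lambda>t. cnj (profile K n m) * a t (m, 0)) has_vector_derivative
      cnj (profile K n m) * (complex_of_real (lam (m, 0)) * a t (m, 0) + nonlin t (m, 0))) (at t within {0..T})"
      using deriv_within[OF t, of "(m, 0)"] by (rule has_vector_derivative_mult_right)
    from bounded_linear.has_vector_derivative[OF bounded_linear_Re this]
    show ?thesis by (simp add: has_real_derivative_iff_has_vector_derivative)
  qed
  have e: "Re (cnj (profile K n m) * (complex_of_real (lam (m, 0)) * a t (m, 0) + nonlin t (m, 0)))
     = lam (m, 0) * Re (cnj (profile K n m) * a t (m, 0))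
       - K / 2 * Re (complex_of_real (hat n m) * conv (a t) (a t) (m, 0))"
    if "m \<in> profile_modes n" for m
  proof -
    have "m \<noteq> 0" using that by (simp add: profile_modes_def)
    then have "cnj (profile K n m) * nonlin t (m, 0) = complex_of_real (- (K / 2) * hat n m) * conv (a t) (a t) (m, 0)"
      by (simp add: profile_def nonlin_def field_simps)
    then have "Re (cnj (profile K n m) * nonlin t (m, 0)) = - (K / 2) * hat n m * Re (conv (a t) (a t) (m, 0))"
      by simp
    then show ?thesis by (simp add: algebra_simps)
  qed
  have "(drift K n has_real_derivative
     (\<Sum>m\<in>profile_modes n. lam (m, 0) * Re (cnj (profile K n m) * a t (m, 0))
       - K / 2 * Re (complex_of_real (hat n m) * conv (a t) (a t) (m, 0)))) (at t within {0..T})"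
    unfolding drift_def[abs_def]
    by (rule DERIV_cong[OF DERIV_sum[OF d]]) (rule sum.cong[OF refl e])
  moreover have "(\<Sum>m\<in>profile_modes n. Re (complex_of_real (hat n m) * conv (a t) (a t) (m, 0)))
     = Re (\<Sum>m\<in>{- int n..int n}. complex_of_real (hat n m) * conv (a t) (a t) (m, 0)) - sqsum (a t)"
  proof -
    have z: "conv (a t) (a t) (0, 0) = complex_of_real (sqsum (a t))"
      using conv_at_0[OF sq_summable_a(1)[OF t0] a_cnj[OF t0]] by (simp add: zero_prod_def)
    have "(\<Sum>m\<in>{- int n..int n}. Re (complex_of_real (hat n m) * conv (a t) (a t) (m, 0)))
      = Re (complex_of_real (hat n 0) * conv (a t) (a t) (0, 0))
        + (\<Sum>m\<in>profile_modes n. Re (complex_of_real (hat n m) * conv (a t) (a t) (m, 0)))"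
      unfolding profile_modes_def by (rule sum.remove) auto
    then show ?thesis unfolding z by (simp add: Re_sum)
  qed
  ultimately show ?thesis by (simp only: sum_subtractf sum_distrib_left[symmetric])
qed

lemma nonlin_orthogonal:
  assumes "t \<ge> 0"
  shows "(\<Sum>\<^sub>\<infinity>\<xi>. cnj (a t \<xi>) * nonlin t \<xi>) = 0"
proof -
  have "(\<Sum>\<^sub>\<infinity>\<xi>. cnj (a t \<xi>) * nonlin t \<xi>) =
    (\<Sum>\<^sub>\<infinity>\<xi>. (- \<i> / 2) * (cnj (a t \<xi>) * (of_int (fst \<xi>) * conv (a t) (a t) \<xi>)))"
    by (intro infsum_cong) (simp add: nonlin_def)
  also have "\<dots> = (- \<i> / 2) * (\<Sum>\<^sub>\<infinity>\<xi>. cnj (a t \<xi>) * (of_int (fst \<xi>) * conv (a t) (a t) \<xi>))"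
    by (rule infsum_cmult_right')
  also have "\<dots> = 0"
    using triple_product_cancels[OF sq_summable_a(1)[OF assms] sq_summable_fst_a(1)[OF assms]
      summable_on_abs_of_bracket[OF h2[OF assms]] a_cnj[OF assms]] by simp
  finally show ?thesis .
qed

text \<open>Restriction to F destroys the exact cancellation of the nonlinearity, but the complete
  sum vanishes, so the part over F is minus the tail. The dissipation missing outside F is a tail as
  well, and both are bounded through the majorant m.\<close>

lemma energy_derivative_le:
  assumes t: "t \<ge> 0" and F: "finite F"
    and m: "\<And>\<xi>. cmod (a t \<xi>) \<le> m \<xi>" and sm: "(\<lambda>\<xi>. (bracket \<xi> * m \<xi>)\<^sup>2) summable_on UNIV"
    and sm1: "m summable_on UNIV" and H: "sqsum (\<lambda>\<xi>. complex_of_real (bracket \<xi>) * a t \<xi>) \<le> H"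
  shows "(\<Sum>\<xi>\<in>F. Re (cnj (a t \<xi>) * (complex_of_real (lam \<xi>) * a t \<xi> + nonlin t \<xi>)))
    \<le> c0 * sqsum (a t) - \<kappa> * sqsum (\<lambda>\<xi>. complex_of_real (bracket \<xi>) * a t \<xi>)
      + (\<Sum>\<^sub>\<infinity>\<xi>\<in>-F. H * m \<xi> + \<kappa> * (bracket \<xi> * m \<xi>)\<^sup>2)"
proof -
  have split: "infsum f UNIV = sum f F + infsum f (- F)" if "f summable_on UNIV" for f :: "int \<times> int \<Rightarrow> 'x::banach"
  proof -
    have "infsum f (F \<union> - F) = infsum f F + infsum f (- F)"
      by (rule infsum_Un_disjoint) (use that F in \<open>auto intro: summable_on_subset_banach\<close>)
    then show ?thesis using F by (simp add: Compl_partition)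
  qed
  have m0: "m \<xi> \<ge> 0" for \<xi> using m[of \<xi>] norm_ge_zero order_trans by blast
  have H0: "H \<ge> 0" using H sqsum_nonneg order_trans by blast
  have nl: "cmod (cnj (a t \<xi>) * nonlin t \<xi>) \<le> H * m \<xi>" for \<xi>
  proof -
    have "cmod (cnj (a t \<xi>) * nonlin t \<xi>) \<le> m \<xi> * H"
      unfolding norm_mult complex_mod_cnj using norm_nonlin_le[OF t, of \<xi>] H m m0 by (intro mult_mono) auto
    then show ?thesis by (simp add: mult.commute)
  qed
  have sHm: "(\<lambda>\<xi>. H * m \<xi>) summable_on S" for S
    by (intro summable_on_cmult_right summable_on_subset_banach[OF sm1]) auto
  have sbm: "(\<lambda>\<xi>. (bracket \<xi> * m \<xi>)\<^sup>2) summable_on S" for S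
    by (intro summable_on_subset_banach[OF sm]) auto
  have snl: "(\<lambda>\<xi>. norm (cnj (a t \<xi>) * nonlin t \<xi>)) summable_on S" for S
    by (rule summable_on_comparison_test[OF sHm]) (use nl in auto)
  have 1: "Re (\<Sum>\<xi>\<in>F. cnj (a t \<xi>) * nonlin t \<xi>) \<le> (\<Sum>\<^sub>\<infinity>\<xi>\<in>-F. H * m \<xi>)"
  proof -
    have "(\<Sum>\<xi>\<in>F. cnj (a t \<xi>) * nonlin t \<xi>) = - (\<Sum>\<^sub>\<infinity>\<xi>\<in>-F. cnj (a t \<xi>) * nonlin t \<xi>)"
      using split[OF abs_summable_summable[OF snl]] nonlin_orthogonal[OF t] by (simp add: eq_neg_iff_add_eq_0)
    then have "Re (\<Sum>\<xi>\<in>F. cnj (a t \<xi>) * nonlin t \<xi>) \<le> cmod (\<Sum>\<^sub>\<infinity>\<xi>\<in>-F. cnj (a t \<xi>) * nonlin t \<xi>)"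
      using complex_Re_le_cmod[of "\<Sum>\<xi>\<in>F. cnj (a t \<xi>) * nonlin t \<xi>"] by simp
    also have "\<dots> \<le> (\<Sum>\<^sub>\<infinity>\<xi>\<in>-F. H * m \<xi>)"
      by (rule norm_infsum_le[OF has_sum_infsum[OF abs_summable_summable[OF snl]] has_sum_infsum[OF sHm]]) (rule nl)
    finally show ?thesis .
  qed
  have ba: "(bracket \<xi>)\<^sup>2 * (cmod (a t \<xi>))\<^sup>2 = (cmod (complex_of_real (bracket \<xi>) * a t \<xi>))\<^sup>2" for \<xi>
    by (simp add: norm_mult power_mult_distrib)
  have 2: "(\<Sum>\<xi>\<in>F. lam \<xi> * (cmod (a t \<xi>))\<^sup>2) \<le> c0 * sqsum (a t)
      - \<kappa> * sqsum (\<lambda>\<xi>. complex_of_real (bracket \<xi>) * a t \<xi>) + \<kappa> * (\<Sum>\<^sub>\<infinity>\<xi>\<in>-F. (bracket \<xi> * m \<xi>)\<^sup>2)"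
  proof -
    have "(\<Sum>\<xi>\<in>F. lam \<xi> * (cmod (a t \<xi>))\<^sup>2) \<le> (\<Sum>\<xi>\<in>F. c0 * (cmod (a t \<xi>))\<^sup>2 - \<kappa> * ((bracket \<xi>)\<^sup>2 * (cmod (a t \<xi>))\<^sup>2))"
    proof (rule sum_mono)
      fix \<xi>
      show "lam \<xi> * (cmod (a t \<xi>))\<^sup>2 \<le> c0 * (cmod (a t \<xi>))\<^sup>2 - \<kappa> * ((bracket \<xi>)\<^sup>2 * (cmod (a t \<xi>))\<^sup>2)"
        using mult_right_mono[OF lam_le[of \<xi>], of "(cmod (a t \<xi>))\<^sup>2"] by (simp add: algebra_simps)
    qed
    also have "\<dots> = c0 * (\<Sum>\<xi>\<in>F. (cmod (a t \<xi>))\<^sup>2) - \<kappa> * (\<Sum>\<xi>\<in>F. (cmod (complex_of_real (bracket \<xi>) * a t \<xi>))\<^sup>2)"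
      unfolding ba by (simp add: sum_subtractf sum_distrib_left)
    also have "(\<Sum>\<xi>\<in>F. (cmod (complex_of_real (bracket \<xi>) * a t \<xi>))\<^sup>2) = sqsum (\<lambda>\<xi>. complex_of_real (bracket \<xi>) * a t \<xi>)
        - (\<Sum>\<^sub>\<infinity>\<xi>\<in>-F. (cmod (complex_of_real (bracket \<xi>) * a t \<xi>))\<^sup>2)"
      using split[OF h2[OF t, unfolded sq_summable_def]] by (simp add: sqsum_def)
    also have "c0 * (\<Sum>\<xi>\<in>F. (cmod (a t \<xi>))\<^sup>2) \<le> c0 * sqsum (a t)"
      unfolding sqsum_def using sq_summable_a(1)[OF t, unfolded sq_summable_def] F c0
      by (intro mult_left_mono finite_sum_le_infsum) auto
    finally have "(\<Sum>\<xi>\<in>F. lam \<xi> * (cmod (a t \<xi>))\<^sup>2) \<le> c0 * sqsum (a t)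
      - \<kappa> * (sqsum (\<lambda>\<xi>. complex_of_real (bracket \<xi>) * a t \<xi>)
        - (\<Sum>\<^sub>\<infinity>\<xi>\<in>-F. (cmod (complex_of_real (bracket \<xi>) * a t \<xi>))\<^sup>2))" by simp
    moreover have "(\<Sum>\<^sub>\<infinity>\<xi>\<in>-F. (cmod (complex_of_real (bracket \<xi>) * a t \<xi>))\<^sup>2) \<le> (\<Sum>\<^sub>\<infinity>\<xi>\<in>-F. (bracket \<xi> * m \<xi>)\<^sup>2)"
    proof (rule infsum_mono[OF _ sbm])
      show "(\<lambda>\<xi>. (cmod (complex_of_real (bracket \<xi>) * a t \<xi>))\<^sup>2) summable_on - F"
        using h2[OF t, unfolded sq_summable_def] by (rule summable_on_subset_banach) simp
      show "(cmod (complex_of_real (bracket \<xi>) * a t \<xi>))\<^sup>2 \<le> (bracket \<xi> * m \<xi>)\<^sup>2" for \<xi>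
        by (intro power_mono) (auto simp: norm_mult m intro!: mult_left_mono)
    qed
    from mult_left_mono[OF this, of \<kappa>] have "\<kappa> * (\<Sum>\<^sub>\<infinity>\<xi>\<in>-F. (cmod (complex_of_real (bracket \<xi>) * a t \<xi>))\<^sup>2)
        \<le> \<kappa> * (\<Sum>\<^sub>\<infinity>\<xi>\<in>-F. (bracket \<xi> * m \<xi>)\<^sup>2)" using kappa by simp
    ultimately show ?thesis by (simp add: right_diff_distrib)
  qed
  have "(\<Sum>\<xi>\<in>F. Re (cnj (a t \<xi>) * (complex_of_real (lam \<xi>) * a t \<xi> + nonlin t \<xi>)))
     = (\<Sum>\<xi>\<in>F. lam \<xi> * (cmod (a t \<xi>))\<^sup>2) + Re (\<Sum>\<xi>\<in>F. cnj (a t \<xi>) * nonlin t \<xi>)"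
    unfolding Re_sum sum.distrib[symmetric]
    unfolding cmod_power2 by (intro sum.cong refl) (simp add: power2_eq_square algebra_simps)
  moreover have "(\<Sum>\<^sub>\<infinity>\<xi>\<in>-F. H * m \<xi> + \<kappa> * (bracket \<xi> * m \<xi>)\<^sup>2)
     = (\<Sum>\<^sub>\<infinity>\<xi>\<in>-F. H * m \<xi>) + \<kappa> * (\<Sum>\<^sub>\<infinity>\<xi>\<in>-F. (bracket \<xi> * m \<xi>)\<^sup>2)"
    using sHm sbm by (simp add: infsum_add summable_on_cmult_right infsum_cmult_right')
  ultimately show ?thesis using 1 2 by linarith
qed

text \<open>
  The term $-\frac12\langle\phi',\eta^2\rangle$ in the derivative of
  $\frac12\|\eta\|^2-\langle\phi,\eta\rangle$ supplies the damping $-\frac K2\|\eta\|^2$; its remainder is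
  concentrated near $x=0$, where an odd function is small. Only finitely many modes are kept in
  $\|\eta\|^2$, so that it can be differentiated termwise.
\<close>

lemma sqsum_bounded:
  assumes odd0: "\<And>\<xi>. a 0 (reflect \<xi>) = - a 0 \<xi>" and t: "t \<ge> 0"
    and n: "n > 0" and K: "K = 2 * c0 + 4" and Kn: "K / 2 * (int_const / real n) \<le> \<kappa>"
    and y0: "sqsum (a 0) \<le> y0"
  defines "\<Phi> \<equiv> profile_norm K n" and "L \<equiv> profile_symbol_norm lam K n"
  shows "sqsum (a t) \<le> 4 * (max (y0 + \<Phi>\<^sup>2 / 2) (1 + L\<^sup>2 / 4 + \<Phi>\<^sup>2 / 2) + 1 / 2 + \<Phi>\<^sup>2)"
proof -
  obtain H where H: "\<And>s. s \<in> {0..t} \<Longrightarrow> sqsum (\<lambda>\<xi>. complex_of_real (bracket \<xi>) * a s \<xi>) \<le> H"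
    using h2_bdd[of t] by blast
  obtain m where m: "\<And>s \<xi>. s \<in> {0..t} \<Longrightarrow> cmod (a s \<xi>) \<le> m \<xi>" "\<And>\<xi>. m \<xi> \<ge> 0"
    "(\<lambda>\<xi>. (bracket \<xi> * m \<xi>)\<^sup>2) summable_on UNIV" using dominating_weights[of t] by blast
  have H0: "H \<ge> 0" using H[of 0] t sqsum_nonneg order_trans by (metis atLeastAtMost_iff order_refl)
  have sm1: "m summable_on UNIV"
    using summable_on_abs_of_bracket[of "\<lambda>\<xi>. complex_of_real (m \<xi>)"] m(2,3)
    by (simp add: sq_summable_def norm_mult abs_mult)
  \<comment> \<open>One tail for all errors of the truncation: H m for the nonlinearity, \<kappa>
    for the lost dissipation, and the additional 1 for the lost part of the L2 norm. It does not
    depend on time, hence neither does F.\<close>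
  define w where "w \<xi> = H * m \<xi> + (\<kappa> + 1) * (bracket \<xi> * m \<xi>)\<^sup>2" for \<xi>
  have w0: "w \<xi> \<ge> 0" for \<xi> using H0 m(2) kappa by (simp add: w_def)
  have sw: "w summable_on UNIV"
    unfolding w_def[abs_def] by (intro summable_on_add summable_on_cmult_right sm1 m(3))
  obtain F where F: "finite F" "infsum w (- F) \<le> 1"
  proof -
    obtain F where F: "finite F" "dist (sum w F) (infsum w UNIV) \<le> 1"
      using infsum_finite_approximation[OF sw, of 1] by auto
    have "infsum w (F \<union> - F) = infsum w F + infsum w (- F)"
      by (rule infsum_Un_disjoint) (use sw F in \<open>auto intro: summable_on_subset_banach\<close>)
    then have "infsum w UNIV = sum w F + infsum w (- F)" using F by (simp add: Compl_partition)
    then have "infsum w (- F) \<le> 1" using F(2) by (simp add: dist_real_def)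
    with F(1) show thesis by (rule that)
  qed
  have tail_le: "infsum f (- F) \<le> 1" if "\<And>\<xi>. 0 \<le> f \<xi>" "\<And>\<xi>. f \<xi> \<le> w \<xi>" for f
  proof -
    have sw': "w summable_on - F" by (rule summable_on_subset_banach[OF sw]) simp
    have "f summable_on - F" by (rule summable_on_comparison_test[OF sw']) (use that in auto)
    then have "infsum f (- F) \<le> infsum w (- F)" by (rule infsum_mono[OF _ sw']) (use that in auto)
    then show ?thesis using F by simp
  qed
  have K0: "K > 0" using K c0 by simp
  have \<Phi>0: "\<Phi> \<ge> 0" unfolding \<Phi>_def profile_norm_def by (rule sum_nonneg) auto
  define y where "y s = sqsum (a s)" for s
  define Y where "Y s = sqsum (\<lambda>\<xi>. complex_of_real (bracket \<xi>) * a s \<xi>)" for s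
  define Q where "Q s = (\<Sum>m\<in>{- int n..int n}. complex_of_real (hat n m) * conv (a s) (a s) (m, 0))" for s
  define V where "V s = 1 / 2 * (\<Sum>\<xi>\<in>F. (cmod (a s \<xi>))\<^sup>2) - drift K n s" for s
  define V' where "V' s = (\<Sum>\<xi>\<in>F. Re (cnj (a s \<xi>) * (complex_of_real (lam \<xi>) * a s \<xi> + nonlin s \<xi>)))
     - ((\<Sum>m\<in>profile_modes n. lam (m, 0) * Re (cnj (profile K n m) * a s (m, 0))) - K / 2 * (Re (Q s) - y s))" for s
  have y0': "y s \<ge> 0" for s by (simp add: y_def sqsum_nonneg)
  have Y0: "Y s \<ge> 0" for s by (simp add: Y_def sqsum_nonneg)
  have sum_le_y: "(\<Sum>\<xi>\<in>F. (cmod (a s \<xi>))\<^sup>2) \<le> y s" if "s \<ge> 0" for s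
    unfolding y_def sqsum_def using sq_summable_a(1)[OF that, unfolded sq_summable_def] F
    by (intro finite_sum_le_infsum) auto
  have drift_le: "\<bar>drift K n s\<bar> \<le> \<Phi> * sqrt (y s)" if "s \<ge> 0" for s
    using abs_drift_le[OF that] by (simp add: \<Phi>_def y_def)
  have V_le: "V s \<le> y s + \<Phi>\<^sup>2 / 2" if "s \<ge> 0" for s
  proof -
    have "\<Phi> * sqrt (y s) \<le> \<Phi>\<^sup>2 / 2 + y s / 2"
      using sum_squares_bound[of \<Phi> "sqrt (y s)"] y0'[of s] by simp
    then show ?thesis using sum_le_y[OF that] drift_le[OF that] unfolding V_def by linarith
  qed
  have "V t \<le> max (V 0) (1 + L\<^sup>2 / 4 + \<Phi>\<^sup>2 / 2)"
  proof (rule gronwall_max[where T = t and f' = V'])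
    fix s assume s: "s \<in> {0..t}"
    have s0: "s \<ge> 0" using s by simp
    have "((\<lambda>s. 1 / 2 * (\<Sum>\<xi>\<in>F. (cmod (a s \<xi>))\<^sup>2)) has_real_derivative
      1 / 2 * (\<Sum>\<xi>\<in>F. 2 * Re (cnj (a s \<xi>) * (complex_of_real (lam \<xi>) * a s \<xi> + nonlin s \<xi>)))) (at s within {0..t})"
      by (intro DERIV_cmult DERIV_sum has_real_derivative_cmod_sq deriv_within s)
    also have "1 / 2 * (\<Sum>\<xi>\<in>F. 2 * Re (cnj (a s \<xi>) * (complex_of_real (lam \<xi>) * a s \<xi> + nonlin s \<xi>)))
      = (\<Sum>\<xi>\<in>F. Re (cnj (a s \<xi>) * (complex_of_real (lam \<xi>) * a s \<xi> + nonlin s \<xi>)))"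
      unfolding sum_distrib_left by (rule sum.cong[OF refl]) linarith
    finally show "(V has_real_derivative V' s) (at s within {0..t})"
      unfolding V_def[abs_def] V'_def Q_def y_def using drift_deriv[OF s n, of K] by (intro DERIV_diff)
    have odd: "a s (reflect \<xi>) = - a s \<xi>" for \<xi> by (rule odd_preserved[OF odd0 s0])
    have E: "(\<Sum>\<xi>\<in>F. Re (cnj (a s \<xi>) * (complex_of_real (lam \<xi>) * a s \<xi> + nonlin s \<xi>))) \<le> c0 * y s - \<kappa> * Y s + 1"
    proof -
      have "(\<Sum>\<^sub>\<infinity>\<xi>\<in>-F. H * m \<xi> + \<kappa> * (bracket \<xi> * m \<xi>)\<^sup>2) \<le> 1"
        by (rule tail_le) (use H0 m(2) kappa in \<open>auto simp: w_def distrib_right\<close>)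
      then show ?thesis
        using energy_derivative_le[OF s0 F(1) m(1)[OF s] m(3) sm1 H[OF s]] unfolding y_def Y_def by linarith
    qed
    \<comment> \<open>The Fejer form is of size 1/n in terms of the squared H^2 norm; n was taken
      large enough for the dissipation in E to pay for it.\<close>
    have Qle: "K / 2 * Re (Q s) \<le> \<kappa> * Y s"
    proof -
      have "Re (Q s) \<le> int_const / real n * Y s"
        using hat_form_small[OF h2[OF s0] odd n] complex_Re_le_cmod[of "Q s"] unfolding Q_def Y_def by linarith
      then have "K / 2 * Re (Q s) \<le> K / 2 * (int_const / real n * Y s)" using K0 by (intro mult_left_mono) auto
      also have "\<dots> = (K / 2 * (int_const / real n)) * Y s" by simp
      also have "\<dots> \<le> \<kappa> * Y s" using Kn Y0 by (intro mult_right_mono) auto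
      finally show ?thesis .
    qed
    have Lle: "\<bar>\<Sum>m\<in>profile_modes n. lam (m, 0) * Re (cnj (profile K n m) * a s (m, 0))\<bar> \<le> L * sqrt (y s)"
    proof -
      have "\<bar>\<Sum>m\<in>profile_modes n. lam (m, 0) * Re (cnj (profile K n m) * a s (m, 0))\<bar>
         \<le> (\<Sum>m\<in>profile_modes n. \<bar>lam (m, 0) * Re (cnj (profile K n m) * a s (m, 0))\<bar>)" by (rule sum_abs)
      also have "\<dots> \<le> (\<Sum>m\<in>profile_modes n. cmod (profile K n m) * \<bar>lam (m, 0)\<bar> * sqrt (y s))"
      proof (rule sum_mono)
        fix m
        have "\<bar>Re (cnj (profile K n m) * a s (m, 0))\<bar> \<le> cmod (profile K n m) * cmod (a s (m, 0))"
          using abs_Re_le_cmod[of "cnj (profile K n m) * a s (m, 0)"] by (simp add: norm_mult)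
        also have "\<dots> \<le> cmod (profile K n m) * sqrt (y s)"
          unfolding y_def using norm_le_sqrt_sqsum[OF sq_summable_a(1)[OF s0]] by (intro mult_left_mono) auto
        finally have "\<bar>lam (m, 0)\<bar> * \<bar>Re (cnj (profile K n m) * a s (m, 0))\<bar> \<le> \<bar>lam (m, 0)\<bar> * (cmod (profile K n m) * sqrt (y s))"
          by (intro mult_left_mono) auto
        then show "\<bar>lam (m, 0) * Re (cnj (profile K n m) * a s (m, 0))\<bar> \<le> cmod (profile K n m) * \<bar>lam (m, 0)\<bar> * sqrt (y s)"
          by (simp only: abs_mult mult_ac)
      qed
      also have "\<dots> = L * sqrt (y s)" by (simp add: L_def profile_symbol_norm_def sum_distrib_right)
      finally show ?thesis .
    qed
    have "L * sqrt (y s) \<le> y s + L\<^sup>2 / 4"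
      using sum_squares_bound[of "L / 2" "sqrt (y s)"] y0'[of s] by (simp add: power_divide)
    \<comment> \<open>Origin of K = 2 c0 + 4: c0 y compensates the linear growth, and of the
      remaining 2 y one part pays for \<open>L * sqrt (y s)\<close> and the other is the decay
      required by \<open>gronwall_max\<close>.\<close>
    moreover have "K / 2 * y s = c0 * y s + 2 * y s" by (simp add: K algebra_simps)
    moreover have "K / 2 * (Re (Q s) - y s) = K / 2 * Re (Q s) - K / 2 * y s" by (rule right_diff_distrib)
    ultimately have "V' s \<le> - y s + 1 + L\<^sup>2 / 4"
      using E Qle Lle unfolding V'_def by linarith
    then show "V' s \<le> - V s + (1 + L\<^sup>2 / 4 + \<Phi>\<^sup>2 / 2)" using V_le[OF s0] by linarith
  qed (use t in simp)
  moreover have "V 0 \<le> y0 + \<Phi>\<^sup>2 / 2" using V_le[of 0] y0 by (simp add: y_def)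
  ultimately have Vt: "V t \<le> max (y0 + \<Phi>\<^sup>2 / 2) (1 + L\<^sup>2 / 4 + \<Phi>\<^sup>2 / 2)" by linarith
  have "y t \<le> (\<Sum>\<xi>\<in>F. (cmod (a t \<xi>))\<^sup>2) + 1"
  proof -
    have s: "(\<lambda>\<xi>. (cmod (a t \<xi>))\<^sup>2) summable_on UNIV" using sq_summable_a(1)[OF t] by (simp add: sq_summable_def)
    have "infsum (\<lambda>\<xi>. (cmod (a t \<xi>))\<^sup>2) (F \<union> - F) = infsum (\<lambda>\<xi>. (cmod (a t \<xi>))\<^sup>2) F + infsum (\<lambda>\<xi>. (cmod (a t \<xi>))\<^sup>2) (- F)"
      by (rule infsum_Un_disjoint) (use s F in \<open>auto intro: summable_on_subset_banach\<close>)
    then have "y t = (\<Sum>\<xi>\<in>F. (cmod (a t \<xi>))\<^sup>2) + infsum (\<lambda>\<xi>. (cmod (a t \<xi>))\<^sup>2) (- F)"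
      using F by (simp add: Compl_partition y_def sqsum_def)
    moreover have "infsum (\<lambda>\<xi>. (cmod (a t \<xi>))\<^sup>2) (- F) \<le> 1"
    proof (rule tail_le)
      fix \<xi>
      have "cmod (a t \<xi>) \<le> 1 * m \<xi>" using m(1)[of t \<xi>] t by simp
      also have "\<dots> \<le> bracket \<xi> * m \<xi>" using m(2) by (intro mult_right_mono) auto
      finally have "(cmod (a t \<xi>))\<^sup>2 \<le> (bracket \<xi> * m \<xi>)\<^sup>2" by (intro power_mono) auto
      moreover have "H * m \<xi> \<ge> 0" "\<kappa> * (bracket \<xi> * m \<xi>)\<^sup>2 \<ge> 0" using H0 m(2) kappa by auto
      ultimately show "(cmod (a t \<xi>))\<^sup>2 \<le> w \<xi>" unfolding w_def distrib_right by linarith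
    qed auto
    ultimately show ?thesis by linarith
  qed
  \<comment> \<open>The drift counts twice when V is solved for y, so half of y is absorbed into the
    left-hand side. This doubling gives the factor 4 and the summand 1/2.\<close>
  moreover have "\<Phi> * sqrt (y t) \<le> \<Phi>\<^sup>2 + y t / 4"
    using sum_squares_bound[of \<Phi> "sqrt (y t) / 2"] y0'[of t] by (simp add: power_divide)
  ultimately have "y t \<le> 4 * (V t + 1 / 2 + \<Phi>\<^sup>2)"
    using drift_le[OF t] unfolding V_def by (simp add: field_simps)
  also have "\<dots> \<le> 4 * (max (y0 + \<Phi>\<^sup>2 / 2) (1 + L\<^sup>2 / 4 + \<Phi>\<^sup>2 / 2) + 1 / 2 + \<Phi>\<^sup>2)"
    by (intro mult_left_mono add_right_mono Vt) simp
  finally show ?thesis by (simp add: y_def)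
qed

end

text \<open>T and R are fixed before the flow a is quantified, because every constant on the way is
  computed from the data b and the symbol. This order of quantifiers makes the lifespan independent
  of the starting time s and of the solution.\<close>

lemma modal_flow_gevrey:
  fixes lam :: "int \<times> int \<Rightarrow> real" and c0 \<kappa> :: real and b :: "int \<times> int \<Rightarrow> complex"
  assumes c0: "c0 \<ge> 0" and kappa: "\<kappa> > 0"
    and odd0: "\<And>\<xi>. b (reflect \<xi>) = - b \<xi>"
  obtains T R where "T > 0" "R > 0"
    "\<And>a s \<tau> \<xi>. modal_flow a lam c0 \<kappa> \<Longrightarrow> a 0 = b \<Longrightarrow> s \<ge> 0 \<Longrightarrow> \<tau> \<in> {0..T} \<Longrightarrow>
      exp (\<tau> * freq_norm \<xi>) * cmod (a (s + \<tau>) \<xi>) \<le> R / bracket \<xi>"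
proof -
  define K where "K = 2 * c0 + 4"
  obtain n :: nat where n: "n > 0" "K / 2 * (int_const / real n) \<le> \<kappa>"
  proof -
    obtain n :: nat where n: "K / 2 * int_const / \<kappa> < real n" using reals_Archimedean2 by blast
    have "K / 2 * int_const / \<kappa> \<ge> 0" using c0 kappa int_const_nonneg by (simp add: K_def)
    then have "n > 0" using n by (cases n) auto
    moreover have "K / 2 * (int_const / real n) \<le> \<kappa>" using n kappa \<open>n > 0\<close> by (simp add: field_simps)
    ultimately show thesis by (rule that)
  qed
  define \<Phi> L where "\<Phi> = profile_norm K n" and "L = profile_symbol_norm lam K n"
  \<comment> \<open>M0 is the bound of \<open>sqsum_bounded\<close>, M that of
    \<open>bound_of_sqsum_bound\<close>, and P and W are the constants of
    \<open>gevrey_bound\<close> for this M.\<close>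
  define M0 where "M0 = 4 * (max (sqsum b + \<Phi>\<^sup>2 / 2) (1 + L\<^sup>2 / 4 + \<Phi>\<^sup>2 / 2) + 1 / 2 + \<Phi>\<^sup>2)"
  define M where "M = sqrt (sqsum (\<lambda>\<xi>. complex_of_real (bracket \<xi>) * b \<xi>)) + M0 / \<kappa> + 2 * c0 * sqrt M0 / \<kappa>"
  define P where "P = 3 * M * lattice_const / 2"
  define W where "W = 2 * (c0 + (1 + P)\<^sup>2 / (2 * \<kappa>)) / \<kappa> + 1"
  have "max (sqsum b + \<Phi>\<^sup>2 / 2) (1 + L\<^sup>2 / 4 + \<Phi>\<^sup>2 / 2) \<ge> 0" using sqsum_nonneg[of b] by (auto simp: max_def)
  then have "M0 > 0" unfolding M0_def by (intro mult_pos_pos add_pos_nonneg[OF add_nonneg_pos]) auto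
  then have "M0 / \<kappa> > 0" "2 * c0 * sqrt M0 / \<kappa> \<ge> 0" using kappa c0 by auto
  then have M: "M > 0" using sqsum_nonneg[of "\<lambda>\<xi>. complex_of_real (bracket \<xi>) * b \<xi>"]
    unfolding M_def by (smt (verit) real_sqrt_ge_zero)
  show thesis
  proof
    show "1 / (2 * W) > 0" using c0 kappa by (simp add: W_def add_nonneg_pos)
    show "3 * M > 0" using M by simp
    fix a and s \<tau> :: real and \<xi> assume "modal_flow a lam c0 \<kappa>" and ab: "a 0 = b" and s: "s \<ge> 0" and tau: "\<tau> \<in> {0..1 / (2 * W)}"
    then interpret modal_flow a lam c0 \<kappa> by simp
    have bd: "sqsum (a t) \<le> M0" if "t \<ge> 0" for t
      unfolding M0_def \<Phi>_def L_def
      by (rule sqsum_bounded) (use that odd0 n ab in \<open>auto simp: K_def\<close>)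
    have bd': "cmod (a t \<xi>) \<le> M / bracket \<xi>" if "t \<ge> 0" for t \<xi>
      using bound_of_sqsum_bound[OF bd that, of \<xi>] unfolding M_def ab .
    show "exp (\<tau> * freq_norm \<xi>) * cmod (a (s + \<tau>) \<xi>) \<le> 3 * M / bracket \<xi>"
      by (rule gevrey_bound[OF M _ s]) (use bd' tau in \<open>simp_all only: W_def P_def\<close>)
  qed
qed

subsection \<open>Characters of the torus\<close>

definition character :: "int \<times> int \<Rightarrow> real \<times> real \<Rightarrow> complex" where
  "character \<xi> z = cis (of_int (fst \<xi>) * fst z + of_int (snd \<xi>) * snd z)"

text \<open>\<open>fourier\<close> for complex-valued functions, so that it applies to characters
  and to partial sums of series.\<close>

definition ft :: "(real \<times> real \<Rightarrow> complex) \<Rightarrow> int \<times> int \<Rightarrow> complex" where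
  "ft f \<xi> = complex_of_real (1 / (2 * pi)\<^sup>2) * (\<integral>z. character (- \<xi>) z * f z \<partial>torus)"

lemma fourier_eq_ft: "fourier u \<xi> = ft (\<lambda>z. complex_of_real (u z)) \<xi>"
  unfolding fourier_def ft_def character_def cis_conv_exp
  by (simp add: algebra_simps)

lemma norm_character [simp]: "cmod (character \<xi> z) = 1"
  by (simp add: character_def)

lemma character_mult: "character \<xi> z * character \<zeta> z = character (\<xi> + \<zeta>) z"
  by (simp add: character_def cis_mult algebra_simps)

lemma character_zero [simp]: "character 0 z = 1"
  by (simp add: character_def)

lemma cnj_character: "cnj (character \<xi> z) = character (- \<xi>) z"
  by (simp add: character_def cis_cnj)

lemma continuous_on_character [continuous_intros]: "continuous_on S (character \<xi>)"
  unfolding character_def[abs_def] by (intro continuous_intros)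

lemma square_eq_cbox: "{0..2 * pi} \<times> {0..2 * pi} = cbox (0, 0) (2 * pi, 2 * pi)"
  by (simp add: cbox_Pair_eq)

lemma square_lebesgue [measurable, simp]: "{0..2 * pi} \<times> {0..2 * pi} \<in> sets lebesgue"
  unfolding square_eq_cbox by simp

lemma space_torus [simp]: "space torus = {0..2 * pi} \<times> {0..2 * pi}"
  by (simp add: torus_def space_restrict_space)

interpretation torus: finite_measure torus
proof
  have "emeasure torus (space torus) = emeasure lborel (cbox (0::real, 0::real) (2 * pi, 2 * pi))"
    unfolding torus_def square_eq_cbox by (simp add: emeasure_restrict_space space_restrict_space)
  then show "emeasure torus (space torus) \<noteq> \<infinity>" using emeasure_lborel_cbox_finite[of "(0::real, 0::real)" "(2 * pi, 2 * pi)"] by simp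
qed

lemma borel_measurable_torus:
  fixes f :: "real \<times> real \<Rightarrow> 'b::{second_countable_topology, metric_space}"
  assumes "f \<in> borel_measurable borel"
  shows "f \<in> borel_measurable torus"
  unfolding torus_def by (intro measurable_restrict_space1 measurable_completion) (use assms in simp)

lemma continuous_borel_measurable_torus:
  fixes f :: "real \<times> real \<Rightarrow> 'b::{second_countable_topology, metric_space}"
  assumes "continuous_on UNIV f"
  shows "f \<in> borel_measurable torus"
  using assms by (intro borel_measurable_torus borel_measurable_continuous_onI)

lemma character_measurable [measurable]: "character \<xi> \<in> borel_measurable torus"
  by (intro continuous_borel_measurable_torus continuous_intros)

lemma integrable_character_mult:
  assumes "integrable torus f"
  shows "integrable torus (\<lambda>z. character \<xi> z * f z)"
  by (rule Bochner_Integration.integrable_bound[OF assms])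
    (use assms in \<open>auto simp: norm_mult\<close>)

lemma integrable_character: "integrable torus (character \<xi>)"
  by (rule torus.integrable_const_bound[where B = 1]) auto

lemma integral_cis_2pi:
  "integral {0..2 * pi} (\<lambda>x. cis (of_int n * x)) = (if n = 0 then complex_of_real (2 * pi) else 0)"
proof (cases "n = 0")
  case False
  have "((\<lambda>x. cis (of_int n * x)) has_integral
     (cis (of_int n * (2 * pi)) / (\<i> * of_int n) - cis (of_int n * 0) / (\<i> * of_int n))) {0..2 * pi}"
  proof (rule fundamental_theorem_of_calculus)
    fix x assume "x \<in> {0..2 * pi}"
    have "((\<lambda>x. cis (of_int n * x)) has_vector_derivative of_int n *\<^sub>R (\<i> * cis (of_int n * x))) (at x within {0..2 * pi})"
    proof -
      have "((\<lambda>x. cos (of_int n * x)) has_real_derivative - of_int n * sin (of_int n * x)) (at x within {0..2 * pi})"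
        "((\<lambda>x. sin (of_int n * x)) has_real_derivative of_int n * cos (of_int n * x)) (at x within {0..2 * pi})"
        by (auto intro!: derivative_eq_intros)
      then have "((\<lambda>x. complex_of_real (cos (of_int n * x)) + \<i> * complex_of_real (sin (of_int n * x))) has_vector_derivative
         complex_of_real (- of_int n * sin (of_int n * x)) + \<i> * complex_of_real (of_int n * cos (of_int n * x))) (at x within {0..2 * pi})"
        by (intro has_vector_derivative_add has_vector_derivative_mult_right has_vector_derivative_of_real)
          (simp_all add: has_real_derivative_iff_has_vector_derivative)
      moreover have "complex_of_real (cos y) + \<i> * complex_of_real (sin y) = cis y" for y
        by (simp add: complex_eq_iff)
      moreover have "complex_of_real (- of_int n * sin (of_int n * x)) + \<i> * complex_of_real (of_int n * cos (of_int n * x))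
        = of_int n *\<^sub>R (\<i> * cis (of_int n * x))" by (simp add: complex_eq_iff)
      ultimately show ?thesis by simp
    qed
    from has_vector_derivative_divide[OF this, of "\<i> * of_int n"]
    show "((\<lambda>x. cis (of_int n * x) / (\<i> * of_int n)) has_vector_derivative cis (of_int n * x)) (at x within {0..2 * pi})"
      using False by (simp add: scaleR_conv_of_real)
  qed simp
  moreover have "cis (of_int n * (2 * pi)) = 1"
    using cis_multiple_2pi[of "of_int n"] by (simp add: mult_ac)
  ultimately show ?thesis using False by (simp add: integral_unique)
qed (simp add: scaleR_conv_of_real)

lemma integral_character:
  "(\<integral>z. character \<xi> z \<partial>torus) = (if \<xi> = 0 then complex_of_real ((2 * pi)\<^sup>2) else 0)"
proof -
  have "(\<integral>z. character \<xi> z \<partial>torus) = integral (cbox (0, 0) (2 * pi, 2 * pi)) (character \<xi>)"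
    using lebesgue_integral_eq_integral[OF integrable_character[of \<xi>, unfolded torus_def]]
    by (simp add: torus_def square_eq_cbox)
  also have "\<dots> = integral (cbox 0 (2 * pi)) (\<lambda>x. integral (cbox 0 (2 * pi)) (\<lambda>y. character \<xi> (x, y)))"
    by (rule integral_prod_continuous) (intro continuous_intros)
  also have "\<dots> = integral {0..2 * pi} (\<lambda>x. cis (of_int (fst \<xi>) * x) * integral {0..2 * pi} (\<lambda>y. cis (of_int (snd \<xi>) * y)))"
    by (simp add: character_def cis_mult[symmetric])
  also have "\<dots> = integral {0..2 * pi} (\<lambda>x. cis (of_int (fst \<xi>) * x)) * integral {0..2 * pi} (\<lambda>y. cis (of_int (snd \<xi>) * y))"
    by simp
  also have "\<dots> = (if \<xi> = 0 then complex_of_real ((2 * pi)\<^sup>2) else 0)"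
    unfolding integral_cis_2pi by (cases \<xi>) (auto simp: zero_prod_def power2_eq_square)
  finally show ?thesis .
qed

lemma ft_character: "ft (character \<zeta>) \<xi> = (if \<xi> = \<zeta> then 1 else 0)"
proof -
  have "(2 * pi)\<^sup>2 \<noteq> 0" by simp
  moreover have "- \<xi> + \<zeta> = 0 \<longleftrightarrow> \<xi> = \<zeta>" by (metis add.inverse_inverse add_eq_0_iff2 minus_add_cancel)
  ultimately show ?thesis unfolding ft_def character_mult integral_character
    by (simp add: power2_eq_square)
qed

lemma ft_add:
  assumes "integrable torus f" "integrable torus g"
  shows "ft (\<lambda>z. f z + g z) \<xi> = ft f \<xi> + ft g \<xi>"
  unfolding ft_def using integrable_character_mult[OF assms(1)] integrable_character_mult[OF assms(2)]
  by (simp add: distrib_left)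

lemma ft_cmult: "ft (\<lambda>z. c * f z) \<xi> = c * ft f \<xi>"
proof -
  have "(\<integral>z. character (- \<xi>) z * (c * f z) \<partial>torus) = (\<integral>z. c * (character (- \<xi>) z * f z) \<partial>torus)"
    by (simp add: mult_ac)
  then show ?thesis unfolding ft_def by simp
qed

lemma ft_cong_AE:
  assumes "AE z in torus. f z = g z" "f \<in> borel_measurable torus" "g \<in> borel_measurable torus"
  shows "ft f \<xi> = ft g \<xi>"
  unfolding ft_def by (intro arg_cong2[where f = "(*)"] refl integral_cong_AE) (use assms in auto)

lemma norm_ft_le:
  assumes "integrable torus f"
  shows "cmod (ft f \<xi>) \<le> 1 / (2 * pi)\<^sup>2 * (\<integral>z. cmod (f z) \<partial>torus)"
proof -
  have "cmod (\<integral>z. character (- \<xi>) z * f z \<partial>torus) \<le> (\<integral>z. cmod (character (- \<xi>) z * f z) \<partial>torus)"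
    by (rule integral_norm_bound)
  also have "\<dots> = (\<integral>z. cmod (f z) \<partial>torus)" by (simp add: norm_mult)
  finally have "\<bar>1 / (2 * pi)\<^sup>2\<bar> * cmod (\<integral>z. character (- \<xi>) z * f z \<partial>torus) \<le> 1 / (2 * pi)\<^sup>2 * (\<integral>z. cmod (f z) \<partial>torus)"
    by (intro mult_mono) auto
  then show ?thesis by (simp only: ft_def norm_mult norm_of_real)
qed

lemma ft_cnj: "ft (\<lambda>z. cnj (f z)) \<xi> = cnj (ft f (- \<xi>))"
proof -
  have "cnj (\<integral>z. character \<xi> z * f z \<partial>torus) = (\<integral>z. cnj (character \<xi> z * f z) \<partial>torus)"
    by (rule Bochner_Integration.integral_cnj[symmetric])
  then show ?thesis by (simp add: ft_def cnj_character)
qed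

lemma fourier_uminus: "fourier u (- \<xi>) = cnj (fourier u \<xi>)"
  using ft_cnj[of "\<lambda>z. complex_of_real (u z)" "- \<xi>"] by (simp add: fourier_eq_ft)

subsection \<open>Uniqueness of Fourier coefficients\<close>

text \<open>The Borel sets on which the integral vanishes form a Dynkin class, and boxes are an
  intersection-stable generator. The total integral takes care of complements; closed and open boxes
  differ by a null set.\<close>

lemma AE_zero_of_cbox_integrals:
  fixes f :: "'a::euclidean_space \<Rightarrow> real"
  assumes f: "integrable lebesgue f" and total: "(\<integral>x. f x \<partial>lebesgue) = 0"
    and boxes: "\<And>a b. (\<integral>x. indicator (cbox a b) x *\<^sub>R f x \<partial>lebesgue) = 0"
  shows "AE x in lebesgue. f x = 0"
proof -
  \<comment> \<open>A Borel representative, since boxes generate the Borel sets and not all Lebesgue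
    sets.\<close>
  obtain g where g [measurable]: "g \<in> borel_measurable lborel" and fg: "AE x in lborel. f x = g x"
    using completion_ex_borel_measurable_real[of f lborel] f by auto
  have fg': "AE x in lebesgue. f x = g x" using fg by (rule AE_completion)
  have "integrable lebesgue g"
    using integrable_cong_AE_imp[OF f _ fg'] g by (simp add: measurable_completion)
  then have ig: "integrable lborel g" using g by (simp add: integrable_completion)
  have mf: "f \<in> borel_measurable lebesgue" using f by simp
  have eq: "(\<integral>x. indicator A x *\<^sub>R g x \<partial>lborel) = (\<integral>x. indicator A x *\<^sub>R f x \<partial>lebesgue)" if "A \<in> sets borel" for A
  proof -
    have "(\<integral>x. indicator A x *\<^sub>R g x \<partial>lborel) = (\<integral>x. indicator A x *\<^sub>R g x \<partial>lebesgue)"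
      by (rule integral_completion[symmetric]) (use that g in measurable)
    also have "\<dots> = (\<integral>x. indicator A x *\<^sub>R f x \<partial>lebesgue)"
    proof (rule integral_cong_AE)
      have "(\<lambda>x. indicator A x *\<^sub>R g x) \<in> borel_measurable lborel" using that g by measurable
      then show "(\<lambda>x. indicator A x *\<^sub>R g x) \<in> borel_measurable lebesgue" by (rule measurable_completion)
      have "A \<in> sets lebesgue" using that by (simp add: sets_completionI_sets)
      then show "(\<lambda>x. indicator A x *\<^sub>R f x) \<in> borel_measurable lebesgue" using mf by measurable
      show "AE x in lebesgue. indicator A x *\<^sub>R g x = indicator A x *\<^sub>R f x" using fg' by eventually_elim simp
    qed
    finally show ?thesis .
  qed
  have zero: "(LINT x:A|lborel. g x) = 0" if A: "A \<in> sets borel" for A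
  proof -
    have "Int_stable (range (\<lambda>(a, b). box a b :: 'a set))"
      by (auto simp: Int_stable_def box_Int_box)
    moreover have "range (\<lambda>(a, b). box a b :: 'a set) \<subseteq> Pow UNIV" by auto
    moreover have "A \<in> sigma_sets UNIV (range (\<lambda>(a, b). box a b))"
      using A unfolding borel_eq_box by simp
    ultimately show ?thesis
    proof (induction rule: sigma_sets_induct_disjoint)
      case (basic A)
      then obtain a b where A: "A = box a b" by auto
      have "(LINT x:box a b|lborel. g x) = (LINT x:cbox a b|lborel. g x)"
        unfolding set_lebesgue_integral_def
      proof (rule integral_cong_AE)
        have "negligible (cbox a b - box a b)" by (rule negligible_frontier_interval)
        then have "cbox a b - box a b \<in> null_sets lebesgue" by (simp add: negligible_iff_null_sets)
        then have "cbox a b - box a b \<in> null_sets lborel"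
          by (simp add: null_sets_completion_iff)
        from AE_not_in[OF this] show "AE x in lborel. indicator (box a b) x *\<^sub>R g x = indicator (cbox a b) x *\<^sub>R g x"
        proof eventually_elim
          case (elim x)
          then show ?case using box_subset_cbox[of a b] by (auto simp: indicator_def)
        qed
      qed auto
      then show ?case using boxes[of a b] eq[of "cbox a b"] by (simp add: A set_lebesgue_integral_def)
    next
      case empty
      then show ?case by (simp add: set_lebesgue_integral_def)
    next
      case (compl A)
      have A: "A \<in> sets borel" using compl(1) unfolding borel_eq_box by simp
      have "(LINT x:UNIV - A|lborel. g x) = (\<integral>x. g x - indicator A x *\<^sub>R g x \<partial>lborel)"
        unfolding set_lebesgue_integral_def by (intro Bochner_Integration.integral_cong) (auto simp: indicator_def)
      also have "\<dots> = (\<integral>x. g x \<partial>lborel) - (LINT x:A|lborel. g x)"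
        unfolding set_lebesgue_integral_def
        by (rule Bochner_Integration.integral_diff[OF ig]) (use integrable_mult_indicator[OF _ ig, of A] A in simp)
      also have "(\<integral>x. g x \<partial>lborel) = 0" using eq[of UNIV] total by simp
      finally show ?case using compl(2) by simp
    next
      case (union A)
      have A: "A i \<in> sets borel" for i using union(2) unfolding borel_eq_box by auto
      have "(LINT x:(\<Union>i. A i)|lborel. g x) = (\<Sum>i. (LINT x:(A i)|lborel. g x))"
      proof (rule lebesgue_integral_countable_add)
        show "A i \<inter> A j = {}" if "i \<noteq> j" for i j using union(1) that by (auto simp: disjoint_family_on_def)
        show "set_integrable lborel (\<Union>i. A i) g" unfolding set_integrable_def
          by (rule integrable_mult_indicator[OF _ ig]) (use A in auto)
      qed (use A in auto)
      then show ?case using union(3) by simp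
    qed
  qed
  have "AE x in lborel. g x = 0"
    by (rule density_unique_real[OF ig]) (use zero in \<open>auto simp: set_lebesgue_integral_def\<close>)
  then have "AE x in lborel. f x = 0" using fg by eventually_elim simp
  then show ?thesis by (rule AE_completion)
qed

inductive trig_poly :: "(real \<times> real \<Rightarrow> complex) \<Rightarrow> bool" where
  trig_term: "trig_poly (\<lambda>z. c * character \<xi> z)"
| trig_sum: "trig_poly f \<Longrightarrow> trig_poly g \<Longrightarrow> trig_poly (\<lambda>z. f z + g z)"

lemma trig_poly_cmult: "trig_poly f \<Longrightarrow> trig_poly (\<lambda>z. c * f z)"
proof (induction rule: trig_poly.induct)
  case (trig_term d \<xi>)
  show ?case using trig_poly.trig_term[of "c * d" \<xi>] by (simp add: mult_ac)
next
  case (trig_sum f g)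
  show ?case using trig_poly.trig_sum[OF trig_sum.IH] by (simp add: distrib_left)
qed

lemma trig_poly_mult: "trig_poly f \<Longrightarrow> trig_poly g \<Longrightarrow> trig_poly (\<lambda>z. f z * g z)"
proof (induction rule: trig_poly.induct)
  case (trig_term c \<xi>)
  from trig_term show ?case
  proof (induction rule: trig_poly.induct)
    case (trig_term d \<zeta>)
    have "(\<lambda>z. c * character \<xi> z * (d * character \<zeta> z)) = (\<lambda>z. (c * d) * character (\<xi> + \<zeta>) z)"
      by (simp add: character_mult[symmetric] mult_ac)
    then show ?case using trig_poly.trig_term by simp
  next
    case (trig_sum f g)
    show ?case using trig_poly.trig_sum[OF trig_sum.IH] by (simp add: distrib_left)
  qed
next
  case (trig_sum f1 f2)
  show ?case using trig_poly.trig_sum[OF trig_sum.IH(1)[OF trig_sum.prems] trig_sum.IH(2)[OF trig_sum.prems]]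
    by (simp add: distrib_right)
qed

text \<open>Bridge to the polynomial form of Stone-Weierstrass: on the torus embedded in C x C the
  real coordinates are the cosines and sines of x and y, which are combinations of
  characters.\<close>

lemma trig_poly_real_polynomial:
  fixes p :: "complex \<times> complex \<Rightarrow> real"
  assumes "real_polynomial_function p"
  shows "trig_poly (\<lambda>z. complex_of_real (p (cis (fst z), cis (snd z))))"
  using assms
proof (induction rule: real_polynomial_function.induct)
  case (linear f)
  then interpret bounded_linear f .
  have cosx: "trig_poly (\<lambda>z. complex_of_real (cos (fst z)))"
    using trig_poly.trig_sum[OF trig_poly.trig_term[of "1/2" "(1, 0)"] trig_poly.trig_term[of "1/2" "(-1, 0)"]]
    by (rule back_subst[of trig_poly]) (auto simp: character_def complex_eq_iff fun_eq_iff)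
  have sinx: "trig_poly (\<lambda>z. complex_of_real (sin (fst z)))"
    using trig_poly.trig_sum[OF trig_poly.trig_term[of "-\<i>/2" "(1, 0)"] trig_poly.trig_term[of "\<i>/2" "(-1, 0)"]]
    by (rule back_subst[of trig_poly]) (auto simp: character_def complex_eq_iff fun_eq_iff)
  have cosy: "trig_poly (\<lambda>z. complex_of_real (cos (snd z)))"
    using trig_poly.trig_sum[OF trig_poly.trig_term[of "1/2" "(0, 1)"] trig_poly.trig_term[of "1/2" "(0, -1)"]]
    by (rule back_subst[of trig_poly]) (auto simp: character_def complex_eq_iff fun_eq_iff)
  have siny: "trig_poly (\<lambda>z. complex_of_real (sin (snd z)))"
    using trig_poly.trig_sum[OF trig_poly.trig_term[of "-\<i>/2" "(0, 1)"] trig_poly.trig_term[of "\<i>/2" "(0, -1)"]]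
    by (rule back_subst[of trig_poly]) (auto simp: character_def complex_eq_iff fun_eq_iff)
  have "f (cis x, cis y) = cos x * f (1, 0) + sin x * f (\<i>, 0) + (cos y * f (0, 1) + sin y * f (0, \<i>))" for x y
  proof -
    have "(cis x, cis y) = cos x *\<^sub>R (1, 0) + sin x *\<^sub>R (\<i>, 0) + (cos y *\<^sub>R (0, 1) + sin y *\<^sub>R (0, \<i>))"
      by (simp add: complex_eq_iff)
    then show ?thesis by (simp only: add scaleR) simp
  qed
  then have "(\<lambda>z. complex_of_real (f (cis (fst z), cis (snd z)))) =
    (\<lambda>z. complex_of_real (f (1, 0)) * complex_of_real (cos (fst z)) + complex_of_real (f (\<i>, 0)) * complex_of_real (sin (fst z))
     + (complex_of_real (f (0, 1)) * complex_of_real (cos (snd z)) + complex_of_real (f (0, \<i>)) * complex_of_real (sin (snd z))))"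
    by (simp add: fun_eq_iff mult_ac)
  then show ?case
    by (simp only:) (intro trig_poly.trig_sum trig_poly_cmult cosx sinx cosy siny)
next
  case (const c)
  show ?case using trig_poly.trig_term[of "complex_of_real c" 0] by simp
next
  case (add f g)
  show ?case using trig_poly.trig_sum[OF add.IH] by simp
next
  case (mult f g)
  show ?case using trig_poly_mult[OF mult.IH] by simp
qed

lemma integral_trig_poly_zero:
  assumes u: "integrable torus u" and z: "\<And>\<xi>. ft u \<xi> = 0" and f: "trig_poly f"
  shows "integrable torus (\<lambda>z. f z * u z) \<and> (\<integral>z. f z * u z \<partial>torus) = 0"
  using f
proof (induction rule: trig_poly.induct)
  case (trig_term c \<xi>)
  have i: "integrable torus (\<lambda>z. character \<xi> z * u z)" by (rule integrable_character_mult[OF u])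
  have "(\<integral>z. character \<xi> z * u z \<partial>torus) = 0" using z[of "- \<xi>"] by (simp add: ft_def)
  then show ?case using i by (simp add: mult.assoc)
next
  case (trig_sum f g)
  then show ?case by (simp add: distrib_right)
qed

text \<open>Stone-Weierstrass on the product of two unit circles: G is uniformly close to a
  polynomial there, and polynomials integrate to 0 against u.\<close>

lemma integral_continuous_zero:
  fixes u :: "real \<times> real \<Rightarrow> real" and G :: "complex \<times> complex \<Rightarrow> real"
  assumes u: "integrable torus u" and z: "\<And>\<xi>. fourier u \<xi> = 0" and G: "continuous_on UNIV G"
  shows "(\<integral>z. G (cis (fst z), cis (snd z)) * u z \<partial>torus) = 0"
proof -
  define S where "S = sphere (0::complex) 1 \<times> sphere (0::complex) 1"
  define e where "e z = (cis (fst z), cis (snd z))" for z :: "real \<times> real"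
  have e_cont: "continuous_on UNIV e" unfolding e_def[abs_def] by (intro continuous_intros)
  have eS: "e z \<in> S" for z by (simp add: e_def S_def)
  have "compact S" unfolding S_def by (intro compact_Times) auto
  then have "bounded (G ` S)" using continuous_on_subset[OF G, of S]
    by (intro compact_imp_bounded compact_continuous_image) auto
  then obtain B where B: "\<And>w. w \<in> S \<Longrightarrow> \<bar>G w\<bar> \<le> B" by (auto simp: bounded_iff)
  have mG: "(\<lambda>z. G (e z)) \<in> borel_measurable torus"
    by (rule continuous_borel_measurable_torus) (rule continuous_on_compose2[OF G e_cont], simp)
  have int: "integrable torus (\<lambda>z. h z * u z)"
    if "h \<in> borel_measurable torus" "\<And>z. \<bar>h z\<bar> \<le> c" for h c
  proof (rule Bochner_Integration.integrable_bound[OF integrable_mult_right[OF u, of c]])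
    show "(\<lambda>z. h z * u z) \<in> borel_measurable torus" using that(1) u by measurable
    show "AE z in torus. norm (h z * u z) \<le> norm (c * u z)"
      using that(2) by (intro AE_I2) (auto simp: abs_mult intro!: mult_right_mono order_trans[OF that(2) abs_ge_self])
  qed
  have "\<bar>\<integral>z. G (e z) * u z \<partial>torus\<bar> \<le> 0"
  proof (rule field_le_epsilon)
    fix r :: real assume r: "r > 0"
    define I where "I = (\<integral>z. \<bar>u z\<bar> \<partial>torus)"
    have I0: "I \<ge> 0" by (simp add: I_def)
    define \<epsilon> where "\<epsilon> = r / (I + 1)"
    have \<epsilon>: "\<epsilon> > 0" using r I0 by (simp add: \<epsilon>_def)
    obtain p where p: "polynomial_function p" "\<And>w. w \<in> S \<Longrightarrow> norm (G w - p w) < \<epsilon>"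
      using Stone_Weierstrass_polynomial_function[OF \<open>compact S\<close> continuous_on_subset[OF G] \<epsilon>] by auto
    have "real_polynomial_function p" using p(1) by (simp add: real_polynomial_function_eq)
    from integral_trig_poly_zero[OF _ _ trig_poly_real_polynomial[OF this], of "\<lambda>z. complex_of_real (u z)"]
    have pz: "integrable torus (\<lambda>z. complex_of_real (p (e z) * u z))" "(\<integral>z. complex_of_real (p (e z) * u z) \<partial>torus) = 0"
      using u z by (simp_all add: fourier_eq_ft e_def)
    have ip: "integrable torus (\<lambda>z. p (e z) * u z)" and p0: "(\<integral>z. p (e z) * u z \<partial>torus) = 0"
      using pz by (simp_all only: complex_of_real_integrable_eq integral_complex_of_real of_real_eq_0_iff)
    have iG: "integrable torus (\<lambda>z. G (e z) * u z)" by (rule int[OF mG, of B]) (use B eS in auto)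
    have "\<bar>\<integral>z. G (e z) * u z \<partial>torus\<bar> = \<bar>\<integral>z. G (e z) * u z - p (e z) * u z \<partial>torus\<bar>"
      using iG ip p0 by simp
    also have "\<dots> \<le> (\<integral>z. \<bar>G (e z) * u z - p (e z) * u z\<bar> \<partial>torus)"
      by (rule integral_abs_bound)
    also have "\<dots> \<le> (\<integral>z. \<epsilon> * \<bar>u z\<bar> \<partial>torus)"
    proof (rule integral_mono)
      show "integrable torus (\<lambda>z. \<bar>G (e z) * u z - p (e z) * u z\<bar>)" using iG ip by simp
      show "integrable torus (\<lambda>z. \<epsilon> * \<bar>u z\<bar>)" using u by simp
      fix z
      have "\<bar>G (e z) * u z - p (e z) * u z\<bar> = \<bar>G (e z) - p (e z)\<bar> * \<bar>u z\<bar>"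
        by (simp add: abs_mult[symmetric] left_diff_distrib)
      also have "\<dots> \<le> \<epsilon> * \<bar>u z\<bar>" using p(2)[OF eS[of z]] by (intro mult_right_mono) auto
      finally show "\<bar>G (e z) * u z - p (e z) * u z\<bar> \<le> \<epsilon> * \<bar>u z\<bar>" .
    qed
    also have "\<dots> = \<epsilon> * I" by (simp add: I_def)
    also have "\<dots> \<le> r" unfolding \<epsilon>_def using r I0 by (simp add: field_simps)
    finally show "\<bar>\<integral>z. G (e z) * u z \<partial>torus\<bar> \<le> 0 + r" by simp
  qed
  then show ?thesis by (simp add: e_def)
qed

text \<open>The map to the circle identifies the two end points, so injectivity needs one of the
  points in the interior.\<close>

lemma cis_inj_interior:
  assumes "x \<in> {0<..<2 * pi}" "y \<in> {0..2 * pi}" "cis x = cis y"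
  shows "x = y"
proof -
  have "sin y = sin x \<and> cos y = cos x" using assms(3) by (simp add: complex_eq_iff)
  then obtain n :: int where n: "y = x + 2 * pi * of_int n" using sin_cos_eq_iff by blast
  have d: "- (2 * pi) < y - x" "y - x < 2 * pi" using assms(1,2) by auto
  have "of_int n * (2 * pi) = y - x" using n by simp
  then have "-1 * (2 * pi) < of_int n * (2 * pi)" "of_int n * (2 * pi) < 1 * (2 * pi)" using d by linarith+
  then have "-1 < real_of_int n" "real_of_int n < 1" using pi_gt_zero by (simp_all only: mult_less_cancel_right)
  then have "n = 0" by linarith
  then show ?thesis using n by simp
qed

text \<open>From continuous functions on the embedded torus one passes to indicators of images of
  boxes by dominated convergence. The embedding is injective off the boundary of the square, a null
  set, so the image of a box pulls back to the box almost everywhere.\<close>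

lemma fourier_zero_imp_AE_zero:
  assumes u: "integrable torus u" and z: "\<And>\<xi>. fourier u \<xi> = 0"
  shows "AE x in torus. u x = 0"
proof -
  define Q where "Q = {0..2 * pi} \<times> {0..2 * pi}"
  define e where "e z = (cis (fst z), cis (snd z))" for z :: "real \<times> real"
  have e_cont: "continuous_on S e" for S unfolding e_def[abs_def] by (intro continuous_intros)
  define f where "f = (\<lambda>z. indicator Q z *\<^sub>R u z)"
  have Q: "Q \<in> sets lebesgue" unfolding Q_def by simp
  have f: "integrable lebesgue f"
    unfolding f_def using u integrable_restrict_space[of Q lebesgue u] Q by (simp add: torus_def Q_def)
  have int_f: "(\<integral>z. indicator A z *\<^sub>R f z \<partial>lebesgue) = (\<integral>z. indicator A z *\<^sub>R u z \<partial>torus)" for A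
    unfolding torus_def Q_def[symmetric] f_def
    using integral_restrict_space[of Q lebesgue "\<lambda>z. indicator A z *\<^sub>R u z"] Q
    by (simp add: mult_ac)
  have AE_int: "AE z in torus. z \<in> {0<..<2 * pi} \<times> {0<..<2 * pi}"
  proof -
    have "negligible (cbox (0::real, 0::real) (2 * pi, 2 * pi) - box (0, 0) (2 * pi, 2 * pi))"
      by (rule negligible_frontier_interval)
    then have "AE z in lebesgue. z \<notin> cbox (0, 0) (2 * pi, 2 * pi) - box (0::real, 0::real) (2 * pi, 2 * pi)"
      by (intro AE_not_in) (simp add: negligible_iff_null_sets)
    moreover have "z \<in> {0<..<2 * pi} \<times> {0<..<2 * pi}"
      if "z \<notin> cbox (0, 0) (2 * pi, 2 * pi) - box (0::real, 0::real) (2 * pi, 2 * pi)" "z \<in> {0..2 * pi} \<times> {0..2 * pi}" for z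
      proof -
      have "z \<in> box (0, 0) (2 * pi, 2 * pi)" using that by (simp add: square_eq_cbox)
      then show ?thesis by (cases z) (auto simp: box_def Basis_prod_def)
    qed
    ultimately show ?thesis unfolding torus_def
      by (subst AE_restrict_space_iff) (auto elim!: eventually_mono)
  qed
  have closed_case: "(\<integral>z. indicator (cbox a b) z *\<^sub>R u z \<partial>torus) = 0" if sub: "cbox a b \<subseteq> Q" for a b
  proof (cases "cbox a b = {}")
    case False
    define A where "A = e ` cbox a b"
    have A: "closed A" "A \<noteq> {}"
      using False unfolding A_def by (auto intro!: compact_imp_closed compact_continuous_image e_cont)
    \<comment> \<open>Continuous functions decreasing to the indicator of the closed set A; composed
      with the embedding they are automatically periodic.\<close>
    define G where "G n w = max 0 (1 - real n * infdist w A)" for n w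
    have Gc: "continuous_on UNIV (G n)" for n
      unfolding G_def[abs_def] by (intro continuous_intros)
    have G0: "0 \<le> G n w" "G n w \<le> 1" for n w
      using infdist_nonneg[of w A] by (auto simp: G_def)
    have lim: "(\<lambda>n. G n w) \<longlonglongrightarrow> indicator A w" for w
    proof (cases "w \<in> A")
      case True
      then show ?thesis by (simp add: G_def)
    next
      case False
      then have d: "infdist w A > 0"
        using A by (metis in_closed_iff_infdist_zero infdist_nonneg less_eq_real_def)
      obtain N :: nat where N: "1 < real N * infdist w A" using reals_Archimedean3[OF d] by blast
      have "\<forall>\<^sub>F n in sequentially. G n w = indicator A w"
        using eventually_ge_at_top[of N]
      proof eventually_elim
        case (elim n)
        then have "real N * infdist w A \<le> real n * infdist w A" using d by (intro mult_right_mono) auto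
        then show ?case using N False by (simp add: G_def)
      qed
      then show ?thesis by (rule tendsto_eventually)
    qed
    have "(\<lambda>n. \<integral>z. G n (e z) * u z \<partial>torus) \<longlonglongrightarrow> (\<integral>z. indicator A (e z) * u z \<partial>torus)"
    proof (rule integral_dominated_convergence[where w = "\<lambda>z. \<bar>u z\<bar>"])
      have "(\<lambda>z. G n (e z)) \<in> borel_measurable torus" for n
        by (rule continuous_borel_measurable_torus) (rule continuous_on_compose2[OF Gc e_cont], simp)
      then show m: "(\<lambda>z. G n (e z) * u z) \<in> borel_measurable torus" for n using u by measurable
      show l: "AE z in torus. (\<lambda>n. G n (e z) * u z) \<longlonglongrightarrow> indicator A (e z) * u z"
        by (intro AE_I2 tendsto_intros lim)
      show "(\<lambda>z. indicator A (e z) * u z) \<in> borel_measurable torus"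
        by (rule borel_measurable_LIMSEQ_metric[where f = "\<lambda>n z. G n (e z) * u z", OF m]) (intro tendsto_intros lim)
      show "AE z in torus. norm (G n (e z) * u z) \<le> \<bar>u z\<bar>" for n
        using mult_right_mono[OF G0(2), of "\<bar>u _\<bar>"] G0(1) by (intro AE_I2) (auto simp: abs_mult)
    qed (use u in auto)
    moreover have "(\<integral>z. G n (e z) * u z \<partial>torus) = 0" for n
      using integral_continuous_zero[OF u z Gc[of n]] by (simp add: e_def)
    ultimately have "(\<integral>z. indicator A (e z) * u z \<partial>torus) = 0"
      using LIMSEQ_unique[OF _ tendsto_const] by simp
    moreover have "(\<integral>z. indicator A (e z) * u z \<partial>torus) = (\<integral>z. indicator (cbox a b) z *\<^sub>R u z \<partial>torus)"
    proof (rule integral_cong_AE)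
      have "AE z in torus. indicator A (e z) = (indicator (cbox a b) z :: real)"
        using AE_int
      proof eventually_elim
        case (elim z)
        have "z \<in> cbox a b" if eA: "e z \<in> A"
        proof -
          obtain w where w: "w \<in> cbox a b" "e z = e w" using eA unfolding A_def by blast
          then have "w \<in> Q" using sub by auto
          then have "z = w" using w(2) elim cis_inj_interior[of "fst z" "fst w"] cis_inj_interior[of "snd z" "snd w"]
            by (cases z; cases w) (auto simp: e_def Q_def)
          then show ?thesis using w by simp
        qed
        then show ?case by (auto simp: A_def indicator_def)
      qed
      then show "AE z in torus. indicator A (e z) * u z = indicator (cbox a b) z *\<^sub>R u z" by eventually_elim simp
      have "(\<lambda>z. indicator A (e z) :: real) \<in> borel_measurable torus"
      proof (rule borel_measurable_torus)
        have "e \<in> borel_measurable borel" by (intro borel_measurable_continuous_onI e_cont)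
        moreover have "indicator A \<in> borel_measurable (borel :: (complex \<times> complex) measure)" using A by (simp add: borel_measurable_indicator)
        ultimately show "(\<lambda>z. indicator A (e z) :: real) \<in> borel_measurable borel" by (rule measurable_compose)
      qed
      then show "(\<lambda>z. indicator A (e z) * u z) \<in> borel_measurable torus" using u by measurable
      have "(indicator (cbox a b) :: _ \<Rightarrow> real) \<in> borel_measurable torus"
        by (intro borel_measurable_torus borel_measurable_indicator) simp
      then show "(\<lambda>z. indicator (cbox a b) z *\<^sub>R u z) \<in> borel_measurable torus" using u by measurable
    qed
    ultimately show ?thesis by simp
  qed simp
  have "AE z in lebesgue. f z = 0"
  proof (rule AE_zero_of_cbox_integrals[OF f])
    fix a b :: "real \<times> real"
    obtain c d where cd: "cbox a b \<inter> Q = cbox c d" unfolding Q_def square_eq_cbox Int_interval by blast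
    have "(\<integral>z. indicator (cbox a b) z *\<^sub>R f z \<partial>lebesgue) = (\<integral>z. indicator (cbox c d) z *\<^sub>R f z \<partial>lebesgue)"
      unfolding cd[symmetric] f_def by (intro Bochner_Integration.integral_cong) (auto simp: indicator_def)
    also have "\<dots> = 0" unfolding int_f by (rule closed_case) (use cd in auto)
    finally show "(\<integral>z. indicator (cbox a b) z *\<^sub>R f z \<partial>lebesgue) = 0" .
  next
    have "(\<integral>z. f z \<partial>lebesgue) = (\<integral>z. indicator Q z *\<^sub>R f z \<partial>lebesgue)"
      unfolding f_def by (intro Bochner_Integration.integral_cong) (auto simp: indicator_def)
    also have "\<dots> = 0" unfolding int_f unfolding Q_def square_eq_cbox
      by (rule closed_case) (simp add: Q_def square_eq_cbox)
    finally show "(\<integral>z. f z \<partial>lebesgue) = 0" .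
  qed
  then show ?thesis
    unfolding torus_def by (subst AE_restrict_space_iff) (auto simp: f_def Q_def indicator_def elim!: eventually_mono)
qed

subsection \<open>Riesz--Fischer and absolutely convergent Fourier series\<close>

lemma trig_sum_measurable [measurable]: "(\<lambda>z. \<Sum>\<xi>\<in>F. d \<xi> * character \<xi> z) \<in> borel_measurable torus"
  by measurable

lemma integrable_trig_sum: "integrable torus (\<lambda>z. \<Sum>\<xi>\<in>F. d \<xi> * character \<xi> z)"
  by (intro Bochner_Integration.integrable_sum integrable_mult_right integrable_character)

lemma ft_sum:
  assumes "finite F" "\<And>i. i \<in> F \<Longrightarrow> integrable torus (f i)"
  shows "ft (\<lambda>z. \<Sum>i\<in>F. f i z) \<xi> = (\<Sum>i\<in>F. ft (f i) \<xi>)"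
  using assms
proof (induction F rule: finite_induct)
  case (insert i F)
  then show ?case by (simp add: ft_add)
qed (simp add: ft_def)

lemma ft_trig_sum:
  assumes "finite F"
  shows "ft (\<lambda>z. \<Sum>\<zeta>\<in>F. d \<zeta> * character \<zeta> z) \<xi> = (if \<xi> \<in> F then d \<xi> else 0)"
proof -
  have "ft (\<lambda>z. \<Sum>\<zeta>\<in>F. d \<zeta> * character \<zeta> z) \<xi> = (\<Sum>\<zeta>\<in>F. if \<zeta> = \<xi> then d \<zeta> else 0)"
    by (subst ft_sum[OF assms]) (auto simp: ft_cmult ft_character integrable_character intro!: sum.cong)
  then show ?thesis using assms by simp
qed

lemma integral_norm_sq_trig_sum:
  assumes F: "finite F"
  shows "(\<integral>z. (cmod (\<Sum>\<xi>\<in>F. d \<xi> * character \<xi> z))\<^sup>2 \<partial>torus) = (2 * pi)\<^sup>2 * (\<Sum>\<xi>\<in>F. (cmod (d \<xi>))\<^sup>2)"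
proof -
  define S where "S z = (\<Sum>\<xi>\<in>F. d \<xi> * character \<xi> z)" for z
  have "complex_of_real (\<integral>z. (cmod (S z))\<^sup>2 \<partial>torus) = (\<integral>z. complex_of_real ((cmod (S z))\<^sup>2) \<partial>torus)"
    by (rule integral_complex_of_real[symmetric])
  also have "\<dots> = (\<integral>z. (\<Sum>\<zeta>\<in>F. cnj (d \<zeta>) * (character (- \<zeta>) z * S z)) \<partial>torus)"
    by (intro Bochner_Integration.integral_cong refl, subst complex_norm_square)
      (simp add: S_def cnj_character sum_distrib_left sum_distrib_right mult_ac)
  also have "\<dots> = (\<Sum>\<zeta>\<in>F. cnj (d \<zeta>) * (\<integral>z. character (- \<zeta>) z * S z \<partial>torus))"
    using integrable_character_mult[OF integrable_trig_sum[where F = F and d = d]]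
    by (subst Bochner_Integration.integral_sum) (auto simp: S_def)
  also have "\<dots> = (\<Sum>\<zeta>\<in>F. complex_of_real ((2 * pi)\<^sup>2 * (cmod (d \<zeta>))\<^sup>2))"
  proof (rule sum.cong[OF refl])
    fix \<zeta> assume "\<zeta> \<in> F"
    then have "complex_of_real (1 / (2 * pi)\<^sup>2) * (\<integral>z. character (- \<zeta>) z * S z \<partial>torus) = d \<zeta>"
      using ft_trig_sum[OF F, of d \<zeta>] by (simp add: ft_def S_def)
    then have I: "(\<integral>z. character (- \<zeta>) z * S z \<partial>torus) = complex_of_real ((2 * pi)\<^sup>2) * d \<zeta>"
      by (simp add: field_simps)
    show "cnj (d \<zeta>) * (\<integral>z. character (- \<zeta>) z * S z \<partial>torus) = complex_of_real ((2 * pi)\<^sup>2 * (cmod (d \<zeta>))\<^sup>2)"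
      unfolding I of_real_mult complex_norm_square by (simp only: mult_ac)
  qed
  also have "\<dots> = complex_of_real ((2 * pi)\<^sup>2 * (\<Sum>\<xi>\<in>F. (cmod (d \<xi>))\<^sup>2))"
    by (simp only: of_real_sum sum_distrib_left)
  finally show ?thesis unfolding S_def by (simp only: of_real_eq_iff)
qed

lemma torus_measure: "measure torus (space torus) = (2 * pi)\<^sup>2"
proof -
  have "complex_of_real (measure torus (space torus)) = (\<integral>z. character 0 z \<partial>torus)"
    by (simp add: scaleR_conv_of_real)
  then show ?thesis unfolding integral_character by (simp only: if_True refl of_real_eq_iff)
qed

text \<open>Cauchy-Schwarz against the constant 1 in the form 2 s |f| \<le> s^2 + |f|^2, with s the
  root mean square bound and (2 pi)^2 the measure of the torus.\<close>

lemma integral_norm_le_of_sq: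
  fixes f :: "real \<times> real \<Rightarrow> complex"
  assumes f: "integrable torus f" and f2: "integrable torus (\<lambda>z. (cmod (f z))\<^sup>2)" and s: "s > 0"
    and le: "(\<integral>z. (cmod (f z))\<^sup>2 \<partial>torus) \<le> (2 * pi)\<^sup>2 * s\<^sup>2"
  shows "(\<integral>z. cmod (f z) \<partial>torus) \<le> (2 * pi)\<^sup>2 * s"
proof -
  have one: "(\<integral>z. s / 2 \<partial>torus) = s / 2 * (2 * pi)\<^sup>2"
    using torus_measure by (simp only: Bochner_Integration.lebesgue_integral_const) simp
  have "(\<integral>z. cmod (f z) \<partial>torus) \<le> (\<integral>z. s / 2 + 1 / (2 * s) * (cmod (f z))\<^sup>2 \<partial>torus)"
  proof (rule integral_mono)
    show "integrable torus (\<lambda>z. s / 2 + 1 / (2 * s) * (cmod (f z))\<^sup>2)"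
      using f2 by (intro Bochner_Integration.integrable_add integrable_mult_right) auto
    fix z
    have "2 * s * cmod (f z) \<le> s\<^sup>2 + (cmod (f z))\<^sup>2" by (rule sum_squares_bound)
    then show "cmod (f z) \<le> s / 2 + 1 / (2 * s) * (cmod (f z))\<^sup>2"
      using s by (simp add: field_simps power2_eq_square)
  qed (use f in simp)
  also have "\<dots> = s / 2 * (2 * pi)\<^sup>2 + 1 / (2 * s) * (\<integral>z. (cmod (f z))\<^sup>2 \<partial>torus)"
  proof -
    have "integrable torus (\<lambda>z. 1 / (2 * s) * (cmod (f z))\<^sup>2)" "integrable torus (\<lambda>z. s / 2)"
      using f2 by (auto intro: integrable_mult_right)
    then show ?thesis
      by (simp only: Bochner_Integration.integral_add one integral_mult_right_zero)
  qed
  also have "\<dots> \<le> s / 2 * (2 * pi)\<^sup>2 + 1 / (2 * s) * ((2 * pi)\<^sup>2 * s\<^sup>2)"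
    using s le by (intro add_left_mono mult_left_mono) auto
  also have "\<dots> = (2 * pi)\<^sup>2 * s" using s by (simp add: field_simps power2_eq_square)
  finally show ?thesis .
qed

lemma cis_periodic: "cis (of_int n * (x + 2 * pi) + y) = cis (of_int n * x + y)"
proof -
  have "cis (of_int n * (x + 2 * pi) + y) = cis (2 * pi * of_int n) * cis (of_int n * x + y)"
    by (simp add: cis_mult algebra_simps)
  then show ?thesis by simp
qed

lemma character_periodic:
  "character \<xi> (x + 2 * pi, y) = character \<xi> (x, y)"
  "character \<xi> (x, y + 2 * pi) = character \<xi> (x, y)"
  using cis_periodic[of "fst \<xi>" x "of_int (snd \<xi>) * y"] cis_periodic[of "snd \<xi>" y "of_int (fst \<xi>) * x"]
  by (simp_all add: character_def add.commute)

lemma integrable_cmod_sq_trig_sum: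
  "integrable torus (\<lambda>z. (cmod (\<Sum>\<xi>\<in>F. d \<xi> * character \<xi> z))\<^sup>2)"
proof (rule torus.integrable_const_bound[where B = "(\<Sum>\<xi>\<in>F. cmod (d \<xi>))\<^sup>2"])
  show "AE z in torus. norm ((cmod (\<Sum>\<xi>\<in>F. d \<xi> * character \<xi> z))\<^sup>2) \<le> (\<Sum>\<xi>\<in>F. cmod (d \<xi>))\<^sup>2"
  proof (intro AE_I2)
    fix z
    have "cmod (\<Sum>\<xi>\<in>F. d \<xi> * character \<xi> z) \<le> (\<Sum>\<xi>\<in>F. cmod (d \<xi>))"
      by (rule order_trans[OF norm_sum]) (simp add: norm_mult)
    then show "norm ((cmod (\<Sum>\<xi>\<in>F. d \<xi> * character \<xi> z))\<^sup>2) \<le> (\<Sum>\<xi>\<in>F. cmod (d \<xi>))\<^sup>2"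
      by (simp add: power_mono)
  qed
qed measurable

text \<open>The tails are made geometrically small so that the L1 norms of consecutive blocks of the
  Fourier series form a convergent series.\<close>

lemma exhausting_sets:
  assumes c: "sq_summable (c :: 'i \<Rightarrow> complex)"
  obtains G :: "nat \<Rightarrow> 'i set" where "\<And>n. finite (G n)" "\<And>n. G n \<subseteq> G (Suc n)"
    "\<And>n F. finite F \<Longrightarrow> F \<inter> G n = {} \<Longrightarrow> (\<Sum>i\<in>F. (cmod (c i))\<^sup>2) \<le> ((1/2) ^ n)\<^sup>2"
proof -
  have s: "(\<lambda>i. (cmod (c i))\<^sup>2) summable_on UNIV" using c by (simp add: sq_summable_def)
  have "\<exists>F. finite F \<and> (\<forall>H. finite H \<longrightarrow> H \<inter> F = {} \<longrightarrow> (\<Sum>i\<in>H. (cmod (c i))\<^sup>2) \<le> ((1/2) ^ n)\<^sup>2)" for n :: nat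
  proof -
    obtain F where F: "finite F" "dist (\<Sum>i\<in>F. (cmod (c i))\<^sup>2) (\<Sum>\<^sub>\<infinity>i. (cmod (c i))\<^sup>2) \<le> ((1/2) ^ n)\<^sup>2"
      using infsum_finite_approximation[OF s, of "((1/2) ^ n)\<^sup>2"] by auto
    have "(\<Sum>i\<in>H. (cmod (c i))\<^sup>2) \<le> ((1/2) ^ n)\<^sup>2" if "finite H" "H \<inter> F = {}" for H
    proof -
      have "(\<Sum>i\<in>H. (cmod (c i))\<^sup>2) + (\<Sum>i\<in>F. (cmod (c i))\<^sup>2) = (\<Sum>i\<in>H \<union> F. (cmod (c i))\<^sup>2)"
        using that F(1) by (simp add: sum.union_disjoint)
      also have "\<dots> \<le> (\<Sum>\<^sub>\<infinity>i. (cmod (c i))\<^sup>2)"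
        by (rule finite_sum_le_infsum[OF s]) (use that F in auto)
      finally show ?thesis using F(2) by (simp add: dist_real_def)
    qed
    then show ?thesis using F(1) by blast
  qed
  then obtain F where F: "\<And>n. finite (F n)"
    "\<And>n H. finite H \<Longrightarrow> H \<inter> F n = {} \<Longrightarrow> (\<Sum>i\<in>H. (cmod (c i))\<^sup>2) \<le> ((1/2) ^ n)\<^sup>2"
    by metis
  show thesis
  proof
    show "finite (\<Union>k\<le>n. F k)" for n using F(1) by auto
    show "(\<Union>k\<le>n. F k) \<subseteq> (\<Union>k\<le>Suc n. F k)" for n by (intro UN_mono) auto
    show "(\<Sum>i\<in>H. (cmod (c i))\<^sup>2) \<le> ((1/2) ^ n)\<^sup>2" if "finite H" "H \<inter> (\<Union>k\<le>n. F k) = {}" for n H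
      by (rule F(2)[OF that(1)]) (use that(2) in auto)
  qed
qed

text \<open>Along the exhausting sets the increments of the partial sums are summable in L1, hence
  the sums converge almost everywhere with an integrable majorant, and dominated convergence
  identifies the coefficients.\<close>

lemma riesz_fischer:
  assumes c: "sq_summable c" and real: "\<And>\<xi>. c (- \<xi>) = cnj (c \<xi>)"
  obtains v where "v \<in> L2_torus" "\<And>\<xi>. fourier v \<xi> = c \<xi>" "(\<integral>z. (v z)\<^sup>2 \<partial>torus) \<le> (2 * pi)\<^sup>2 * sqsum c"
proof -
  obtain G where G: "\<And>n. finite (G n)" "\<And>n. G n \<subseteq> G (Suc n)"
    "\<And>n F. finite F \<Longrightarrow> F \<inter> G n = {} \<Longrightarrow> (\<Sum>i\<in>F. (cmod (c i))\<^sup>2) \<le> ((1/2) ^ n)\<^sup>2"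
    using exhausting_sets[OF c] by blast
  define S where "S n z = (\<Sum>\<xi>\<in>G n. c \<xi> * character \<xi> z)" for n z
  define D where "D n z = S (Suc n) z - S n z" for n z
  have D: "D n z = (\<Sum>\<xi>\<in>G (Suc n) - G n. c \<xi> * character \<xi> z)" for n z
    unfolding D_def S_def using G by (simp add: sum_diff)
  have mS [measurable]: "S n \<in> borel_measurable torus" for n unfolding S_def[abs_def] by measurable
  have mD [measurable]: "D n \<in> borel_measurable torus" for n unfolding D_def[abs_def] by measurable
  have iS: "integrable torus (S n)" for n unfolding S_def[abs_def] by (rule integrable_trig_sum)
  have iD: "integrable torus (D n)" for n unfolding D_def[abs_def] using iS by simp
  have intD: "(\<integral>z. cmod (D n z) \<partial>torus) \<le> (2 * pi)\<^sup>2 * (1/2) ^ n" for n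
  proof (rule integral_norm_le_of_sq)
    show "integrable torus (\<lambda>z. (cmod (D n z))\<^sup>2)" unfolding D by (rule integrable_cmod_sq_trig_sum)
    show "(\<integral>z. (cmod (D n z))\<^sup>2 \<partial>torus) \<le> (2 * pi)\<^sup>2 * ((1/2) ^ n)\<^sup>2"
      unfolding D using G by (subst integral_norm_sq_trig_sum) (auto intro!: mult_left_mono G(3))
  qed (use iD in auto)
  have sum_int: "summable (\<lambda>n. \<integral>z. cmod (D n z) \<partial>torus)"
    by (rule summable_comparison_test'[where g = "\<lambda>n. (2 * pi)\<^sup>2 * (1/2) ^ n" and N = 0])
      (use intD in \<open>auto intro!: summable_mult summable_geometric\<close>)
  have AE_sum: "AE z in torus. summable (\<lambda>n. cmod (D n z))"
  proof -
    have "(\<integral>\<^sup>+z. (\<Sum>n. ennreal (cmod (D n z))) \<partial>torus) = (\<Sum>n. \<integral>\<^sup>+z. ennreal (cmod (D n z)) \<partial>torus)"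
      by (rule nn_integral_suminf) measurable
    also have "\<dots> = (\<Sum>n. ennreal (\<integral>z. cmod (D n z) \<partial>torus))"
      using iD by (intro suminf_cong nn_integral_eq_integral) auto
    also have "\<dots> = ennreal (\<Sum>n. \<integral>z. cmod (D n z) \<partial>torus)"
      by (rule suminf_ennreal2[OF _ sum_int]) simp
    finally have "(\<integral>\<^sup>+z. (\<Sum>n. ennreal (cmod (D n z))) \<partial>torus) \<noteq> \<infinity>" by simp
    then have "AE z in torus. (\<Sum>n. ennreal (cmod (D n z))) \<noteq> \<infinity>"
      by (intro nn_integral_noteq_infinite) auto
    then show ?thesis
      by eventually_elim (rule summable_suminf_not_top, auto)
  qed
  have S_sum: "S n z = S 0 z + (\<Sum>k<n. D k z)" for n z
    using sum_lessThan_telescope[of "\<lambda>n. S n z" n] by (simp add: D_def)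
  \<comment> \<open>A pointwise limit: the partial sums are periodic, so f is periodic at every
    point, also where the limit does not exist.\<close>
  define f where "f z = lim (\<lambda>n. S n z)" for z
  have mf [measurable]: "f \<in> borel_measurable torus" unfolding f_def[abs_def] by measurable
  have AE_lim: "AE z in torus. (\<lambda>n. S n z) \<longlonglongrightarrow> f z \<and> (\<forall>n. cmod (S n z) \<le> cmod (S 0 z) + (\<Sum>k. cmod (D k z)))"
    using AE_sum
  proof eventually_elim
    case (elim z)
    have "(\<lambda>n. S 0 z + (\<Sum>k<n. D k z)) \<longlonglongrightarrow> S 0 z + (\<Sum>k. D k z)"
      by (intro tendsto_intros summable_LIMSEQ summable_norm_cancel[OF elim])
    then have "convergent (\<lambda>n. S n z)" unfolding S_sum[symmetric] by (rule convergentI)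
    moreover have "cmod (S n z) \<le> cmod (S 0 z) + (\<Sum>k. cmod (D k z))" for n
    proof -
      have "cmod (S n z) \<le> cmod (S 0 z) + (\<Sum>k<n. cmod (D k z))"
        unfolding S_sum[of n z] by (rule order_trans[OF norm_triangle_ineq add_left_mono[OF norm_sum]])
      also have "(\<Sum>k<n. cmod (D k z)) \<le> (\<Sum>k. cmod (D k z))" by (rule sum_le_suminf[OF elim]) auto
      finally show ?thesis by simp
    qed
    ultimately show ?case by (simp add: f_def convergent_LIMSEQ_iff)
  qed
  define w where "w z = cmod (S 0 z) + (\<Sum>k. cmod (D k z))" for z
  have iw: "integrable torus w"
    unfolding w_def[abs_def]
    by (intro Bochner_Integration.integrable_add integrable_suminf) (use iS iD AE_sum sum_int in auto)
  have f_int: "integrable torus f"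
  proof (rule integrable_dominated_convergence[where s = S and w = w])
    show "AE z in torus. (\<lambda>n. S n z) \<longlonglongrightarrow> f z" using AE_lim by eventually_elim simp
    show "AE z in torus. norm (S n z) \<le> w z" for n using AE_lim by eventually_elim (simp add: w_def)
  qed (use iw in auto)
  have ft_f: "ft f \<xi> = c \<xi>" for \<xi>
  proof -
    have "(\<lambda>n. \<integral>z. character (- \<xi>) z * S n z \<partial>torus) \<longlonglongrightarrow> (\<integral>z. character (- \<xi>) z * f z \<partial>torus)"
    proof (rule integral_dominated_convergence[where w = w])
      show "AE z in torus. (\<lambda>n. character (- \<xi>) z * S n z) \<longlonglongrightarrow> character (- \<xi>) z * f z"
        using AE_lim by eventually_elim (auto intro!: tendsto_intros)
      show "AE z in torus. norm (character (- \<xi>) z * S n z) \<le> w z" for n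
        using AE_lim by eventually_elim (auto simp: norm_mult w_def)
    qed (use iw in auto)
    then have "(\<lambda>n. ft (S n) \<xi>) \<longlonglongrightarrow> ft f \<xi>" unfolding ft_def by (intro tendsto_intros)
    moreover have "(\<lambda>n. ft (S n) \<xi>) \<longlonglongrightarrow> c \<xi>"
    \<comment> \<open>At stage n the coefficient is either exact already, or \<xi> lies outside
      \<open>G n\<close>, where c itself has modulus at most (1/2)^n.\<close>
    proof (rule Lim_transform_bound[of _ "\<lambda>n. (1/2::real) ^ n", THEN LIM_zero_cancel])
      show "\<forall>\<^sub>F n in sequentially. norm (ft (S n) \<xi> - c \<xi>) \<le> norm ((1/2::real) ^ n)"
      proof (intro always_eventually allI)
        fix n
        show "norm (ft (S n) \<xi> - c \<xi>) \<le> norm ((1/2::real) ^ n)"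
        proof (cases "\<xi> \<in> G n")
          case True
          then show ?thesis using ft_trig_sum[OF G(1)[of n], of c \<xi>] by (simp add: S_def[abs_def])
        next
          case False
          then have "(cmod (c \<xi>))\<^sup>2 \<le> ((1/2) ^ n)\<^sup>2" using G(3)[of "{\<xi>}" n] by simp
          then have "cmod (c \<xi>) \<le> (1/2) ^ n" by (rule power2_le_imp_le) simp
          then show ?thesis using False ft_trig_sum[OF G(1)[of n], of c \<xi>] by (simp add: S_def[abs_def])
        qed
      qed
      show "(\<lambda>n. (1/2::real) ^ n) \<longlonglongrightarrow> 0" by (rule LIMSEQ_realpow_zero) auto
    qed
    ultimately show ?thesis by (rule LIMSEQ_unique)
  qed
  \<comment> \<open>Fatou's lemma carries the bound on the partial sums to their almost everywhere
    limit.\<close>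
  have nnf: "(\<integral>\<^sup>+z. ennreal ((cmod (f z))\<^sup>2) \<partial>torus) \<le> ennreal ((2 * pi)\<^sup>2 * sqsum c)"
  proof -
    have "(\<integral>\<^sup>+z. ennreal ((cmod (f z))\<^sup>2) \<partial>torus) = (\<integral>\<^sup>+z. liminf (\<lambda>n. ennreal ((cmod (S n z))\<^sup>2)) \<partial>torus)"
    proof (rule nn_integral_cong_AE)
      show "AE z in torus. ennreal ((cmod (f z))\<^sup>2) = liminf (\<lambda>n. ennreal ((cmod (S n z))\<^sup>2))"
        using AE_lim
      proof eventually_elim
        case (elim z)
        then have "(\<lambda>n. ennreal ((cmod (S n z))\<^sup>2)) \<longlonglongrightarrow> ennreal ((cmod (f z))\<^sup>2)"
          by (intro tendsto_ennrealI tendsto_intros) auto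
        then show ?case by (intro lim_imp_Liminf[symmetric]) auto
      qed
    qed
    also have "\<dots> \<le> liminf (\<lambda>n. \<integral>\<^sup>+z. ennreal ((cmod (S n z))\<^sup>2) \<partial>torus)"
      by (rule nn_integral_liminf) measurable
    also have "\<dots> \<le> liminf (\<lambda>n. ennreal ((2 * pi)\<^sup>2 * sqsum c))"
    proof (intro Liminf_mono always_eventually allI)
      fix n
      have "(\<integral>\<^sup>+z. ennreal ((cmod (S n z))\<^sup>2) \<partial>torus) = ennreal (\<integral>z. (cmod (S n z))\<^sup>2 \<partial>torus)"
        unfolding S_def by (intro nn_integral_eq_integral integrable_cmod_sq_trig_sum) auto
      also have "(\<integral>z. (cmod (S n z))\<^sup>2 \<partial>torus) = (2 * pi)\<^sup>2 * (\<Sum>\<xi>\<in>G n. (cmod (c \<xi>))\<^sup>2)"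
        unfolding S_def by (rule integral_norm_sq_trig_sum[OF G(1)])
      also have "ennreal \<dots> \<le> ennreal ((2 * pi)\<^sup>2 * sqsum c)"
        unfolding sqsum_def using c G(1)
        by (intro ennreal_leI mult_left_mono finite_sum_le_infsum) (auto simp: sq_summable_def)
      finally show "(\<integral>\<^sup>+z. ennreal ((cmod (S n z))\<^sup>2) \<partial>torus) \<le> ennreal ((2 * pi)\<^sup>2 * sqsum c)" .
    qed
    finally show ?thesis by (simp add: Liminf_const)
  qed
  \<comment> \<open>The real part has the same coefficients as f, by the Hermitian symmetry of
    c.\<close>
  define v where "v z = Re (f z)" for z
  have mv [measurable]: "v \<in> borel_measurable torus" unfolding v_def[abs_def] by measurable
  have nnv: "(\<integral>\<^sup>+z. ennreal ((v z)\<^sup>2) \<partial>torus) \<le> ennreal ((2 * pi)\<^sup>2 * sqsum c)"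
  proof (rule order_trans[OF nn_integral_mono nnf])
    show "ennreal ((v z)\<^sup>2) \<le> ennreal ((cmod (f z))\<^sup>2)" for z
      unfolding v_def by (intro ennreal_leI) (simp add: cmod_power2)
  qed
  have iv2: "integrable torus (\<lambda>z. (v z)\<^sup>2)"
    by (rule integrableI_bounded) (use nnv in \<open>auto simp: le_less_trans\<close>)
  show thesis
  proof
    have "torus_periodic v"
      unfolding torus_periodic_def v_def f_def S_def by (simp add: character_periodic)
    then show "v \<in> L2_torus" using mv iv2 by (simp add: L2_torus_def)
    have "ennreal (\<integral>z. (v z)\<^sup>2 \<partial>torus) \<le> ennreal ((2 * pi)\<^sup>2 * sqsum c)"
      using nnv nn_integral_eq_integral[OF iv2] by simp
    then show "(\<integral>z. (v z)\<^sup>2 \<partial>torus) \<le> (2 * pi)\<^sup>2 * sqsum c"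
      by (simp add: ennreal_le_iff sqsum_nonneg)
    fix \<xi>
    have "fourier v \<xi> = ft (\<lambda>z. (1/2) * (f z + cnj (f z))) \<xi>"
      unfolding fourier_eq_ft v_def by (simp add: complex_add_cnj)
    also have "\<dots> = (1/2) * (ft f \<xi> + cnj (ft f (- \<xi>)))"
      by (simp only: ft_cmult) (subst ft_add, use f_int in \<open>auto simp: ft_cnj\<close>)
    also have "\<dots> = c \<xi>" by (simp add: ft_f real)
    finally show "fourier v \<xi> = c \<xi>" .
  qed
qed

section \<open>Absolutely convergent Fourier series\<close>

definition fseries :: "(int \<times> int \<Rightarrow> complex) \<Rightarrow> real \<times> real \<Rightarrow> complex" where
  "fseries c z = (\<Sum>\<^sub>\<infinity>\<xi>. c \<xi> * character \<xi> z)"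

lemma fseries_summable:
  assumes "(\<lambda>\<xi>. cmod (c \<xi>)) summable_on UNIV"
  shows "(\<lambda>\<xi>. norm (c \<xi> * character \<xi> z)) summable_on UNIV" "(\<lambda>\<xi>. c \<xi> * character \<xi> z) summable_on UNIV"
proof -
  show "(\<lambda>\<xi>. norm (c \<xi> * character \<xi> z)) summable_on UNIV" using assms by (simp add: norm_mult)
  then show "(\<lambda>\<xi>. c \<xi> * character \<xi> z) summable_on UNIV" by (rule abs_summable_summable)
qed

lemma fseries_uniform_limit:
  assumes "(\<lambda>\<xi>. cmod (c \<xi>)) summable_on UNIV"
  shows "uniform_limit UNIV (\<lambda>F z. \<Sum>\<xi>\<in>F. c \<xi> * character \<xi> z) (fseries c) (finite_subsets_at_top UNIV)"
  unfolding fseries_def[abs_def]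
  by (rule Weierstrass_m_test_general[OF _ assms]) (simp add: norm_mult)

lemma continuous_fseries:
  assumes "(\<lambda>\<xi>. cmod (c \<xi>)) summable_on UNIV"
  shows "continuous_on UNIV (fseries c)"
  by (rule uniform_limit_theorem[OF _ fseries_uniform_limit[OF assms]])
    (auto intro!: always_eventually continuous_intros)

lemma norm_fseries_le:
  assumes "(\<lambda>\<xi>. cmod (c \<xi>)) summable_on UNIV"
  shows "cmod (fseries c z) \<le> (\<Sum>\<^sub>\<infinity>\<xi>. cmod (c \<xi>))"
  unfolding fseries_def
  using norm_infsum_bound[OF fseries_summable(1)[OF assms, of z]] by (simp add: norm_mult)

lemma integrable_fseries:
  assumes "(\<lambda>\<xi>. cmod (c \<xi>)) summable_on UNIV"
  shows "integrable torus (fseries c)"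
  by (rule torus.integrable_const_bound[where B = "\<Sum>\<^sub>\<infinity>\<xi>. cmod (c \<xi>)"])
    (use norm_fseries_le[OF assms] continuous_borel_measurable_torus[OF continuous_fseries[OF assms]] in auto)

lemma ft_fseries:
  assumes c: "(\<lambda>\<xi>. cmod (c \<xi>)) summable_on UNIV"
  shows "ft (fseries c) \<xi> = c \<xi>"
proof -
  have "cmod (ft (fseries c) \<xi> - c \<xi>) \<le> 0"
  proof (rule field_le_epsilon)
    fix e :: real assume e: "e > 0"
    have "\<forall>\<^sub>F F in finite_subsets_at_top UNIV. \<forall>z\<in>UNIV. dist (\<Sum>\<xi>\<in>F. c \<xi> * character \<xi> z) (fseries c z) < e"
      by (rule uniform_limitD[OF fseries_uniform_limit[OF c] e])
    moreover have "\<forall>\<^sub>F F in finite_subsets_at_top UNIV. \<xi> \<in> F \<and> finite F"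
      unfolding eventually_finite_subsets_at_top by (rule exI[of _ "{\<xi>}"]) auto
    ultimately have "\<forall>\<^sub>F F in finite_subsets_at_top UNIV. finite F \<and> \<xi> \<in> F \<and> (\<forall>z. dist (\<Sum>\<xi>\<in>F. c \<xi> * character \<xi> z) (fseries c z) < e)"
      by eventually_elim auto
    then have "\<exists>F. finite F \<and> \<xi> \<in> F \<and> (\<forall>z. dist (\<Sum>\<xi>\<in>F. c \<xi> * character \<xi> z) (fseries c z) < e)"
      by (rule eventually_happens'[OF finite_subsets_at_top_neq_bot])
    then obtain F where F: "finite F" "\<xi> \<in> F" "\<And>z. dist (\<Sum>\<xi>\<in>F. c \<xi> * character \<xi> z) (fseries c z) < e"
      by blast
    define T where "T z = (\<Sum>\<xi>\<in>F. c \<xi> * character \<xi> z)" for z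
    have iT: "integrable torus T" unfolding T_def[abs_def] by (rule integrable_trig_sum)
    have iD: "integrable torus (\<lambda>z. fseries c z - T z)" using integrable_fseries[OF c] iT by simp
    have "ft (fseries c) \<xi> = ft (\<lambda>z. (fseries c z - T z) + T z) \<xi>" by simp
    also have "\<dots> = ft (\<lambda>z. fseries c z - T z) \<xi> + ft T \<xi>" by (rule ft_add[OF iD iT])
    also have "ft T \<xi> = c \<xi>" unfolding T_def[abs_def] using ft_trig_sum[OF F(1), of c \<xi>] F(2) by simp
    finally have "cmod (ft (fseries c) \<xi> - c \<xi>) = cmod (ft (\<lambda>z. fseries c z - T z) \<xi>)" by simp
    also have "\<dots> \<le> 1 / (2 * pi)\<^sup>2 * (\<integral>z. cmod (fseries c z - T z) \<partial>torus)" by (rule norm_ft_le[OF iD])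
    also have "\<dots> \<le> 1 / (2 * pi)\<^sup>2 * (\<integral>z. e \<partial>torus)"
      using iD F(3) by (intro mult_left_mono integral_mono) (auto simp: T_def dist_norm norm_minus_commute less_imp_le)
    also have "\<dots> = e" using torus_measure by simp
    finally show "cmod (ft (fseries c) \<xi> - c \<xi>) \<le> 0 + e" by simp
  qed
  then show ?thesis by simp
qed

lemma fseries_real:
  assumes c: "(\<lambda>\<xi>. cmod (c \<xi>)) summable_on UNIV" and real: "\<And>\<xi>. c (- \<xi>) = cnj (c \<xi>)"
  shows "complex_of_real (Re (fseries c z)) = fseries c z"
proof -
  have bij: "bij (\<lambda>\<xi> :: int \<times> int. - \<xi>)" using bij_diff_left[of 0] by simp
  have "cnj (fseries c z) = (\<Sum>\<^sub>\<infinity>\<xi>. c (- \<xi>) * character (- \<xi>) z)"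
    unfolding fseries_def infsum_cnj[symmetric] by (simp add: real cnj_character del: infsum_cnj)
  also have "\<dots> = fseries c z" unfolding fseries_def
    using infsum_reindex_bij_betw[OF bij, of "\<lambda>\<xi>. c \<xi> * character \<xi> z"] by simp
  finally have "Im (fseries c z) = 0" by (simp add: complex_eq_iff)
  then show ?thesis by (simp add: complex_eq_iff)
qed

lemma summable_product:
  assumes c: "(\<lambda>i. cmod (c i)) summable_on UNIV" and d: "(\<lambda>j. cmod (d j)) summable_on UNIV"
  shows "(\<lambda>(i, j). cmod (c i) * cmod (d j)) summable_on UNIV \<times> UNIV"
proof (rule summable_on_SigmaI)
  show "((\<lambda>j. case (i, j) of (i, j) \<Rightarrow> cmod (c i) * cmod (d j)) has_sum cmod (c i) * (\<Sum>\<^sub>\<infinity>j. cmod (d j))) UNIV" for i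
    using has_sum_cmult_right[OF has_sum_infsum[OF d], of "cmod (c i)"] by simp
  show "(\<lambda>i. cmod (c i) * (\<Sum>\<^sub>\<infinity>j. cmod (d j))) summable_on UNIV" by (rule summable_on_cmult_left[OF c])
qed auto

text \<open>Cauchy product in the algebra of absolutely convergent series, by the substitution
  (\<xi>, k) -> (k, \<xi> - k). It computes the coefficients of the product of eta and its
  x-derivative.\<close>

lemma fseries_mult:
  assumes c: "(\<lambda>\<xi>. cmod (c \<xi>)) summable_on UNIV" and d: "(\<lambda>\<xi>. cmod (d \<xi>)) summable_on UNIV"
  shows "(\<lambda>\<xi>. cmod (conv c d \<xi>)) summable_on UNIV" "fseries c z * fseries d z = fseries (conv c d) z"
proof -
  have bij: "bij_betw (\<lambda>(\<xi>, k). (k, \<xi> - k)) (UNIV \<times> UNIV :: ((int \<times> int) \<times> (int \<times> int)) set) (UNIV \<times> UNIV)"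
    by (rule bij_betw_byWitness[where f' = "\<lambda>(k, l). (k + l, k)"]) auto
  have s: "(\<lambda>q. norm (case q of (\<xi>, k) \<Rightarrow> c k * d (\<xi> - k))) summable_on UNIV \<times> UNIV"
    using iffD2[OF summable_on_reindex_bij_betw[OF bij] summable_product[OF c d]]
    by (simp add: case_prod_unfold norm_mult)
  have row: "(\<lambda>k. norm (c k * d (\<xi> - k))) summable_on UNIV" for \<xi>
    using summable_on_SigmaD1[of "\<lambda>\<xi> k. norm (c k * d (\<xi> - k))" UNIV "\<lambda>_. UNIV" \<xi>] s
    by (simp add: case_prod_unfold)
  have sn: "(\<lambda>\<xi>. \<Sum>\<^sub>\<infinity>k. norm (c k * d (\<xi> - k))) summable_on UNIV"
    using summable_on_Sigma_banach[of "\<lambda>\<xi> k. norm (c k * d (\<xi> - k))" UNIV "\<lambda>_. UNIV"] s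
    by (simp add: case_prod_unfold)
  show "(\<lambda>\<xi>. cmod (conv c d \<xi>)) summable_on UNIV"
    by (rule summable_on_comparison_test[OF sn]) (auto simp: conv_def intro!: norm_infsum_bound row)
  define f where "f = (\<lambda>(k, l). (c k * character k z) * (d l * character l z))"
  have sf: "(\<lambda>q. norm (f q)) summable_on UNIV \<times> UNIV"
    using summable_product[OF c d] by (simp add: f_def case_prod_unfold norm_mult)
  have "fseries c z * fseries d z = (\<Sum>\<^sub>\<infinity>k. (c k * character k z) * fseries d z)"
    unfolding fseries_def[of c] by (rule infsum_cmult_left[symmetric]) (use fseries_summable[OF c] in auto)
  also have "\<dots> = (\<Sum>\<^sub>\<infinity>k. \<Sum>\<^sub>\<infinity>l. f (k, l))"
    unfolding fseries_def f_def using fseries_summable(2)[OF d, of z]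
    by (intro infsum_cong) (simp add: infsum_cmult_right)
  also have "\<dots> = infsum f (UNIV \<times> UNIV)"
    by (rule infsum_Sigma_banach) (rule abs_summable_summable[OF sf])
  also have "\<dots> = (\<Sum>\<^sub>\<infinity>q\<in>UNIV \<times> UNIV. f ((\<lambda>(\<xi>, k). (k, \<xi> - k)) q))"
    by (rule infsum_reindex_bij_betw[OF bij, symmetric])
  also have "\<dots> = (\<Sum>\<^sub>\<infinity>\<xi>. \<Sum>\<^sub>\<infinity>k. f ((\<lambda>(\<xi>, k). (k, \<xi> - k)) (\<xi>, k)))"
    by (rule infsum_Sigma_banach[symmetric])
      (rule iffD2[OF summable_on_reindex_bij_betw[OF bij] abs_summable_summable[OF sf]])
  also have "\<dots> = (\<Sum>\<^sub>\<infinity>\<xi>. conv c d \<xi> * character \<xi> z)"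
  proof (rule infsum_cong)
    fix \<xi>
    have "(\<Sum>\<^sub>\<infinity>k. f ((\<lambda>(\<xi>, k). (k, \<xi> - k)) (\<xi>, k))) = (\<Sum>\<^sub>\<infinity>k. (c k * d (\<xi> - k)) * character \<xi> z)"
    proof (rule infsum_cong)
      fix k
      have "character k z * character (\<xi> - k) z = character \<xi> z" by (simp add: character_mult)
      then show "f ((\<lambda>(\<xi>, k). (k, \<xi> - k)) (\<xi>, k)) = (c k * d (\<xi> - k)) * character \<xi> z"
        by (simp add: f_def mult_ac)
    qed
    also have "\<dots> = conv c d \<xi> * character \<xi> z"
      unfolding conv_def by (rule infsum_cmult_left) (use abs_summable_summable[OF row] in auto)
    finally show "(\<Sum>\<^sub>\<infinity>k. f ((\<lambda>(\<xi>, k). (k, \<xi> - k)) (\<xi>, k))) = conv c d \<xi> * character \<xi> z" .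
  qed
  finally show "fseries c z * fseries d z = fseries (conv c d) z" by (simp add: fseries_def)
qed

subsection \<open>From solutions to Fourier coefficients\<close>

lemma L2_torus_integrable:
  assumes "u \<in> L2_torus"
  shows "integrable torus u"
proof (rule Bochner_Integration.integrable_bound[where f = "\<lambda>z. 1 + (u z)\<^sup>2"])
  show "integrable torus (\<lambda>z. 1 + (u z)\<^sup>2)" "u \<in> borel_measurable torus" using assms by (auto simp: L2_torus_def)
  have "\<bar>x\<bar> \<le> 1 + x\<^sup>2" for x :: real
    using sum_squares_bound[of 1 "\<bar>x\<bar>"] by simp
  then show "AE z in torus. norm (u z) \<le> norm (1 + (u z)\<^sup>2)" by simp
qed

lemma L2_torus_measurable: "u \<in> L2_torus \<Longrightarrow> u \<in> borel_measurable torus"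
  by (simp add: L2_torus_def)

lemma L2_torus_mult_integrable:
  assumes "u \<in> L2_torus" "v \<in> L2_torus"
  shows "integrable torus (\<lambda>z. u z * v z)"
proof (rule Bochner_Integration.integrable_bound[where f = "\<lambda>z. (u z)\<^sup>2 + (v z)\<^sup>2"])
  show "integrable torus (\<lambda>z. (u z)\<^sup>2 + (v z)\<^sup>2)" using assms by (auto simp: L2_torus_def)
  show "(\<lambda>z. u z * v z) \<in> borel_measurable torus"
    using assms by (intro borel_measurable_times) (auto simp: L2_torus_def)
  have "\<bar>x * y\<bar> \<le> x\<^sup>2 + y\<^sup>2" for x y :: real
  proof -
    have "2 * \<bar>x * y\<bar> \<le> x\<^sup>2 + y\<^sup>2" using sum_squares_bound[of "\<bar>x\<bar>" "\<bar>y\<bar>"] by (simp add: abs_mult)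
    then show ?thesis using abs_ge_zero[of "x * y"] by linarith
  qed
  then show "AE z in torus. norm (u z * v z) \<le> norm ((u z)\<^sup>2 + (v z)\<^sup>2)" by simp
qed

lemma L2_torus_add:
  assumes "u \<in> L2_torus" "v \<in> L2_torus"
  shows "(\<lambda>z. u z + v z) \<in> L2_torus"
proof -
  have "integrable torus (\<lambda>z. (u z)\<^sup>2 + (v z)\<^sup>2 + 2 * (u z * v z))"
    using assms L2_torus_mult_integrable[OF assms] by (auto simp: L2_torus_def)
  then have "integrable torus (\<lambda>z. (u z + v z)\<^sup>2)" by (simp add: power2_sum mult.assoc)
  then show ?thesis using assms by (auto simp: L2_torus_def torus_periodic_def)
qed

lemma fourier_add:
  assumes "integrable torus u" "integrable torus v"
  shows "fourier (\<lambda>z. u z + v z) \<xi> = fourier u \<xi> + fourier v \<xi>"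
  using ft_add[of "\<lambda>z. complex_of_real (u z)" "\<lambda>z. complex_of_real (v z)"] assms by (simp add: fourier_eq_ft)

lemma fourier_cmult: "fourier (\<lambda>z. c * u z) \<xi> = complex_of_real c * fourier u \<xi>"
  using ft_cmult[of "complex_of_real c" "\<lambda>z. complex_of_real (u z)"] by (simp add: fourier_eq_ft)

lemma fourier_diff:
  assumes "integrable torus u" "integrable torus v"
  shows "fourier (\<lambda>z. u z - v z) \<xi> = fourier u \<xi> - fourier v \<xi>"
  using fourier_add[of u "\<lambda>z. (-1) * v z"] assms by (simp add: fourier_cmult[of "-1", simplified])

lemma fourier_cong_AE:
  assumes "AE z in torus. u z = v z" "u \<in> borel_measurable torus" "v \<in> borel_measurable torus"
  shows "fourier u \<xi> = fourier v \<xi>"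
  unfolding fourier_eq_ft by (rule ft_cong_AE) (use assms in auto)

lemma fourier_inj_AE:
  assumes "integrable torus u" "integrable torus v" "\<And>\<xi>. fourier u \<xi> = fourier v \<xi>"
  shows "AE z in torus. u z = v z"
proof -
  have "AE z in torus. u z - v z = 0"
    by (rule fourier_zero_imp_AE_zero) (use assms fourier_diff in auto)
  then show ?thesis by simp
qed

text \<open>\<open>multiplier\<close> is an arbitrary choice among L2 functions with the prescribed
  coefficients. \<open>riesz_fischer\<close> shows that there is one, and uniqueness almost
  everywhere transfers its norm bound to the chosen one.\<close>

lemma multiplier_L2:
  assumes u: "u \<in> L2_torus" and s: "sq_summable (\<lambda>\<xi>. m \<xi> * fourier u \<xi>)" and m: "\<And>\<xi>. m (- \<xi>) = cnj (m \<xi>)"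
  shows "u \<in> multiplier_domain m" "multiplier m u \<in> L2_torus" "fourier (multiplier m u) \<xi> = m \<xi> * fourier u \<xi>"
    "(\<integral>z. (multiplier m u z)\<^sup>2 \<partial>torus) \<le> (2 * pi)\<^sup>2 * sqsum (\<lambda>\<xi>. m \<xi> * fourier u \<xi>)"
proof -
  obtain v where v: "v \<in> L2_torus" "\<And>\<xi>. fourier v \<xi> = m \<xi> * fourier u \<xi>"
    "(\<integral>z. (v z)\<^sup>2 \<partial>torus) \<le> (2 * pi)\<^sup>2 * sqsum (\<lambda>\<xi>. m \<xi> * fourier u \<xi>)"
    using riesz_fischer[OF s] m by (auto simp: fourier_uminus)
  show "u \<in> multiplier_domain m" using u v by (auto simp: multiplier_domain_def)
  have mu: "multiplier m u \<in> L2_torus \<and> (\<forall>\<xi>. fourier (multiplier m u) \<xi> = m \<xi> * fourier u \<xi>)"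
    unfolding multiplier_def by (rule someI[of _ v]) (use v in auto)
  then show "multiplier m u \<in> L2_torus" "fourier (multiplier m u) \<xi> = m \<xi> * fourier u \<xi>" by blast+
  have "AE z in torus. multiplier m u z = v z"
    by (rule fourier_inj_AE) (use mu v L2_torus_integrable in auto)
  then have "(\<integral>z. (multiplier m u z)\<^sup>2 \<partial>torus) = (\<integral>z. (v z)\<^sup>2 \<partial>torus)"
    using mu v by (intro integral_cong_AE) (auto simp: L2_torus_def elim!: eventually_mono)
  then show "(\<integral>z. (multiplier m u z)\<^sup>2 \<partial>torus) \<le> (2 * pi)\<^sup>2 * sqsum (\<lambda>\<xi>. m \<xi> * fourier u \<xi>)"
    using v(3) by simp
qed

lemma L2_torus_eq_fseries:
  assumes u: "u \<in> L2_torus" and s: "(\<lambda>\<xi>. cmod (fourier u \<xi>)) summable_on UNIV"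
  shows "AE z in torus. u z = Re (fseries (fourier u) z)"
proof (rule fourier_inj_AE)
  have m: "fseries (fourier u) \<in> borel_measurable torus"
    by (rule continuous_borel_measurable_torus[OF continuous_fseries[OF s]])
  show "integrable torus u" by (rule L2_torus_integrable[OF u])
  show "integrable torus (\<lambda>z. Re (fseries (fourier u) z))"
    using integrable_fseries[OF s] by simp
  show "fourier u \<xi> = fourier (\<lambda>z. Re (fseries (fourier u) z)) \<xi>" for \<xi>
    unfolding fourier_eq_ft[of "\<lambda>z. Re (fseries (fourier u) z)"]
    using fseries_real[OF s fourier_uminus] ft_fseries[OF s] by simp
qed

lemma Sobolev_sq_summable:
  assumes "u \<in> Sobolev s" "k \<le> s"
  shows "sq_summable (\<lambda>\<xi>. complex_of_real (sqrt (bracket \<xi>) ^ k) * fourier u \<xi>)"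
proof -
  have "(\<lambda>\<xi>. (bracket \<xi>) ^ s * (cmod (fourier u \<xi>))\<^sup>2) summable_on UNIV"
    using assms(1) by (simp add: Sobolev_def bracket_def)
  then show ?thesis
    unfolding sq_summable_def
  proof (rule summable_on_comparison_test)
    fix \<xi>
    have "(cmod (complex_of_real (sqrt (bracket \<xi>) ^ k) * fourier u \<xi>))\<^sup>2 = (sqrt (bracket \<xi>) ^ k)\<^sup>2 * (cmod (fourier u \<xi>))\<^sup>2"
      by (simp add: norm_mult norm_power power_mult_distrib)
    also have "(sqrt (bracket \<xi>) ^ k)\<^sup>2 = bracket \<xi> ^ k"
      by (simp add: power_mult[symmetric] mult.commute[of k 2]) (simp add: power_mult)
    also have "bracket \<xi> ^ k * (cmod (fourier u \<xi>))\<^sup>2 \<le> bracket \<xi> ^ s * (cmod (fourier u \<xi>))\<^sup>2"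
      using assms(2) by (intro mult_right_mono power_increasing) auto
    finally show "(cmod (complex_of_real (sqrt (bracket \<xi>) ^ k) * fourier u \<xi>))\<^sup>2 \<le> bracket \<xi> ^ s * (cmod (fourier u \<xi>))\<^sup>2" .
  qed auto
qed

lemma freq_norm_le_sqrt_bracket: "freq_norm \<xi> \<le> sqrt (bracket \<xi>)"
  by (rule real_le_rsqrt) (simp add: bracket_def)

lemma Sobolev_symbol_sq_summable:
  assumes "u \<in> Sobolev s" "k \<le> s" "\<And>\<xi>. cmod (m \<xi>) \<le> sqrt (bracket \<xi>) ^ k"
  shows "sq_summable (\<lambda>\<xi>. m \<xi> * fourier u \<xi>)"
  by (rule sqsum_mono(1)[OF Sobolev_sq_summable[OF assms(1,2)]])
    (use assms(3) in \<open>auto simp: norm_mult norm_power intro!: mult_right_mono\<close>)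

text \<open>Symbol of the linear part after it is moved to the right-hand side: positive values mean
  growth, and the last term is the damping.\<close>

definition symbol :: "real \<Rightarrow> real \<Rightarrow> real \<Rightarrow> int \<times> int \<Rightarrow> real" where
  "symbol \<beta> \<delta> \<epsilon> \<xi> = (\<beta> - 1) * (of_int (fst \<xi>))\<^sup>2 - (of_int (snd \<xi>))\<^sup>2 + \<delta> * freq_norm \<xi> ^ 3 - \<epsilon> * freq_norm \<xi> ^ 4"

text \<open>Two Young inequalities, first for the cubic and then for the quadratic terms, each spend
  a quarter of \<epsilon> |\<xi>|^4. The summand \<epsilon> / 2 in A restores the mixed term of (1 +
  |\<xi>|^2)^2, and a further quarter remains as the damping.\<close>

lemma symbol_le:
  fixes \<beta> \<delta> \<epsilon> :: real
  assumes "\<epsilon> > 0"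
  defines "A \<equiv> \<bar>\<beta> - 1\<bar> + \<epsilon> / 2 + \<delta>\<^sup>2 / \<epsilon>"
  shows "symbol \<beta> \<delta> \<epsilon> \<xi> \<le> (\<epsilon> / 4 + A\<^sup>2 / \<epsilon>) - \<epsilon> / 4 * (bracket \<xi>)\<^sup>2"
proof -
  define r where "r = freq_norm \<xi>"
  have r: "r \<ge> 0" by (simp add: r_def)
  have "0 \<le> (\<epsilon> * r - 2 * \<bar>\<delta>\<bar>)\<^sup>2" by simp
  then have "4 * \<epsilon> * (\<bar>\<delta>\<bar> * r) \<le> \<epsilon>\<^sup>2 * r\<^sup>2 + 4 * \<delta>\<^sup>2" by (simp add: power2_diff power_mult_distrib algebra_simps)
  then have "\<bar>\<delta>\<bar> * r \<le> \<epsilon> / 4 * r\<^sup>2 + \<delta>\<^sup>2 / \<epsilon>" using assms(1) by (simp add: field_simps power2_eq_square)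
  from mult_right_mono[OF this, of "r\<^sup>2"]
  have 1: "\<bar>\<delta>\<bar> * r ^ 3 \<le> \<epsilon> / 4 * r ^ 4 + \<delta>\<^sup>2 / \<epsilon> * r\<^sup>2"
    by (simp add: power2_eq_square power3_eq_cube power4_eq_xxxx algebra_simps)
  have "0 \<le> (\<epsilon> * r\<^sup>2 - 2 * A)\<^sup>2" by simp
  then have "4 * \<epsilon> * (A * r\<^sup>2) \<le> \<epsilon>\<^sup>2 * r ^ 4 + 4 * A\<^sup>2"
    by (simp add: power2_diff power_mult_distrib algebra_simps flip: power_mult)
  then have 2: "A * r\<^sup>2 \<le> \<epsilon> / 4 * r ^ 4 + A\<^sup>2 / \<epsilon>" using assms(1) by (simp add: field_simps power2_eq_square)
  have 3: "(\<beta> - 1) * (of_int (fst \<xi>))\<^sup>2 \<le> \<bar>\<beta> - 1\<bar> * r\<^sup>2"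
    unfolding r_def freq_norm_sq by (intro mult_mono) auto
  have 4: "\<delta> * r ^ 3 \<le> \<bar>\<delta>\<bar> * r ^ 3" using r by (intro mult_right_mono) auto
  have 5: "A * r\<^sup>2 = \<bar>\<beta> - 1\<bar> * r\<^sup>2 + \<epsilon> / 2 * r\<^sup>2 + \<delta>\<^sup>2 / \<epsilon> * r\<^sup>2" by (simp add: A_def distrib_right)
  have 6: "\<epsilon> / 4 * (bracket \<xi>)\<^sup>2 = \<epsilon> / 4 + \<epsilon> / 2 * r\<^sup>2 + \<epsilon> / 4 * r ^ 4"
    by (simp add: bracket_def r_def[symmetric] power2_sum algebra_simps flip: power_mult)
  have 7: "0 \<le> \<epsilon> / 4 * r ^ 4" using assms(1) by simp
  have 8: "\<epsilon> * r ^ 4 = 4 * (\<epsilon> / 4 * r ^ 4)" by simp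
  show ?thesis unfolding symbol_def r_def[symmetric] 6
    using 1 2 3 4 5 7 8 zero_le_power2[of "real_of_int (snd \<xi>)"] by linarith
qed

lemma symbol_reflect: "symbol \<beta> \<delta> \<epsilon> (reflect \<xi>) = symbol \<beta> \<delta> \<epsilon> \<xi>"
  by (simp add: symbol_def) (simp add: reflect_def)

text \<open>At a time with H^4 regularity every term lies in L2, so the operators, defined by
  choice, are determined by their symbols, and the almost everywhere equation can be read mode by
  mode.\<close>

lemma equation_coefficients:
  assumes u: "u \<in> Sobolev 4" and w: "w \<in> L2_torus"
    and eq: "AE z in torus. w z + u z * Dx u z + (\<beta> - 1) * Dx (Dx u) z - Dy (Dy u) z
          - \<delta> * (Lambda ^^ 3) u z + \<epsilon> * Laplacian (Laplacian u) z = 0"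
  shows "fourier w \<xi> = complex_of_real (symbol \<beta> \<delta> \<epsilon> \<xi>) * fourier u \<xi>
    + (- \<i> * of_int (fst \<xi>) / 2 * conv (fourier u) (fourier u) \<xi>)"
proof -
  note split_paired_All [simp del]
  have uL2: "u \<in> L2_torus" using u by (simp add: Sobolev_def)
  define X where "X \<xi> = \<i> * of_int (fst \<xi>)" for \<xi> :: "int \<times> int"
  define Y where "Y \<xi> = \<i> * of_int (snd \<xi>)" for \<xi> :: "int \<times> int"
  define r where "r \<xi> = complex_of_real (freq_norm \<xi>)" for \<xi>
  have rsq: "X \<xi> * X \<xi> + Y \<xi> * Y \<xi> = - (r \<xi> * r \<xi>)" for \<xi>
  proof -
    have "r \<xi> * r \<xi> = complex_of_real ((freq_norm \<xi>)\<^sup>2)" by (simp add: r_def power2_eq_square)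
    also have "\<dots> = of_int (fst \<xi>) * of_int (fst \<xi>) + of_int (snd \<xi>) * of_int (snd \<xi>)"
      unfolding freq_norm_sq by (simp add: power2_eq_square)
    finally have "r \<xi> * r \<xi> = of_int (fst \<xi>) * of_int (fst \<xi>) + of_int (snd \<xi>) * of_int (snd \<xi>)" .
    moreover have "(\<i> * c) * (\<i> * c) = - (c * c)" for c by (simp add: mult.left_commute mult.assoc)
    ultimately show ?thesis by (simp add: X_def Y_def)
  qed
  have cX: "X (- \<xi>) = cnj (X \<xi>)" and cY: "Y (- \<xi>) = cnj (Y \<xi>)" and cr: "r (- \<xi>) = cnj (r \<xi>)" for \<xi>
    by (simp_all add: X_def Y_def r_def)
  have bX: "cmod (X \<xi>) \<le> sqrt (bracket \<xi>)" and bY: "cmod (Y \<xi>) \<le> sqrt (bracket \<xi>)" and br: "cmod (r \<xi>) \<le> sqrt (bracket \<xi>)" for \<xi>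
    using freq_norm_le_sqrt_bracket[of \<xi>] abs_fst_le_freq_norm[of \<xi>] abs_snd_le_freq_norm[of \<xi>]
    by (simp_all add: X_def Y_def r_def norm_mult)
  \<comment> \<open>\<open>q\<close> is the symbol accumulated so far and k its order; one more
    first-order multiplier is admissible while k < 4, the regularity of u.\<close>
  have step: "multiplier p v \<in> L2_torus \<and> (\<forall>\<xi>. fourier (multiplier p v) \<xi> = p \<xi> * q \<xi> * fourier u \<xi>)"
    if v: "v \<in> L2_torus" "\<And>\<xi>. fourier v \<xi> = q \<xi> * fourier u \<xi>" and k: "k < 4" "\<And>\<xi>. cmod (q \<xi>) \<le> sqrt (bracket \<xi>) ^ k"
      and p: "\<And>\<xi>. cmod (p \<xi>) \<le> sqrt (bracket \<xi>)" "\<And>\<xi>. p (- \<xi>) = cnj (p \<xi>)" for p q v k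
  proof -
    have "sq_summable (\<lambda>\<xi>. (p \<xi> * q \<xi>) * fourier u \<xi>)"
    proof (rule Sobolev_symbol_sq_summable[OF u, of "Suc k"])
      show "cmod (p \<xi> * q \<xi>) \<le> sqrt (bracket \<xi>) ^ Suc k" for \<xi>
        unfolding norm_mult power_Suc by (intro mult_mono p k) auto
    qed (use k in simp)
    then have "sq_summable (\<lambda>\<xi>. p \<xi> * fourier v \<xi>)" by (simp add: v(2) mult.assoc)
    from multiplier_L2(2,3)[OF v(1) this p(2)] show ?thesis by (simp add: v(2) mult.assoc)
  qed
  have one: "fourier u \<xi> = 1 * fourier u \<xi>" for \<xi> by simp
  have Dx1: "Dx u \<in> L2_torus \<and> (\<forall>\<xi>. fourier (Dx u) \<xi> = X \<xi> * fourier u \<xi>)"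
    using step[OF uL2 one, of 0 X] bX cX by (simp add: Dx_def X_def[abs_def])
  have Dy1: "Dy u \<in> L2_torus \<and> (\<forall>\<xi>. fourier (Dy u) \<xi> = Y \<xi> * fourier u \<xi>)"
    using step[OF uL2 one, of 0 Y] bY cY by (simp add: Dy_def Y_def[abs_def])
  have Dx2: "Dx (Dx u) \<in> L2_torus \<and> (\<forall>\<xi>. fourier (Dx (Dx u)) \<xi> = X \<xi> * X \<xi> * fourier u \<xi>)"
    using step[of "Dx u" X 1 X] Dx1 bX cX by (simp add: Dx_def X_def[abs_def])
  have Dy2: "Dy (Dy u) \<in> L2_torus \<and> (\<forall>\<xi>. fourier (Dy (Dy u)) \<xi> = Y \<xi> * Y \<xi> * fourier u \<xi>)"
    using step[of "Dy u" Y 1 Y] Dy1 bY cY by (simp add: Dy_def Y_def[abs_def])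
  have brr: "cmod (- (r \<xi> * r \<xi>)) \<le> sqrt (bracket \<xi>) ^ 2" for \<xi>
    unfolding norm_minus_cancel norm_mult power2_eq_square by (intro mult_mono br) auto
  have Lap: "Laplacian v \<in> L2_torus \<and> (\<forall>\<xi>. fourier (Laplacian v) \<xi> = - (r \<xi> * r \<xi>) * q \<xi> * fourier u \<xi>)"
    if v: "v \<in> L2_torus" "\<And>\<xi>. fourier v \<xi> = q \<xi> * fourier u \<xi>" and k: "k < 3" "\<And>\<xi>. cmod (q \<xi>) \<le> sqrt (bracket \<xi>) ^ k" for q v k
  proof -
    have x1: "Dx v \<in> L2_torus \<and> (\<forall>\<xi>. fourier (Dx v) \<xi> = X \<xi> * q \<xi> * fourier u \<xi>)"
      using step[OF v, of k X] k bX cX by (simp add: Dx_def X_def[abs_def])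
    have y1: "Dy v \<in> L2_torus \<and> (\<forall>\<xi>. fourier (Dy v) \<xi> = Y \<xi> * q \<xi> * fourier u \<xi>)"
      using step[OF v, of k Y] k bY cY by (simp add: Dy_def Y_def[abs_def])
    have bq: "cmod (X \<xi> * q \<xi>) \<le> sqrt (bracket \<xi>) ^ Suc k" "cmod (Y \<xi> * q \<xi>) \<le> sqrt (bracket \<xi>) ^ Suc k" for \<xi>
      unfolding norm_mult power_Suc by (intro mult_mono bX bY k; simp)+
    have x2: "Dx (Dx v) \<in> L2_torus \<and> (\<forall>\<xi>. fourier (Dx (Dx v)) \<xi> = X \<xi> * (X \<xi> * q \<xi>) * fourier u \<xi>)"
      using step[of "Dx v" "\<lambda>\<xi>. X \<xi> * q \<xi>" "Suc k" X] x1 bq k bX cX by (simp add: Dx_def X_def[abs_def])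
    have y2: "Dy (Dy v) \<in> L2_torus \<and> (\<forall>\<xi>. fourier (Dy (Dy v)) \<xi> = Y \<xi> * (Y \<xi> * q \<xi>) * fourier u \<xi>)"
      using step[of "Dy v" "\<lambda>\<xi>. Y \<xi> * q \<xi>" "Suc k" Y] y1 bq k bY cY by (simp add: Dy_def Y_def[abs_def])
    have "fourier (Laplacian v) \<xi> = - (r \<xi> * r \<xi>) * q \<xi> * fourier u \<xi>" for \<xi>
    proof -
      have "fourier (Laplacian v) \<xi> = (X \<xi> * X \<xi> + Y \<xi> * Y \<xi>) * q \<xi> * fourier u \<xi>"
        unfolding Laplacian_def using x2 y2 L2_torus_integrable
        by (subst fourier_add) (auto simp: algebra_simps)
      then show ?thesis by (simp only: rsq)
    qed
    moreover have "Laplacian v \<in> L2_torus" unfolding Laplacian_def by (rule L2_torus_add) (use x2 y2 in auto)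
    ultimately show ?thesis by simp
  qed
  have La: "Laplacian u \<in> L2_torus \<and> (\<forall>\<xi>. fourier (Laplacian u) \<xi> = - (r \<xi> * r \<xi>) * fourier u \<xi>)"
    using Lap[OF uL2 one, of 0] by simp
  have LL: "Laplacian (Laplacian u) \<in> L2_torus \<and> (\<forall>\<xi>. fourier (Laplacian (Laplacian u)) \<xi> = - (r \<xi> * r \<xi>) * - (r \<xi> * r \<xi>) * fourier u \<xi>)"
    using Lap[of "Laplacian u" "\<lambda>\<xi>. - (r \<xi> * r \<xi>)" 2] La brr by simp
  have L1: "Lambda u \<in> L2_torus \<and> (\<forall>\<xi>. fourier (Lambda u) \<xi> = r \<xi> * fourier u \<xi>)"
    using step[OF uL2 one, of 0 r] br cr by (simp add: Lambda_def r_def[abs_def])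
  have L2: "Lambda (Lambda u) \<in> L2_torus \<and> (\<forall>\<xi>. fourier (Lambda (Lambda u)) \<xi> = r \<xi> * r \<xi> * fourier u \<xi>)"
    using step[of "Lambda u" r 1 r] L1 br cr by (simp add: Lambda_def r_def[abs_def])
  have L3: "(Lambda ^^ 3) u \<in> L2_torus \<and> (\<forall>\<xi>. fourier ((Lambda ^^ 3) u) \<xi> = r \<xi> * (r \<xi> * r \<xi>) * fourier u \<xi>)"
    using step[of "Lambda (Lambda u)" "\<lambda>\<xi>. r \<xi> * r \<xi>" 2 r] L2 br cr brr
    by (simp add: Lambda_def r_def[abs_def] numeral_3_eq_3)
  have h2: "sq_summable (\<lambda>\<xi>. complex_of_real (bracket \<xi>) * fourier u \<xi>)"
    using Sobolev_sq_summable[OF u, of 2] by simp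
  have l1: "(\<lambda>\<xi>. cmod (fourier u \<xi>)) summable_on UNIV" by (rule summable_on_abs_of_bracket[OF h2])
  \<comment> \<open>Absolute summability costs two derivatives; with the one in X this uses three of
    the four available.\<close>
  have l1X: "(\<lambda>\<xi>. cmod (X \<xi> * fourier u \<xi>)) summable_on UNIV"
  proof (rule summable_on_abs_of_bracket)
    have "sq_summable (\<lambda>\<xi>. (complex_of_real (bracket \<xi>) * X \<xi>) * fourier u \<xi>)"
    proof (rule Sobolev_symbol_sq_summable[OF u, of 3])
      show "cmod (complex_of_real (bracket \<xi>) * X \<xi>) \<le> sqrt (bracket \<xi>) ^ 3" for \<xi>
      proof -
        have "cmod (complex_of_real (bracket \<xi>) * X \<xi>) \<le> bracket \<xi> * sqrt (bracket \<xi>)"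
          unfolding norm_mult using bX[of \<xi>] by (intro mult_mono) auto
        also have "\<dots> = sqrt (bracket \<xi>) ^ 3" by (simp add: power3_eq_cube)
        finally show ?thesis .
      qed
    qed simp
    then show "sq_summable (\<lambda>\<xi>. complex_of_real (bracket \<xi>) * (X \<xi> * fourier u \<xi>))" by (simp add: mult.assoc)
  qed
  have uX: "(\<lambda>\<xi>. X \<xi> * fourier u \<xi>) = fourier (Dx u)" using Dx1 by auto
  have l1X': "(\<lambda>\<xi>. cmod (fourier (Dx u) \<xi>)) summable_on UNIV" using l1X Dx1 by simp
  \<comment> \<open>Both factors agree almost everywhere with absolutely convergent series, so the
    coefficients of the product are a convolution; the product rule then brings the derivative
    outside.\<close>
  have prod: "fourier (\<lambda>z. u z * Dx u z) \<xi> = \<i> * of_int (fst \<xi>) / 2 * conv (fourier u) (fourier u) \<xi>"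
  proof -
    have "AE z in torus. complex_of_real (u z * Dx u z) = fseries (conv (fourier u) (fourier (Dx u))) z"
      using L2_torus_eq_fseries[OF uL2 l1] L2_torus_eq_fseries[OF conjunct1[OF Dx1] l1X']
    proof eventually_elim
      case (elim z)
      have "complex_of_real (u z) = fseries (fourier u) z"
        using elim(1) fseries_real[OF l1 fourier_uminus, of z] by simp
      moreover have "complex_of_real (Dx u z) = fseries (fourier (Dx u)) z"
        using elim(2) fseries_real[OF l1X' fourier_uminus, of z] by simp
      ultimately show ?case using fseries_mult(2)[OF l1 l1X'] by simp
    qed
    then have "fourier (\<lambda>z. u z * Dx u z) \<xi> = ft (fseries (conv (fourier u) (fourier (Dx u)))) \<xi>"
      unfolding fourier_eq_ft[of "\<lambda>z. u z * Dx u z"]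
    proof (rule ft_cong_AE)
      show "(\<lambda>z. complex_of_real (u z * Dx u z)) \<in> borel_measurable torus"
        by (rule measurable_compose[OF borel_measurable_integrable[OF
          L2_torus_mult_integrable[OF uL2 conjunct1[OF Dx1]]] borel_measurable_of_real])
      show "fseries (conv (fourier u) (fourier (Dx u))) \<in> borel_measurable torus"
        by (rule continuous_borel_measurable_torus[OF continuous_fseries[OF fseries_mult(1)[OF l1 l1X']]])
    qed
    also have "\<dots> = conv (fourier u) (fourier (Dx u)) \<xi>"
      by (rule ft_fseries[OF fseries_mult(1)[OF l1 l1X']])
    also have "\<dots> = conv (\<lambda>\<xi>. X \<xi> * fourier u \<xi>) (fourier u) \<xi>" unfolding uX by (rule conv_commute)
    also have "\<dots> = \<i> * conv (\<lambda>k. of_int (fst k) * fourier u k) (fourier u) \<xi>"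
      unfolding conv_def X_def by (subst infsum_cmult_right'[symmetric]) (simp add: mult_ac)
    also have "\<dots> = \<i> / 2 * (of_int (fst \<xi>) * conv (fourier u) (fourier u) \<xi>)"
    proof -
      have "sq_summable (fourier u)" using Sobolev_sq_summable[OF u, of 0] by simp
      moreover have "sq_summable (\<lambda>k. of_int (fst k) * fourier u k)"
        by (rule Sobolev_symbol_sq_summable[OF u, of 1]) (use bX in \<open>auto simp: X_def norm_mult\<close>)
      ultimately show ?thesis by (simp add: conv_first_moment)
    qed
    finally show ?thesis by simp
  qed
  define S where "S z = w z + u z * Dx u z + ((\<beta> - 1) * Dx (Dx u) z + ((-1) * Dy (Dy u) z
          + ((- \<delta>) * (Lambda ^^ 3) u z + \<epsilon> * Laplacian (Laplacian u) z)))" for z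
  have i: "integrable torus w" "integrable torus (\<lambda>z. u z * Dx u z)"
    "integrable torus (\<lambda>z. (\<beta> - 1) * Dx (Dx u) z)" "integrable torus (\<lambda>z. (-1) * Dy (Dy u) z)"
    "integrable torus (\<lambda>z. (- \<delta>) * (Lambda ^^ 3) u z)" "integrable torus (\<lambda>z. \<epsilon> * Laplacian (Laplacian u) z)"
    using w Dx2 Dy2 L3 LL L2_torus_mult_integrable[OF uL2 conjunct1[OF Dx1]]
    by (auto intro: integrable_mult_right L2_torus_integrable)
  note i2 = Bochner_Integration.integrable_add[OF i(5) i(6)]
  note i3 = Bochner_Integration.integrable_add[OF i(4) i2]
  note i4 = Bochner_Integration.integrable_add[OF i(3) i3]
  note i5 = Bochner_Integration.integrable_add[OF i(1) i(2)]
  \<comment> \<open>Zero is written as \<open>0 * w z\<close> so that \<open>fourier_cmult\<close>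
    evaluates its coefficient.\<close>
  have S0: "fourier S \<xi> = fourier (\<lambda>z. 0 * w z) \<xi>"
  proof (rule fourier_cong_AE)
    show "AE z in torus. S z = 0 * w z" using eq by eventually_elim (simp add: S_def)
    show "S \<in> borel_measurable torus" unfolding S_def[abs_def]
      using Bochner_Integration.integrable_add[OF i5 i4] by (rule borel_measurable_integrable)
  qed simp
  have "fourier S \<xi> = 0" unfolding S0 fourier_cmult by simp
  moreover have "fourier S \<xi> = fourier w \<xi> + fourier (\<lambda>z. u z * Dx u z) \<xi> + (complex_of_real (\<beta> - 1) * (X \<xi> * X \<xi> * fourier u \<xi>)
     + (complex_of_real (-1) * (Y \<xi> * Y \<xi> * fourier u \<xi>) + (complex_of_real (- \<delta>) * (r \<xi> * (r \<xi> * r \<xi>) * fourier u \<xi>)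
     + complex_of_real \<epsilon> * (- (r \<xi> * r \<xi>) * - (r \<xi> * r \<xi>) * fourier u \<xi>))))"
    unfolding S_def[abs_def] fourier_add[OF i5 i4] fourier_add[OF i(1) i(2)] fourier_add[OF i(3) i3]
      fourier_add[OF i(4) i2] fourier_add[OF i(5) i(6)] fourier_cmult
    using Dx2 Dy2 L3 LL by simp
  ultimately have "fourier w \<xi> = - fourier (\<lambda>z. u z * Dx u z) \<xi> - (complex_of_real (\<beta> - 1) * (X \<xi> * X \<xi> * fourier u \<xi>)
     + (complex_of_real (-1) * (Y \<xi> * Y \<xi> * fourier u \<xi>) + (complex_of_real (- \<delta>) * (r \<xi> * (r \<xi> * r \<xi>) * fourier u \<xi>)
     + complex_of_real \<epsilon> * (- (r \<xi> * r \<xi>) * - (r \<xi> * r \<xi>) * fourier u \<xi>))))"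
    by (simp add: eq_neg_iff_add_eq_0 algebra_simps)
  also have "\<dots> = complex_of_real (symbol \<beta> \<delta> \<epsilon> \<xi>) * fourier u \<xi> - fourier (\<lambda>z. u z * Dx u z) \<xi>"
    by (simp add: symbol_def X_def Y_def r_def power2_eq_square power3_eq_cube power4_eq_xxxx algebra_simps)
  finally show ?thesis by (simp add: prod)
qed

text \<open>A finite subcover. Convergence of differences in H^2 yields local bounds through the
  triangle inequality, and this turns them into a bound on the whole time interval.\<close>

lemma bounded_of_locally_bounded:
  fixes f :: "'a::metric_space \<Rightarrow> real"
  assumes S: "compact S" and loc: "\<And>x. x \<in> S \<Longrightarrow> \<exists>d>0. \<exists>B. \<forall>y\<in>S. dist y x < d \<longrightarrow> f y \<le> B"
  shows "\<exists>H. \<forall>x\<in>S. f x \<le> H"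
proof -
  obtain d B where dB: "\<And>x. x \<in> S \<Longrightarrow> d x > 0" "\<And>x y. x \<in> S \<Longrightarrow> y \<in> S \<Longrightarrow> dist y x < d x \<Longrightarrow> f y \<le> B x"
    using loc by metis
  have "S \<subseteq> (\<Union>x\<in>S. ball x (d x))" using dB(1) by force
  then obtain F where F: "F \<subseteq> S" "finite F" "S \<subseteq> (\<Union>x\<in>F. ball x (d x))"
    using compactE_image[OF S, of S "\<lambda>x. ball x (d x)"] by auto
  have "f y \<le> (\<Sum>x\<in>F. \<bar>B x\<bar>)" if y: "y \<in> S" for y
  proof -
    obtain x where x: "x \<in> F" "dist y x < d x" using F(3) y by (auto simp: dist_commute)
    have "f y \<le> \<bar>B x\<bar>" using dB(2)[of x y] x F(1) y by force
    also have "\<dots> \<le> (\<Sum>x\<in>F. \<bar>B x\<bar>)" using x F(2) by (intro member_le_sum) auto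
    finally show ?thesis .
  qed
  then show ?thesis by blast
qed

lemma Sobolev_norm_diff:
  assumes "u \<in> Sobolev 2" "v \<in> Sobolev 2"
  shows "(Sobolev_norm 2 (\<lambda>z. u z - v z))\<^sup>2 = sqsum (\<lambda>\<xi>. complex_of_real (bracket \<xi>) * (fourier u \<xi> - fourier v \<xi>))"
proof -
  have "u \<in> L2_torus" "v \<in> L2_torus" using assms by (auto simp: Sobolev_def)
  then have f: "fourier (\<lambda>z. u z - v z) \<xi> = fourier u \<xi> - fourier v \<xi>" for \<xi>
    by (intro fourier_diff L2_torus_integrable)
  have "(\<Sum>\<^sub>\<infinity>\<xi>. (1 + (freq_norm \<xi>)\<^sup>2) ^ 2 * (cmod (fourier (\<lambda>z. u z - v z) \<xi>))\<^sup>2)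
     = sqsum (\<lambda>\<xi>. complex_of_real (bracket \<xi>) * (fourier u \<xi> - fourier v \<xi>))"
    unfolding sqsum_def f by (intro infsum_cong) (simp add: norm_mult power_mult_distrib bracket_def[symmetric])
  then show ?thesis unfolding Sobolev_norm_def
    using sqsum_nonneg[of "\<lambda>\<xi>. complex_of_real (bracket \<xi>) * (fourier u \<xi> - fourier v \<xi>)"] by simp
qed

lemma Sobolev_bracket:
  assumes "u \<in> Sobolev 2"
  shows "sq_summable (\<lambda>\<xi>. complex_of_real (bracket \<xi>) * fourier u \<xi>)" "sq_summable (fourier u)"
  using Sobolev_sq_summable[OF assms, of 2] Sobolev_sq_summable[OF assms, of 0] by simp_all

text \<open>The derivative of eta equals the right-hand side B only for almost every time, but that
  is enough inside the integral identity. Continuity of eta in H^2 makes B continuous mode by mode,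
  and the fundamental theorem of calculus then differentiates at every time.\<close>

lemma solution_modal_flow:
  assumes eps: "\<epsilon> > 0" and sol: "global_solution \<beta> \<delta> \<epsilon> \<eta>\<^sub>0 \<eta>"
  shows "modal_flow (\<lambda>t. fourier (\<eta> t)) (symbol \<beta> \<delta> \<epsilon>)
    (\<epsilon> / 4 + (\<bar>\<beta> - 1\<bar> + \<epsilon> / 2 + \<delta>\<^sup>2 / \<epsilon>)\<^sup>2 / \<epsilon>) (\<epsilon> / 4)"
proof -
  define a where "a t = fourier (\<eta> t)" for t
  obtain w where w: "has_time_derivative \<eta> w" and eq: "AE t in lebesgue. t > 0 \<longrightarrow> (AE z in torus.
          w t z + \<eta> t z * Dx (\<eta> t) z + (\<beta> - 1) * Dx (Dx (\<eta> t)) z - Dy (Dy (\<eta> t)) z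
          - \<delta> * (Lambda ^^ 3) (\<eta> t) z + \<epsilon> * Laplacian (Laplacian (\<eta> t)) z = 0)"
    using sol unfolding global_solution_def by blast
  have C: "\<eta> \<in> C_time_Sobolev T 2" and L: "\<eta> \<in> L2_time_Sobolev T 4" if "T > 0" for T
    using sol that unfolding global_solution_def by auto
  have H2: "\<eta> t \<in> Sobolev 2" if "t \<ge> 0" for t
    using C[of "t + 1"] that by (auto simp: C_time_Sobolev_def)
  \<comment> \<open>Squared H^2 distance between two times. The local bound and the continuity of
    each coefficient and of each convolution are all read off from its convergence to 0.\<close>
  define dd where "dd r t = sqsum (\<lambda>\<xi>. complex_of_real (bracket \<xi>) * (a r \<xi> - a t \<xi>))" for r t
  have dd: "((\<lambda>r. dd r t) \<longlongrightarrow> 0) (at t within {0..T})" if t: "t \<in> {0..T}" and T: "T > 0" for t T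
  proof -
    have "((\<lambda>r. Sobolev_norm 2 (\<lambda>z. \<eta> r z - \<eta> t z)) \<longlongrightarrow> 0) (at t within {0..T})"
      using C[OF T] t by (auto simp: C_time_Sobolev_def)
    then have "((\<lambda>r. (Sobolev_norm 2 (\<lambda>z. \<eta> r z - \<eta> t z))\<^sup>2) \<longlongrightarrow> 0\<^sup>2) (at t within {0..T})"
      by (rule tendsto_power)
    then have lim: "((\<lambda>r. (Sobolev_norm 2 (\<lambda>z. \<eta> r z - \<eta> t z))\<^sup>2) \<longlongrightarrow> 0) (at t within {0..T})" by simp
    have "\<forall>\<^sub>F r in at t within {0..T}. (Sobolev_norm 2 (\<lambda>z. \<eta> r z - \<eta> t z))\<^sup>2 = dd r t"
      unfolding dd_def a_def eventually_at_filter
      by (intro always_eventually allI impI Sobolev_norm_diff H2) (use t in auto)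
    with lim show ?thesis by (rule Lim_transform_eventually)
  qed
  have s2: "sq_summable (\<lambda>\<xi>. complex_of_real (bracket \<xi>) * a t \<xi>)" "sq_summable (a t)" if "t \<ge> 0" for t
    using Sobolev_bracket[OF H2[OF that]] by (simp_all add: a_def)
  have sd: "sq_summable (\<lambda>\<xi>. complex_of_real (bracket \<xi>) * (a r \<xi> - a t \<xi>))" if "r \<ge> 0" "t \<ge> 0" for r t
    using sq_summable_diff(1)[OF s2(1)[OF that(1)] s2(1)[OF that(2)]] by (simp add: right_diff_distrib)
  have s2d: "sq_summable (\<lambda>\<xi>. a r \<xi> - a t \<xi>)" "sqsum (\<lambda>\<xi>. a r \<xi> - a t \<xi>) \<le> dd r t" if "r \<ge> 0" "t \<ge> 0" for r t
  proof -
    have le: "cmod (a r \<xi> - a t \<xi>) \<le> cmod (complex_of_real (bracket \<xi>) * (a r \<xi> - a t \<xi>))" for \<xi>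
      using mult_right_mono[OF bracket_ge_1[of \<xi>], of "cmod (a r \<xi> - a t \<xi>)"] by (simp add: norm_mult)
    show "sq_summable (\<lambda>\<xi>. a r \<xi> - a t \<xi>)" "sqsum (\<lambda>\<xi>. a r \<xi> - a t \<xi>) \<le> dd r t"
      unfolding dd_def using sqsum_mono[OF sd[OF that] le] by auto
  qed
  have bdd: "\<exists>H. \<forall>t\<in>{0..T}. sqsum (\<lambda>\<xi>. complex_of_real (bracket \<xi>) * a t \<xi>) \<le> H" if T: "T > 0" for T
  proof (rule bounded_of_locally_bounded)
    fix t assume t: "t \<in> {0..T}"
    have "\<forall>\<^sub>F r in at t within {0..T}. dd r t < 1" using order_tendstoD(2)[OF dd[OF t T], of 1] by simp
    then obtain d where d: "d > 0" "\<And>r. r \<in> {0..T} \<Longrightarrow> r \<noteq> t \<Longrightarrow> dist r t < d \<Longrightarrow> dd r t < 1"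
      unfolding eventually_at by auto
    have "sqsum (\<lambda>\<xi>. complex_of_real (bracket \<xi>) * a r \<xi>) \<le> 2 + 2 * sqsum (\<lambda>\<xi>. complex_of_real (bracket \<xi>) * a t \<xi>)"
      if r: "r \<in> {0..T}" "dist r t < d" for r
    proof (cases "r = t")
      case True
      then show ?thesis using sqsum_nonneg[of "\<lambda>\<xi>. complex_of_real (bracket \<xi>) * a t \<xi>"] by simp
    next
      case False
      have "sqsum (\<lambda>\<xi>. complex_of_real (bracket \<xi>) * (a r \<xi> - a t \<xi>) + complex_of_real (bracket \<xi>) * a t \<xi>)
        \<le> 2 * dd r t + 2 * sqsum (\<lambda>\<xi>. complex_of_real (bracket \<xi>) * a t \<xi>)"
        unfolding dd_def by (rule sq_summable_add(2)) (use sd s2 r t in auto)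
      then show ?thesis using d(2)[OF r(1) False r(2)] by (simp add: algebra_simps)
    qed
    then show "\<exists>d>0. \<exists>B. \<forall>r\<in>{0..T}. dist r t < d \<longrightarrow> sqsum (\<lambda>\<xi>. complex_of_real (bracket \<xi>) * a r \<xi>) \<le> B"
      using d(1) by blast
  qed simp
  define B where "B t \<xi> = complex_of_real (symbol \<beta> \<delta> \<epsilon> \<xi>) * a t \<xi> + (- \<i> * of_int (fst \<xi>) / 2 * conv (a t) (a t) \<xi>)" for t \<xi>
  have cont_a: "continuous_on {0..T} (\<lambda>t. a t \<xi>)" if T: "T > 0" for T \<xi>
    unfolding continuous_on_def
  proof
    fix t assume t: "t \<in> {0..T}"
    have "((\<lambda>r. sqrt (dd r t)) \<longlongrightarrow> sqrt 0) (at t within {0..T})" by (intro tendsto_real_sqrt dd t T)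
    then have lim: "((\<lambda>r. sqrt (dd r t)) \<longlongrightarrow> 0) (at t within {0..T})" by simp
    have "((\<lambda>r. a r \<xi> - a t \<xi>) \<longlongrightarrow> 0) (at t within {0..T})"
    proof (rule Lim_null_comparison[OF _ lim])
      show "\<forall>\<^sub>F r in at t within {0..T}. norm (a r \<xi> - a t \<xi>) \<le> sqrt (dd r t)"
        unfolding eventually_at_filter
      proof (intro always_eventually allI impI)
        fix r assume "r \<in> {0..T}"
        then have r: "r \<ge> 0" "t \<ge> 0" using t by auto
        show "norm (a r \<xi> - a t \<xi>) \<le> sqrt (dd r t)"
          by (rule order_trans[OF norm_le_sqrt_sqsum[OF s2d(1)[OF r], of \<xi>]]) (rule real_sqrt_le_mono[OF s2d(2)[OF r]])
      qed
    qed
    then show "((\<lambda>r. a r \<xi>) \<longlongrightarrow> a t \<xi>) (at t within {0..T})" by (simp add: LIM_zero_iff)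
  qed
  have cont_conv: "continuous_on {0..T} (\<lambda>t. conv (a t) (a t) \<xi>)" if T: "T > 0" for T \<xi>
    unfolding continuous_on_def
  proof
    fix t assume t: "t \<in> {0..T}"
    obtain H where H: "\<And>t. t \<in> {0..T} \<Longrightarrow> sqsum (\<lambda>\<xi>. complex_of_real (bracket \<xi>) * a t \<xi>) \<le> H" using bdd[OF T] by blast
    have le_H: "sqsum (a r) \<le> H" if "r \<in> {0..T}" for r
    proof -
      have le: "cmod (a r \<xi>) \<le> cmod (complex_of_real (bracket \<xi>) * a r \<xi>)" for \<xi>
        using mult_right_mono[OF bracket_ge_1[of \<xi>], of "cmod (a r \<xi>)"] by (simp add: norm_mult)
      have "sqsum (a r) \<le> sqsum (\<lambda>\<xi>. complex_of_real (bracket \<xi>) * a r \<xi>)"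
        by (rule sqsum_mono(2)[OF s2(1) le]) (use that in simp)
      also have "\<dots> \<le> H" by (rule H[OF that])
      finally show ?thesis .
    qed
    have "((\<lambda>r. sqrt (dd r t) * sqrt (4 * H)) \<longlongrightarrow> sqrt 0 * sqrt (4 * H)) (at t within {0..T})"
      by (intro tendsto_intros tendsto_real_sqrt dd t T)
    then have lim: "((\<lambda>r. sqrt (dd r t) * sqrt (4 * H)) \<longlongrightarrow> 0) (at t within {0..T})" by simp
    have "((\<lambda>r. conv (a r) (a r) \<xi> - conv (a t) (a t) \<xi>) \<longlongrightarrow> 0) (at t within {0..T})"
    proof (rule Lim_null_comparison[OF _ lim])
      show "\<forall>\<^sub>F r in at t within {0..T}. norm (conv (a r) (a r) \<xi> - conv (a t) (a t) \<xi>) \<le> sqrt (dd r t) * sqrt (4 * H)"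
        unfolding eventually_at_filter
      proof (intro always_eventually allI impI)
        fix r assume rT: "r \<in> {0..T}"
        then have r: "r \<ge> 0" "t \<ge> 0" using t by auto
        note sp = sq_summable_add[OF s2(2)[OF r(1)] s2(2)[OF r(2)]]
        have "norm (conv (a r) (a r) \<xi> - conv (a t) (a t) \<xi>) \<le> sqrt (sqsum (\<lambda>\<xi>. a r \<xi> - a t \<xi>)) * sqrt (sqsum (\<lambda>\<xi>. a r \<xi> + a t \<xi>))"
          unfolding conv_diff_sq[OF s2(2)[OF r(1)] s2(2)[OF r(2)]] by (rule norm_conv_le[OF s2d(1)[OF r] sp(1)])
        also have "\<dots> \<le> sqrt (dd r t) * sqrt (4 * H)"
          using s2d(2)[OF r] sp(2) le_H[OF rT] le_H[OF t] sqsum_nonneg[of "\<lambda>\<xi>. a r \<xi> - a t \<xi>"]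
          by (intro mult_mono real_sqrt_le_mono) (auto simp: sqsum_nonneg dd_def)
        finally show "norm (conv (a r) (a r) \<xi> - conv (a t) (a t) \<xi>) \<le> sqrt (dd r t) * sqrt (4 * H)" .
      qed
    qed
    then show "((\<lambda>r. conv (a r) (a r) \<xi>) \<longlongrightarrow> conv (a t) (a t) \<xi>) (at t within {0..T})" by (simp add: LIM_zero_iff)
  qed
  have cont_B: "continuous_on {0..T} (\<lambda>t. B t \<xi>)" if T: "T > 0" for T \<xi>
    unfolding B_def by (intro continuous_intros cont_a cont_conv T)
  have w_eq: "AE t in lebesgue. t \<in> {0..T} \<longrightarrow> (\<forall>\<xi>. fourier (w t) \<xi> = B t \<xi>)" if T: "T > 0" for T
  proof -
    have "AE t in lebesgue. t \<in> {0..T} \<longrightarrow> w t \<in> Sobolev 0" "AE t in lebesgue. t \<in> {0..T} \<longrightarrow> \<eta> t \<in> Sobolev 4"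
      using w L[OF T] T by (auto simp: has_time_derivative_def L2_time_Sobolev_def)
    \<comment> \<open>The equation is given for positive times, so the single time 0 is discarded as
      a null set.\<close>
    moreover have "AE t in lebesgue. t \<noteq> (0::real)"
      by (rule AE_completion) (rule AE_lborel_singleton)
    ultimately show ?thesis using eq
    proof eventually_elim
      case (elim t)
      show ?case
      proof (intro impI allI)
        fix \<xi> assume t: "t \<in> {0..T}"
        then have "t > 0" using elim(3) by simp
        then show "fourier (w t) \<xi> = B t \<xi>"
          unfolding B_def a_def
          by (intro equation_coefficients) (use elim t in \<open>auto simp: Sobolev_def\<close>)
      qed
    qed
  qed
  have integral_eq: "a t \<xi> = a 0 \<xi> + integral {0..t} (\<lambda>s. B s \<xi>)" if t: "t \<in> {0..T}" and T: "T > 0" for t T \<xi>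
  proof -
    have cB: "continuous_on {0..t} (\<lambda>s. B s \<xi>)" using cont_B[OF T] by (rule continuous_on_subset) (use t in auto)
    have iB: "set_integrable lebesgue {0..t} (\<lambda>s. B s \<xi>)" by (rule absolutely_integrable_continuous_real[OF cB])
    have "a t \<xi> - a 0 \<xi> = (LINT s:{0..t}|lebesgue. fourier (w s) \<xi>)"
      using w t unfolding has_time_derivative_def a_def atLeastAtMost_iff by blast
    also have "\<dots> = (LINT s:{0..t}|lebesgue. B s \<xi>)"
      unfolding set_lebesgue_integral_def
    proof (rule integral_cong_AE)
      \<comment> \<open>Measurability is given on intervals {0..T} with T > 0; the interval {0..t},
        which may be degenerate, is cut out of a longer one.\<close>
      have mT: "(\<lambda>s. indicator {0..T} s *\<^sub>R fourier (w s) \<xi>) \<in> borel_measurable lebesgue"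
        using w T by (auto simp: has_time_derivative_def L2_time_Sobolev_def set_borel_measurable_def simp del: split_paired_All)
      have "(\<lambda>s. indicator {0..t} s *\<^sub>R (indicator {0..T} s *\<^sub>R fourier (w s) \<xi>)) \<in> borel_measurable lebesgue"
        by (rule borel_measurable_scaleR[OF borel_measurable_indicator mT]) auto
      moreover have "(\<lambda>s. indicator {0..t} s *\<^sub>R (indicator {0..T} s *\<^sub>R fourier (w s) \<xi>)) = (\<lambda>s. indicator {0..t} s *\<^sub>R fourier (w s) \<xi>)"
        using t by (auto simp: indicator_def)
      ultimately show "(\<lambda>s. indicator {0..t} s *\<^sub>R fourier (w s) \<xi>) \<in> borel_measurable lebesgue" by simp
      show "(\<lambda>s. indicator {0..t} s *\<^sub>R B s \<xi>) \<in> borel_measurable lebesgue"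
        using iB by (simp add: set_integrable_def borel_measurable_integrable)
      show "AE s in lebesgue. indicator {0..t} s *\<^sub>R fourier (w s) \<xi> = indicator {0..t} s *\<^sub>R B s \<xi>"
        using w_eq[OF T] by eventually_elim (use t in \<open>auto simp: indicator_def simp del: split_paired_All\<close>)
    qed
    also have "\<dots> = integral {0..t} (\<lambda>s. B s \<xi>)" by (rule set_lebesgue_integral_eq_integral(2)[OF iB])
    finally show ?thesis by (simp add: algebra_simps)
  qed
  have deriv: "((\<lambda>t. a t \<xi>) has_vector_derivative B t \<xi>) (at t within {0..})" if t: "t \<ge> 0" for t \<xi>
  proof -
    \<comment> \<open>With t strictly below T, differentiability within {0..T} and within {0..} are
      the same.\<close>
    define T where "T = t + 1"
    have T: "T > 0" "t \<in> {0..T}" using t by (auto simp: T_def)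
    have d: "((\<lambda>u. a 0 \<xi> + integral {0..u} (\<lambda>s. B s \<xi>)) has_vector_derivative 0 + B t \<xi>) (at t within {0..T})"
      by (intro has_vector_derivative_add has_vector_derivative_const integral_has_vector_derivative cont_B T)
    have "((\<lambda>t. a t \<xi>) has_vector_derivative 0 + B t \<xi>) (at t within {0..T})"
      by (rule has_vector_derivative_transform[OF T(2) integral_eq[OF _ T(1)] d])
    moreover have "at t within {0..T} = at t within {0..}"
      by (rule at_within_nhd[of t "{..<T}"]) (auto simp: T_def)
    ultimately show ?thesis by simp
  qed
  show ?thesis
  proof (unfold_locales, goal_cases)
    case 1 then show ?case using eps by simp
  next
    case 2 then show ?case using eps by simp
  next
    case (3 \<xi>) then show ?case by (rule symbol_le[OF eps])
  next
    case (4 \<xi>) then show ?case by (rule symbol_reflect)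
  next
    case (5 t \<xi>) show ?case by (rule fourier_uminus)
  next
    case (6 t) then show ?case using s2(1) by (simp add: a_def)
  next
    case (7 T)
    \<comment> \<open>The bound was proved for positive T; the maximum also covers the remaining
      values.\<close>
    obtain H where H: "\<forall>t\<in>{0..max T 1}. sqsum (\<lambda>\<xi>. complex_of_real (bracket \<xi>) * a t \<xi>) \<le> H" using bdd[of "max T 1"] by fastforce
    have "sqsum (\<lambda>\<xi>. complex_of_real (bracket \<xi>) * a t \<xi>) \<le> H" if "t \<in> {0..T}" for t
      by (rule bspec[OF H]) (use that in auto)
    then show ?case unfolding a_def by blast
  next
    case (8 t \<xi>) then show ?case using deriv[of t \<xi>] by (simp add: a_def[abs_def] B_def)
  qed
qed

text \<open>Change of variables by x -> 2 pi - x, which preserves the square and differs from the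
  reflection x -> -x by a period.\<close>

lemma fourier_odd:
  assumes u: "u \<in> H2_od"
  shows "fourier u (reflect \<xi>) = - fourier u \<xi>"
proof -
  define Q where "Q = {0..2 * pi} \<times> {0..2 * pi}"
  have Q: "Q \<in> sets lebesgue" by (simp add: Q_def)
  have L2: "u \<in> L2_torus" and odd: "AE z in lebesgue. - u (- fst z, snd z) = u z"
    using u by (auto simp: H2_od_def Sobolev_def)
  define c :: "real \<times> real \<Rightarrow> real" where "c j = (if j = (1, 0) then -1 else 1)" for j
  \<comment> \<open>Written over \<open>Basis\<close> to match the affine change of variables for
    Lebesgue measure; the scaling factors are -1 and 1, so the Jacobian is 1.\<close>
  define T where "T z = (2 * pi, 0) + (\<Sum>j\<in>Basis. (c j * (z \<bullet> j)) *\<^sub>R j)" for z :: "real \<times> real"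
  have T: "T z = (2 * pi - fst z, snd z)" for z
    unfolding T_def by (cases z) (simp add: Basis_prod_def c_def sum.union_disjoint image_Un)
  have c0: "\<And>j. j \<in> Basis \<Longrightarrow> c j \<noteq> 0" by (simp add: c_def)
  have prod1: "(\<Prod>j\<in>Basis. \<bar>c j\<bar>) = 1" by (rule prod.neutral) (simp add: c_def)
  have mT: "T \<in> lebesgue \<rightarrow>\<^sub>M lebesgue"
    unfolding T_def[abs_def] by (rule lebesgue_affine_measurable[OF c0])
  have "lebesgue = density (distr lebesgue lebesgue T) (\<lambda>_. \<Prod>j\<in>Basis. \<bar>c j\<bar>)"
    unfolding T_def[abs_def] by (rule lebesgue_affine_euclidean[OF c0])
  then have leb: "distr lebesgue lebesgue T = lebesgue" by (simp add: prod1 density_1)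
  define g where "g \<xi> z = indicator Q z *\<^sub>R (character (- \<xi>) z * complex_of_real (u z))" for \<xi> z
  have ft: "fourier u \<xi> = complex_of_real (1 / (2 * pi)\<^sup>2) * (\<integral>z. g \<xi> z \<partial>lebesgue)" for \<xi>
    unfolding fourier_eq_ft ft_def torus_def Q_def[symmetric] g_def
    by (subst integral_restrict_space) (use Q in auto)
  have mg: "g \<xi> \<in> borel_measurable lebesgue" for \<xi>
  proof -
    have "(\<lambda>z. character (- \<xi>) z * complex_of_real (u z)) \<in> borel_measurable torus"
      using L2_torus_measurable[OF L2] by measurable
    then have "(\<lambda>z. character (- \<xi>) z * complex_of_real (u z)) \<in> borel_measurable (lebesgue_on Q)"
      by (simp only: torus_def Q_def)
    then show ?thesis unfolding g_def[abs_def]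
      by (subst borel_measurable_restrict_space_iff[symmetric]) (use Q in auto)
  qed
  have "(\<integral>z. g \<xi> z \<partial>lebesgue) = - (\<integral>z. g (reflect \<xi>) z \<partial>lebesgue)" for \<xi>
  proof -
    have "(\<integral>z. g \<xi> z \<partial>lebesgue) = (\<integral>z. g \<xi> z \<partial>distr lebesgue lebesgue T)" by (simp add: leb)
    also have "\<dots> = (\<integral>z. g \<xi> (T z) \<partial>lebesgue)" by (rule integral_distr[OF mT mg])
    also have "\<dots> = (\<integral>z. - g (reflect \<xi>) z \<partial>lebesgue)"
    proof (rule integral_cong_AE)
      show "(\<lambda>z. g \<xi> (T z)) \<in> borel_measurable lebesgue" by (rule measurable_compose[OF mT mg])
      show "(\<lambda>z. - g (reflect \<xi>) z) \<in> borel_measurable lebesgue" using mg by measurable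
      show "AE z in lebesgue. g \<xi> (T z) = - g (reflect \<xi>) z"
        using odd
      proof eventually_elim
        case (elim z)
        have "u (2 * pi - fst z, snd z) = u (- fst z, snd z)"
        proof -
        have "\<forall>x y. u (x + 2 * pi, y) = u (x, y)" using L2 by (simp add: L2_torus_def torus_periodic_def)
        then have "u (- fst z + 2 * pi, snd z) = u (- fst z, snd z)" by blast
        moreover have "2 * pi - fst z = - fst z + 2 * pi" by simp
        ultimately show ?thesis by (simp only:)
      qed
      then have "u (T z) = - u z" using elim by (simp add: T)
        moreover have "indicator Q (T z) = (indicator Q z :: real)" by (cases z) (auto simp: T Q_def indicator_def)
        moreover have "character (- \<xi>) (T z) = character (- reflect \<xi>) z"
        proof -
          have "character (- \<xi>) (T z) = cis (of_int (- fst \<xi>) * (- fst z + 2 * pi) + of_int (- snd \<xi>) * snd z)"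
            by (simp add: character_def T)
          also have "\<dots> = cis (of_int (- fst \<xi>) * - fst z + of_int (- snd \<xi>) * snd z)" by (rule cis_periodic)
          finally show ?thesis by (simp add: character_def reflect_def)
        qed
        ultimately show ?case by (simp add: g_def)
      qed
    qed
    finally show ?thesis by simp
  qed
  note flip = this
  show ?thesis unfolding ft flip[of \<xi>] by simp
qed

subsection \<open>Analyticity\<close>

lemma exp_has_sum:
  fixes p :: "'a::{banach, real_normed_field}"
  shows "((\<lambda>n. p ^ n /\<^sub>R fact n) has_sum exp p) UNIV"
  by (rule norm_summable_imp_has_sum[OF summable_norm_exp exp_converges])

text \<open>The second part evaluates the absolute sum exactly; it is the majorant when such
  products are summed over all frequencies.\<close>

lemma exp_product_has_sum:
  fixes p q :: complex
  shows "((\<lambda>(j, k). (p ^ j /\<^sub>R fact j) * (q ^ k /\<^sub>R fact k)) has_sum exp p * exp q) (UNIV \<times> UNIV)"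
    "((\<lambda>(j, k). norm ((p ^ j /\<^sub>R fact j) * (q ^ k /\<^sub>R fact k))) has_sum exp (cmod p) * exp (cmod q)) (UNIV \<times> UNIV)"
proof -
  have n: "norm (p ^ j /\<^sub>R fact j) = cmod p ^ j /\<^sub>R fact j" for p :: complex and j by (simp add: norm_power)
  have row: "((\<lambda>k. norm ((p ^ j /\<^sub>R fact j) * (q ^ k /\<^sub>R fact k))) has_sum (cmod p ^ j /\<^sub>R fact j) * exp (cmod q)) UNIV" for j
    unfolding norm_mult n by (intro has_sum_cmult_right exp_has_sum)
  have col: "((\<lambda>j. (cmod p ^ j /\<^sub>R fact j) * exp (cmod q)) has_sum exp (cmod p) * exp (cmod q)) UNIV"
    by (intro has_sum_cmult_left exp_has_sum)
  have s: "(\<lambda>(j, k). norm ((p ^ j /\<^sub>R fact j) * (q ^ k /\<^sub>R fact k))) summable_on UNIV \<times> UNIV"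
    by (rule summable_on_SigmaI[where g = "\<lambda>j. (cmod p ^ j /\<^sub>R fact j) * exp (cmod q)"])
      (use row has_sum_imp_summable[OF col] in auto)
  show "((\<lambda>(j, k). norm ((p ^ j /\<^sub>R fact j) * (q ^ k /\<^sub>R fact k))) has_sum exp (cmod p) * exp (cmod q)) (UNIV \<times> UNIV)"
    by (rule has_sum_SigmaI[OF _ col s]) (use row in auto)
  have "(\<lambda>x. norm (case x of (j, k) \<Rightarrow> (p ^ j /\<^sub>R fact j) * (q ^ k /\<^sub>R fact k))) summable_on UNIV \<times> UNIV"
    using s by (simp add: case_prod_unfold)
  then have s': "(\<lambda>(j, k). (p ^ j /\<^sub>R fact j) * (q ^ k /\<^sub>R fact k)) summable_on UNIV \<times> UNIV"
    by (rule abs_summable_summable)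
  show "((\<lambda>(j, k). (p ^ j /\<^sub>R fact j) * (q ^ k /\<^sub>R fact k)) has_sum exp p * exp q) (UNIV \<times> UNIV)"
  proof (rule has_sum_SigmaI[OF _ _ s'])
    show "((\<lambda>k. case (j, k) of (j, k) \<Rightarrow> (p ^ j /\<^sub>R fact j) * (q ^ k /\<^sub>R fact k)) has_sum (p ^ j /\<^sub>R fact j) * exp q) UNIV" for j
      unfolding prod.case by (intro has_sum_cmult_right exp_has_sum)
    show "((\<lambda>j. (p ^ j /\<^sub>R fact j) * exp q) has_sum exp p * exp q) UNIV"
      by (intro has_sum_cmult_left exp_has_sum)
  qed
qed

text \<open>Each character is expanded about (x0, y0) into a product of two exponential series. The
  exponential weight makes the sum over frequencies and exponents absolutely convergent for |x - x0|
  and |y - y0| below \<rho>, so the frequencies can be summed first. The radius is the same at every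
  centre.\<close>

lemma real_analytic_fseries:
  assumes \<rho>: "\<rho> > 0"
    and s: "(\<lambda>\<xi>. cmod (c \<xi>) * exp (\<rho> * (\<bar>of_int (fst \<xi>)\<bar> + \<bar>of_int (snd \<xi>)\<bar>))) summable_on UNIV"
  shows "real_analytic (\<lambda>z. Re (fseries c z))"
  unfolding real_analytic_def
proof (intro allI)
  fix x0 y0 :: real
  define d where "d \<xi> = c \<xi> * character \<xi> (x0, y0)" for \<xi>
  define e where "e \<xi> = (\<lambda>(j, k). d \<xi> * (((\<i> * of_int (fst \<xi>)) ^ j /\<^sub>R fact j) * ((\<i> * of_int (snd \<xi>)) ^ k /\<^sub>R fact k)))" for \<xi> :: "int \<times> int"
  define A where "A q = Re (\<Sum>\<^sub>\<infinity>\<xi>. e \<xi> q)" for q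
  show "\<exists>r>0. \<exists>a. \<forall>x y. \<bar>x - x0\<bar> < r \<longrightarrow> \<bar>y - y0\<bar> < r \<longrightarrow>
     ((\<lambda>(j, k). a (j, k) * (x - x0) ^ j * (y - y0) ^ k) has_sum Re (fseries c (x, y))) UNIV"
  proof (intro exI[of _ \<rho>] exI[of _ A] conjI allI impI \<rho>)
    fix x y assume xy: "\<bar>x - x0\<bar> < \<rho>" "\<bar>y - y0\<bar> < \<rho>"
    define X Y where "X = x - x0" and "Y = y - y0"
    define p q where "p \<xi> = \<i> * of_int (fst \<xi>) * complex_of_real X" and "q \<xi> = \<i> * of_int (snd \<xi>) * complex_of_real Y" for \<xi> :: "int \<times> int"
    define f where "f = (\<lambda>(\<xi>, (j, k)). d \<xi> * ((p \<xi> ^ j /\<^sub>R fact j) * (q \<xi> ^ k /\<^sub>R fact k)))"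
    have f_e: "f (\<xi>, (j, k)) = e \<xi> (j, k) * complex_of_real (X ^ j * Y ^ k)" for \<xi> j k
      by (simp add: f_def e_def p_def q_def power_mult_distrib scaleR_conv_of_real mult_ac)
    have nf: "((\<lambda>jk. norm (f (\<xi>, jk))) has_sum cmod (c \<xi>) * (exp (cmod (p \<xi>)) * exp (cmod (q \<xi>)))) (UNIV \<times> UNIV)" for \<xi>
    proof -
      have "(\<lambda>jk. norm (f (\<xi>, jk))) = (\<lambda>jk. cmod (c \<xi>) * (case jk of (j, k) \<Rightarrow> norm ((p \<xi> ^ j /\<^sub>R fact j) * (q \<xi> ^ k /\<^sub>R fact k))))"
        by (auto simp: f_def d_def norm_mult)
      then show ?thesis using has_sum_cmult_right[OF exp_product_has_sum(2)[of "p \<xi>" "q \<xi>"], of "cmod (c \<xi>)"] by simp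
    qed
    have sn: "(\<lambda>z. norm (f z)) summable_on UNIV \<times> (UNIV \<times> UNIV)"
    proof (rule summable_on_SigmaI[OF nf])
      show "(\<lambda>\<xi>. cmod (c \<xi>) * (exp (cmod (p \<xi>)) * exp (cmod (q \<xi>)))) summable_on UNIV"
      proof (rule summable_on_comparison_test[OF s])
        fix \<xi> :: "int \<times> int"
        have "cmod (p \<xi>) + cmod (q \<xi>) \<le> \<bar>of_int (fst \<xi>)\<bar> * \<rho> + \<bar>of_int (snd \<xi>)\<bar> * \<rho>"
        proof -
          have "\<bar>X\<bar> \<le> \<rho>" "\<bar>Y\<bar> \<le> \<rho>" using xy by (auto simp: X_def Y_def)
          then show ?thesis by (intro add_mono) (auto simp: p_def q_def norm_mult intro!: mult_left_mono)
        qed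
        then have "exp (cmod (p \<xi>)) * exp (cmod (q \<xi>)) \<le> exp (\<rho> * (\<bar>of_int (fst \<xi>)\<bar> + \<bar>of_int (snd \<xi>)\<bar>))"
          by (simp add: exp_add[symmetric] algebra_simps)
        then show "cmod (c \<xi>) * (exp (cmod (p \<xi>)) * exp (cmod (q \<xi>))) \<le> cmod (c \<xi>) * exp (\<rho> * (\<bar>of_int (fst \<xi>)\<bar> + \<bar>of_int (snd \<xi>)\<bar>))"
          by (rule mult_left_mono) simp
      qed auto
    qed auto
    have sf: "f summable_on UNIV \<times> (UNIV \<times> UNIV)" by (rule abs_summable_summable[OF sn])
    have sc: "(\<lambda>\<xi>. cmod (c \<xi>)) summable_on UNIV"
    proof (rule summable_on_comparison_test[OF s])
      fix \<xi> :: "int \<times> int"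
      have "1 \<le> exp (\<rho> * (\<bar>of_int (fst \<xi>)\<bar> + \<bar>of_int (snd \<xi>)\<bar>))" using \<rho> by simp
      from mult_left_mono[OF this, of "cmod (c \<xi>)"]
      show "cmod (c \<xi>) \<le> cmod (c \<xi>) * exp (\<rho> * (\<bar>of_int (fst \<xi>)\<bar> + \<bar>of_int (snd \<xi>)\<bar>))" by simp
    qed auto
    have total: "(f has_sum fseries c (x, y)) (UNIV \<times> (UNIV \<times> UNIV))"
    proof (rule has_sum_SigmaI[OF _ _ sf])
      show "((\<lambda>jk. f (\<xi>, jk)) has_sum c \<xi> * character \<xi> (x, y)) (UNIV \<times> UNIV)" for \<xi>
      proof -
        have "exp (p \<xi>) * exp (q \<xi>) = cis (of_int (fst \<xi>) * X) * cis (of_int (snd \<xi>) * Y)"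
          by (simp add: cis_conv_exp p_def q_def mult_ac)
        then have "d \<xi> * (exp (p \<xi>) * exp (q \<xi>)) = c \<xi> * character \<xi> (x, y)"
          by (simp add: d_def character_def cis_mult X_def Y_def algebra_simps)
        moreover have "(\<lambda>jk. f (\<xi>, jk)) = (\<lambda>jk. d \<xi> * (case jk of (j, k) \<Rightarrow> (p \<xi> ^ j /\<^sub>R fact j) * (q \<xi> ^ k /\<^sub>R fact k)))"
          by (auto simp: f_def)
        ultimately show ?thesis using has_sum_cmult_right[OF exp_product_has_sum(1)[of "p \<xi>" "q \<xi>"], of "d \<xi>"] by simp
      qed
      show "((\<lambda>\<xi>. c \<xi> * character \<xi> (x, y)) has_sum fseries c (x, y)) UNIV"
        unfolding fseries_def by (rule has_sum_infsum) (rule fseries_summable(2)[OF sc])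
    qed
    have bij: "bij_betw prod.swap (UNIV :: ((nat \<times> nat) \<times> (int \<times> int)) set) UNIV"
      by (rule bij_swap)
    have tot': "((\<lambda>(jk, \<xi>). f (\<xi>, jk)) has_sum fseries c (x, y)) (UNIV \<times> UNIV)"
    proof -
      have "(\<lambda>(jk, \<xi>). f (\<xi>, jk)) = (\<lambda>z. f (prod.swap z))" by (auto simp: fun_eq_iff)
      then show ?thesis using has_sum_reindex_bij_betw[OF bij, of f] total by simp
    qed
    have "((\<lambda>jk. \<Sum>\<^sub>\<infinity>\<xi>. f (\<xi>, jk)) has_sum fseries c (x, y)) UNIV"
    proof (rule has_sum_SigmaD[OF tot'])
      show "((\<lambda>\<xi>. case (jk, \<xi>) of (jk, \<xi>) \<Rightarrow> f (\<xi>, jk)) has_sum (\<Sum>\<^sub>\<infinity>\<xi>. f (\<xi>, jk))) UNIV" for jk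
        using summable_on_SigmaD1[of "\<lambda>jk \<xi>. f (\<xi>, jk)" UNIV "\<lambda>_. UNIV" jk] has_sum_imp_summable[OF tot'] by simp
    qed
    from has_sum_Re[OF this]
    have "((\<lambda>jk. Re (\<Sum>\<^sub>\<infinity>\<xi>. f (\<xi>, jk))) has_sum Re (fseries c (x, y))) UNIV" .
    also have "(\<lambda>jk. Re (\<Sum>\<^sub>\<infinity>\<xi>. f (\<xi>, jk))) = (\<lambda>(j, k). A (j, k) * (x - x0) ^ j * (y - y0) ^ k)"
    proof (intro ext, clarify)
      fix j k
      have "(\<Sum>\<^sub>\<infinity>\<xi>. f (\<xi>, (j, k))) = (\<Sum>\<^sub>\<infinity>\<xi>. e \<xi> (j, k)) * complex_of_real (X ^ j * Y ^ k)"
        unfolding f_e by (rule infsum_cmult_left')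
      then show "Re (\<Sum>\<^sub>\<infinity>\<xi>. f (\<xi>, (j, k))) = A (j, k) * (x - x0) ^ j * (y - y0) ^ k"
        by (simp add: A_def X_def Y_def mult.assoc flip: of_real_power of_real_mult)
    qed
    finally show "((\<lambda>(j, k). A (j, k) * (x - x0) ^ j * (y - y0) ^ k) has_sum Re (fseries c (x, y))) UNIV" .
  qed
qed

lemma torus_periodic_int:
  assumes "torus_periodic u"
  shows "u (x + 2 * pi * of_int m, y + 2 * pi * of_int n) = u (x, y)"
proof -
  have nat: "u (x + 2 * pi * real m, y + 2 * pi * real n) = u (x, y)" for x y and m n :: nat
  proof -
    have 1: "u (x + 2 * pi * real m, y) = u (x, y)" for x y m
    proof (induction m)
      case (Suc m)
      have "u (x + 2 * pi * real (Suc m), y) = u ((x + 2 * pi * real m) + 2 * pi, y)" by (simp add: algebra_simps)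
      also have "\<dots> = u (x + 2 * pi * real m, y)" using assms unfolding torus_periodic_def by blast
      finally show ?case using Suc by simp
    qed simp
    have 2: "u (x, y + 2 * pi * real n) = u (x, y)" for x y n
    proof (induction n)
      case (Suc n)
      have "u (x, y + 2 * pi * real (Suc n)) = u (x, (y + 2 * pi * real n) + 2 * pi)" by (simp add: algebra_simps)
      also have "\<dots> = u (x, y + 2 * pi * real n)" using assms unfolding torus_periodic_def by blast
      finally show ?case using Suc by simp
    qed simp
    show ?thesis by (simp only: 1 2)
  qed
  define x' y' where "x' = x - 2 * pi * real (nat (- m))" and "y' = y - 2 * pi * real (nat (- n))"
  have k: "real_of_int m = real (nat m) - real (nat (- m))" "real_of_int n = real (nat n) - real (nat (- n))" by linarith+
  have "x + 2 * pi * of_int m = x' + 2 * pi * real (nat m)" "y + 2 * pi * of_int n = y' + 2 * pi * real (nat n)"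
    unfolding k x'_def y'_def by (simp_all add: algebra_simps)
  then have "u (x + 2 * pi * of_int m, y + 2 * pi * of_int n) = u (x', y')" using nat by (simp only:)
  also have "\<dots> = u (x' + 2 * pi * real (nat (- m)), y' + 2 * pi * real (nat (- n)))" by (rule nat[symmetric])
  also have "\<dots> = u (x, y)" by (simp add: x'_def y'_def)
  finally show ?thesis .
qed

text \<open>By periodicity the exceptional set in the plane is covered by countably many translates
  of the one in the square, each of them null.\<close>

lemma AE_torus_imp_AE_lebesgue:
  assumes u: "torus_periodic u" and v: "torus_periodic v" and ae: "AE z in torus. u z = v z"
  shows "AE z in lebesgue. u z = v z"
proof -
  define Q where "Q = {0..2 * pi} \<times> {0..2 * pi}"
  define N where "N = {z \<in> Q. u z \<noteq> v z}"
  have "AE z in lebesgue. z \<in> Q \<longrightarrow> u z = v z"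
    using ae unfolding torus_def Q_def by (subst (asm) AE_restrict_space_iff) auto
  then have "AE z in lebesgue. z \<notin> N" by eventually_elim (auto simp: N_def)
  then obtain N' where "negligible N'" "{z. \<not> z \<notin> N} \<subseteq> N'" unfolding eventually_ae_filter_negligible by blast
  then have negN: "negligible N" by (auto intro: negligible_subset)
  define S where "S = (\<Union>(m, n)\<in>(UNIV :: (int \<times> int) set). (+) (2 * pi * of_int m, 2 * pi * of_int n) ` N)"
  have "negligible S"
    unfolding S_def
    by (rule negligible_countable_Union[OF countable_image]) (auto intro: negligible_translation negN)
  moreover have "{z. u z \<noteq> v z} \<subseteq> S"
  proof
    fix z assume z: "z \<in> {z. u z \<noteq> v z}"
    define m n where "m = \<lfloor>fst z / (2 * pi)\<rfloor>" and "n = \<lfloor>snd z / (2 * pi)\<rfloor>"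
    define z' where "z' = (fst z - 2 * pi * of_int m, snd z - 2 * pi * of_int n)"
    have red: "t - 2 * pi * of_int \<lfloor>t / (2 * pi)\<rfloor> \<in> {0..2 * pi}" for t :: real
    proof -
      define q where "q = t / (2 * pi)"
      have t: "t = 2 * pi * q" by (simp add: q_def)
      have "2 * pi * of_int \<lfloor>q\<rfloor> \<le> 2 * pi * q" "2 * pi * q \<le> 2 * pi * (of_int \<lfloor>q\<rfloor> + 1)"
        by (intro mult_left_mono; linarith | simp)+
      then have "2 * pi * of_int \<lfloor>q\<rfloor> \<le> t" "t \<le> 2 * pi * (of_int \<lfloor>q\<rfloor> + 1)" unfolding t by auto
      then show ?thesis unfolding q_def[symmetric] by (simp add: distrib_left)
    qed
    have zz: "z = (fst z' + 2 * pi * of_int m, snd z' + 2 * pi * of_int n)" by (simp add: z'_def prod_eq_iff)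
    have "u z = u z'" "v z = v z'"
      using torus_periodic_int[OF u, of "fst z'" m "snd z'" n] torus_periodic_int[OF v, of "fst z'" m "snd z'" n] zz by simp_all
    then have "z' \<in> N" using z red by (simp add: N_def Q_def z'_def m_def n_def)
    moreover have "z = (2 * pi * of_int m, 2 * pi * of_int n) + z'" by (simp add: z'_def prod_eq_iff)
    ultimately show "z \<in> S" unfolding S_def by blast
  qed
  ultimately have "negligible {z. u z \<noteq> v z}" by (rule negligible_subset)
  then show ?thesis by (auto simp: negligible_iff_null_sets dest: AE_not_in)
qed

lemma tanh_le_self: "0 \<le> x \<Longrightarrow> tanh x \<le> (x::real)"
proof -
  assume x: "0 \<le> x"
  have "0 - tanh 0 \<le> x - tanh x"
  proof (rule DERIV_nonneg_imp_nondecreasing[OF x])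
    fix y :: real
    have "((\<lambda>x. x - tanh x) has_real_derivative 1 - (1 - (tanh y)\<^sup>2)) (at y)"
      by (auto intro!: derivative_eq_intros)
    then show "\<exists>d. ((\<lambda>x. x - tanh x) has_real_derivative d) (at y) \<and> 0 \<le> d" by (intro exI conjI) auto
  qed
  then show ?thesis by simp
qed

text \<open>Quadratic Taylor bound for exp. It trades a part of the exponential weight for one more
  power of \<open>bracket\<close>, which is what summability over the lattice lacks.\<close>

lemma bracket_le_exp:
  assumes "s > 0"
  shows "min 1 (s\<^sup>2 / 2) * bracket \<xi> \<le> exp (s * freq_norm \<xi>)"
proof -
  define r where "r = freq_norm \<xi>"
  have r: "r \<ge> 0" by (simp add: r_def)
  have "min 1 (s\<^sup>2 / 2) * bracket \<xi> = min 1 (s\<^sup>2 / 2) * 1 + min 1 (s\<^sup>2 / 2) * r\<^sup>2"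
    by (simp add: bracket_def r_def distrib_left)
  also have "\<dots> \<le> 1 * 1 + s\<^sup>2 / 2 * r\<^sup>2" by (intro add_mono mult_right_mono) auto
  also have "\<dots> \<le> 1 + s * r + (s * r)\<^sup>2 / 2" using r assms by (simp add: power_mult_distrib)
  also have "\<dots> \<le> exp (s * r)" by (rule exp_lower_Taylor_quadratic) (use r assms in simp)
  finally show ?thesis by (simp add: r_def)
qed

text \<open>The weight is split in halves: one is traded for a power of \<open>bracket\<close>,
  which makes the coefficients summable, and the other dominates exp(\<tau>/4 (|\<xi>_1| +
  |\<xi>_2|)), because the sum of the two components is at most 2 |\<xi>|. The latter is the radius
  of analyticity.\<close>

lemma analytic_of_gevrey:
  assumes u: "u \<in> L2_torus" and tau: "\<tau> > 0"
    and g: "\<And>\<xi>. exp (\<tau> * freq_norm \<xi>) * cmod (fourier u \<xi>) \<le> R / bracket \<xi>"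
  shows "\<exists>g. real_analytic g \<and> (AE z in lebesgue. u z = g z)"
proof -
  define s where "s = \<tau> / 2"
  define \<mu> where "\<mu> = min 1 (s\<^sup>2 / 2)"
  have s0: "s > 0" using tau by (simp add: s_def)
  have \<mu>: "\<mu> > 0" using s0 by (simp add: \<mu>_def)
  have le: "cmod (fourier u \<xi>) * exp (\<tau> / 4 * (\<bar>of_int (fst \<xi>)\<bar> + \<bar>of_int (snd \<xi>)\<bar>)) \<le> (R / \<mu>) * (1 / (bracket \<xi>)\<^sup>2)" for \<xi>
  proof -
    have "\<tau> / 4 * (\<bar>of_int (fst \<xi>)\<bar> + \<bar>of_int (snd \<xi>)\<bar>) \<le> \<tau> / 4 * (freq_norm \<xi> + freq_norm \<xi>)"
      using tau by (intro mult_left_mono add_mono abs_fst_le_freq_norm abs_snd_le_freq_norm) auto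
    also have "\<dots> = s * freq_norm \<xi>" by (simp add: s_def)
    finally have "cmod (fourier u \<xi>) * exp (\<tau> / 4 * (\<bar>of_int (fst \<xi>)\<bar> + \<bar>of_int (snd \<xi>)\<bar>)) \<le> cmod (fourier u \<xi>) * exp (s * freq_norm \<xi>)"
      by (intro mult_left_mono) auto
    also have "\<dots> \<le> (R / \<mu>) * (1 / (bracket \<xi>)\<^sup>2)"
    proof -
      define E where "E = exp (s * freq_norm \<xi>)"
      have E: "\<mu> * bracket \<xi> \<le> E" unfolding E_def \<mu>_def by (rule bracket_le_exp[OF s0])
      have "exp (\<tau> * freq_norm \<xi>) = E * E" by (simp add: E_def s_def exp_add[symmetric] algebra_simps)
      then have *: "E * (E * cmod (fourier u \<xi>)) \<le> R / bracket \<xi>" using g[of \<xi>] by (simp add: mult.assoc)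
      have "(\<mu> * bracket \<xi>) * (E * cmod (fourier u \<xi>)) \<le> E * (E * cmod (fourier u \<xi>))"
        using E by (intro mult_right_mono) (auto simp: E_def)
      with * have "(\<mu> * bracket \<xi>) * (E * cmod (fourier u \<xi>)) \<le> R / bracket \<xi>" by linarith
      then show ?thesis using \<mu> unfolding E_def[symmetric] by (simp add: field_simps power2_eq_square)
    qed
    finally show ?thesis .
  qed
  have S: "(\<lambda>\<xi>. cmod (fourier u \<xi>) * exp (\<tau> / 4 * (\<bar>of_int (fst \<xi>)\<bar> + \<bar>of_int (snd \<xi>)\<bar>))) summable_on UNIV"
    by (rule summable_on_comparison_test[OF summable_on_cmult_right[OF summable_on_inverse_bracket_sq, of "R / \<mu>"] le]) auto
  have l1: "(\<lambda>\<xi>. cmod (fourier u \<xi>)) summable_on UNIV"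
  proof (rule summable_on_comparison_test[OF S])
    fix \<xi> :: "int \<times> int"
    have "1 \<le> exp (\<tau> / 4 * (\<bar>of_int (fst \<xi>)\<bar> + \<bar>of_int (snd \<xi>)\<bar>))" using tau by simp
    from mult_left_mono[OF this, of "cmod (fourier u \<xi>)"]
    show "cmod (fourier u \<xi>) \<le> cmod (fourier u \<xi>) * exp (\<tau> / 4 * (\<bar>of_int (fst \<xi>)\<bar> + \<bar>of_int (snd \<xi>)\<bar>))" by simp
  qed auto
  have "real_analytic (\<lambda>z. Re (fseries (fourier u) z))"
    by (rule real_analytic_fseries[OF _ S]) (use tau in simp)
  moreover have "AE z in lebesgue. u z = Re (fseries (fourier u) z)"
  proof (rule AE_torus_imp_AE_lebesgue)
    show "torus_periodic u" using u by (simp add: L2_torus_def)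
    show "torus_periodic (\<lambda>z. Re (fseries (fourier u) z))"
      by (simp add: torus_periodic_def fseries_def character_periodic)
  qed (rule L2_torus_eq_fseries[OF u l1])
  ultimately show ?thesis by blast
qed

section \<open>Gevrey bound and analyticity of the solution\<close>

theorem theorem4:
  fixes \<beta> \<gamma> \<delta> \<epsilon> lam L :: real and \<eta>\<^sub>0 :: "real \<times> real \<Rightarrow> real"
  assumes "\<beta> > 0" and "0 \<le> \<gamma>" and "\<gamma> \<le> 2"
    and "L > 0" and "lam = 2 * pi / L" and "\<delta> = \<gamma> * lam" and "\<epsilon> = lam\<^sup>2"
    and "\<eta>\<^sub>0 \<in> H2_od"
  shows "\<exists>T\<^sub>0 C :: real. T\<^sub>0 > 0 \<and>
    (\<forall>\<eta>. global_solution \<beta> \<delta> \<epsilon> \<eta>\<^sub>0 \<eta> \<longrightarrow>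
      (\<forall>t>0. let \<sigma> = min (tanh t) (tanh (T\<^sub>0 / 2)) in
        \<eta> t \<in> multiplier_domain (exp_Lambda_symbol \<sigma>) \<and>
        (L2_norm (exp_Lambda \<sigma> (\<eta> t)))\<^sup>2 \<le> 1 + 2 * C\<^sup>2) \<and>
      (\<forall>t>0. \<exists>g. real_analytic g \<and> (AE z in lebesgue. \<eta> t z = g z)))"
proof -
  have eps: "\<epsilon> > 0" using assms(4,5,7) by simp
  define c0 where "c0 = \<epsilon> / 4 + (\<bar>\<beta> - 1\<bar> + \<epsilon> / 2 + \<delta>\<^sup>2 / \<epsilon>)\<^sup>2 / \<epsilon>"
  have c0: "c0 \<ge> 0" using eps by (simp add: c0_def)
  obtain T R where T: "T > 0" and R: "R > 0"
    and bound: "\<And>a s \<tau> \<xi>. modal_flow a (symbol \<beta> \<delta> \<epsilon>) c0 (\<epsilon> / 4) \<Longrightarrow> a 0 = fourier \<eta>\<^sub>0 \<Longrightarrow> s \<ge> 0 \<Longrightarrow> \<tau> \<in> {0..T} \<Longrightarrow>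
      exp (\<tau> * freq_norm \<xi>) * cmod (a (s + \<tau>) \<xi>) \<le> R / bracket \<xi>"
    
  proof (rule modal_flow_gevrey[where b = "fourier \<eta>\<^sub>0" and lam = "symbol \<beta> \<delta> \<epsilon>"])
    show "c0 \<ge> 0" by (rule c0)
    show "\<epsilon> / 4 > 0" using eps by simp
    show "fourier \<eta>\<^sub>0 (reflect \<xi>) = - fourier \<eta>\<^sub>0 \<xi>" for \<xi> by (rule fourier_odd[OF assms(8)])
  qed (rule that)
  \<comment> \<open>\<open>C\<^sup>2\<close> is Parseval's factor (2 pi)^2 times the bound of
    \<open>sqsum_le_of_bracket\<close> for coefficients below
    \<open>R / bracket \<xi>\<close>.\<close>
  define C where "C = 2 * pi * R * sqrt lattice_const"
  have C: "C\<^sup>2 = (2 * pi)\<^sup>2 * (R\<^sup>2 * lattice_const)"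
    using lattice_const_pos by (simp add: C_def power_mult_distrib)
  have main: "(let \<sigma> = min (tanh t) (tanh (T / 2)) in
        \<eta> t \<in> multiplier_domain (exp_Lambda_symbol \<sigma>) \<and>
        (L2_norm (exp_Lambda \<sigma> (\<eta> t)))\<^sup>2 \<le> 1 + 2 * C\<^sup>2)"
    "\<exists>g. real_analytic g \<and> (AE z in lebesgue. \<eta> t z = g z)"
    if sol: "global_solution \<beta> \<delta> \<epsilon> \<eta>\<^sub>0 \<eta>" and t: "t > 0" for \<eta> t
  proof -
    have H2: "\<eta> r \<in> Sobolev 2" if "r \<ge> 0" for r
    proof -
      have "\<eta> \<in> C_time_Sobolev (r + 1) 2" using sol that by (auto simp: global_solution_def)
      then show ?thesis using that by (auto simp: C_time_Sobolev_def)
    qed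
    have L2: "\<eta> r \<in> L2_torus" if "r \<ge> 0" for r using H2[OF that] by (simp add: Sobolev_def)
    have flow: "modal_flow (\<lambda>t. fourier (\<eta> t)) (symbol \<beta> \<delta> \<epsilon>) c0 (\<epsilon> / 4)"
      unfolding c0_def by (rule solution_modal_flow[OF eps sol])
    have init: "fourier (\<eta> 0) = fourier \<eta>\<^sub>0"
    proof
      have "\<eta>\<^sub>0 \<in> L2_torus" using assms(8) by (simp add: H2_od_def Sobolev_def)
      then show "fourier (\<eta> 0) \<xi> = fourier \<eta>\<^sub>0 \<xi>" for \<xi>
        using sol L2[of 0] by (intro fourier_cong_AE L2_torus_measurable) (auto simp: global_solution_def)
    qed
    \<comment> \<open>The Gevrey estimate is restarted at time t - \<tau>: from the initial time
      while t \<le> T / 2, and from a time T / 2 earlier afterwards. As tanh x \<le> x for x \<ge>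
      0, the radius in the statement is at most \<tau>.\<close>
    define \<tau> where "\<tau> = min t (T / 2)"
    have tau: "\<tau> > 0" "\<tau> \<in> {0..T}" "t - \<tau> \<ge> 0" using t T by (auto simp: \<tau>_def)
    have gev: "exp (\<tau> * freq_norm \<xi>) * cmod (fourier (\<eta> t) \<xi>) \<le> R / bracket \<xi>" for \<xi>
      using bound[OF flow init tau(3) tau(2), of \<xi>] by simp
    show "\<exists>g. real_analytic g \<and> (AE z in lebesgue. \<eta> t z = g z)"
      by (rule analytic_of_gevrey[OF L2 tau(1) gev]) (use t in simp)
    define \<sigma> where "\<sigma> = min (tanh t) (tanh (T / 2))"
    have "\<sigma> \<le> \<tau>"
      using tanh_le_self[of t] tanh_le_self[of "T / 2"] t T by (auto simp: \<sigma>_def \<tau>_def min_def)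
    have le: "cmod (exp_Lambda_symbol \<sigma> \<xi> * fourier (\<eta> t) \<xi>) \<le> R / bracket \<xi>" for \<xi>
    proof -
      have "exp (\<sigma> * freq_norm \<xi>) \<le> exp (\<tau> * freq_norm \<xi>)"
        using \<open>\<sigma> \<le> \<tau>\<close> by (simp add: mult_right_mono)
      from mult_right_mono[OF this, of "cmod (fourier (\<eta> t) \<xi>)"] show ?thesis
        using gev[of \<xi>] by (simp add: exp_Lambda_symbol_def norm_mult)
    qed
    note ss = sqsum_le_of_bracket[of "\<lambda>\<xi>. exp_Lambda_symbol \<sigma> \<xi> * fourier (\<eta> t) \<xi>", OF le]
    have sym: "exp_Lambda_symbol \<sigma> (- \<xi>) = cnj (exp_Lambda_symbol \<sigma> \<xi>)" for \<xi>
      by (simp add: exp_Lambda_symbol_def)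
    have Lt: "\<eta> t \<in> L2_torus" using L2[of t] t by simp
    note mul = multiplier_L2[OF Lt ss(1) sym]
    have "(L2_norm (exp_Lambda \<sigma> (\<eta> t)))\<^sup>2 = (\<integral>z. (exp_Lambda \<sigma> (\<eta> t) z)\<^sup>2 \<partial>torus)"
      by (simp add: L2_norm_def)
    also have "\<dots> \<le> (2 * pi)\<^sup>2 * sqsum (\<lambda>\<xi>. exp_Lambda_symbol \<sigma> \<xi> * fourier (\<eta> t) \<xi>)"
      unfolding exp_Lambda_def by (rule mul(4))
    also have "\<dots> \<le> C\<^sup>2" unfolding C using ss(2) by (intro mult_left_mono) auto
    also have "\<dots> \<le> 1 + 2 * C\<^sup>2" by simp
    finally have "(L2_norm (exp_Lambda \<sigma> (\<eta> t)))\<^sup>2 \<le> 1 + 2 * C\<^sup>2" .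
    then show "let \<sigma> = min (tanh t) (tanh (T / 2)) in
        \<eta> t \<in> multiplier_domain (exp_Lambda_symbol \<sigma>) \<and>
        (L2_norm (exp_Lambda \<sigma> (\<eta> t)))\<^sup>2 \<le> 1 + 2 * C\<^sup>2"
      unfolding Let_def \<sigma>_def[symmetric] using mul(1) by simp
  qed
  show ?thesis
    by (rule exI[of _ T], rule exI[of _ C]) (use T main in blast)
qed

end
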